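(* Let $(A,m,u)$ be an algebra in an abelian monoidal category $(\mathcal{M},\otimes,\mathbf{1})$. The following assertions are equivalent: (a) $A$ is separable, i.e. the multiplication $m:A\otimes A\to A$ has a section in the category ${}_A\mathcal{M}_A$ of $(A,A)$-bimodules. (b) $\mathbf{H}^1(A,M)=0$ for all $M\in{}_A\mathcal{M}_A$. (c) $\mathbf{H}^n(A,M)=0$ for all $M\in{}_A\mathcal{M}_A$ and all $n>0$.
   Context: $(\mathcal{M},\otimes,\mathbf{1})$ is a monoidal category with $\mathcal{M}$ abelian; associativity and unit constraints are suppressed. An algebra in $\mathcal{M}$ is an object $A$ with morphisms $m:A\otimes A\to A$, $u:\mathbf{1}\to A$ satisfying the associativity and unit axioms; ${}_A\mathcal{M}_A$ is the category of objects of $\mathcal M$ with compatible left and right (associative, unital) $A$-actions. Let $\mathcal{E}$ be the class of epimorphisms of ${}_A\mathcal{M}_A$ that have a section in $\mathcal{M}$. A bimodule $P$ is $\mathcal{E}$-projective if ${}_A\mathcal{M}_A(P,\varepsilon)$ is surjective for each $\varepsilon\in\mathcal{E}$. A morphism is $\mathcal{E}$-admissible if, in its canonical factorization (monomorphism)$\circ$(epimorphism), the epimorphism is in $\mathcal{E}$. An $\mathcal{E}$-projective resolution of $N$ is an exact sequence $\cdots\to P_1\to P_0\to N\to0$ in ${}_A\mathcal{M}_A$ with all maps $\mathcal{E}$-admissible and all $P_n$ $\mathcal{E}$-projective; such resolutions exist for every $N$ and are unique up to homotopy. $\mathbf{Ext}^\bullet_{\mathcal{E}}(N,M)$ is the cohomology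 of ${}_A\mathcal{M}_A(P_\bullet,M)$. The Hochschild cohomology of $A$ with coefficients in $M$ is $\mathbf{H}^\bullet(A,M)=\mathbf{Ext}^\bullet_{\mathcal{E}}(A,M)$.
   Formalization: The tensor product is assumed additive in each variable; without this (e.g. when the tensor product is the direct sum) the bimodule category has no zero morphisms or Hom-groups, so the Ext groups are undefined. *)

theory Defs
  imports "HOL-Algebra.Elementary_Groups"
begin

section \<open>Preadditive and abelian categories\<close>

text \<open>
  Hom-sets are indexed by pairs of objects and need not be disjoint; composition, addition and
  the tensor product are total functions that are only constrained on composable, parallel,
  resp. well-typed arguments.  This lets a category of bimodules share the morphisms
  (and their composition and addition) of the underlying category.
\<close>

record ('o, 'm) precat =
  Ob :: "'o set"
  Hom :: "'o \<Rightarrow> 'o \<Rightarrow> 'm set"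
  Id :: "'o \<Rightarrow> 'm"
  comp :: "'m \<Rightarrow> 'm \<Rightarrow> 'm"  (infixl \<open>\<cdot>\<index>\<close> 70)
  madd :: "'m \<Rightarrow> 'm \<Rightarrow> 'm"
  mzero :: "'o \<Rightarrow> 'o \<Rightarrow> 'm"

definition hom_group :: "('o, 'm, 'x) precat_scheme \<Rightarrow> 'o \<Rightarrow> 'o \<Rightarrow> 'm monoid" where
  "hom_group C X Y = \<lparr>carrier = Hom C X Y, mult = madd C, one = mzero C X Y\<rparr>"

locale cat =
  fixes C :: "('o, 'm, 'x) precat_scheme" (structure)
  assumes Id_in: "X \<in> Ob C \<Longrightarrow> Id C X \<in> Hom C X X"
    and comp_in: "\<lbrakk>X \<in> Ob C; Y \<in> Ob C; Z \<in> Ob C; f \<in> Hom C X Y; g \<in> Hom C Y Z\<rbrakk>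
      \<Longrightarrow> g \<cdot> f \<in> Hom C X Z"
    and comp_Id: "\<lbrakk>X \<in> Ob C; Y \<in> Ob C; f \<in> Hom C X Y\<rbrakk> \<Longrightarrow> f \<cdot> Id C X = f"
    and Id_comp: "\<lbrakk>X \<in> Ob C; Y \<in> Ob C; f \<in> Hom C X Y\<rbrakk> \<Longrightarrow> Id C Y \<cdot> f = f"
    and comp_assoc: "\<lbrakk>W \<in> Ob C; X \<in> Ob C; Y \<in> Ob C; Z \<in> Ob C;
        f \<in> Hom C W X; g \<in> Hom C X Y; h \<in> Hom C Y Z\<rbrakk> \<Longrightarrow> h \<cdot> g \<cdot> f = h \<cdot> (g \<cdot> f)"

locale preadditive_cat = cat +
  assumes hom_comm_group: "\<lbrakk>X \<in> Ob C; Y \<in> Ob C\<rbrakk> \<Longrightarrow> comm_group (hom_group C X Y)"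
    and comp_madd_right: "\<lbrakk>X \<in> Ob C; Y \<in> Ob C; Z \<in> Ob C; f \<in> Hom C X Y; f' \<in> Hom C X Y;
        g \<in> Hom C Y Z\<rbrakk> \<Longrightarrow> g \<cdot> madd C f f' = madd C (g \<cdot> f) (g \<cdot> f')"
    and comp_madd_left: "\<lbrakk>X \<in> Ob C; Y \<in> Ob C; Z \<in> Ob C; f \<in> Hom C X Y; g \<in> Hom C Y Z;
        g' \<in> Hom C Y Z\<rbrakk> \<Longrightarrow> madd C g g' \<cdot> f = madd C (g \<cdot> f) (g' \<cdot> f)"

definition is_mono :: "('o, 'm, 'x) precat_scheme \<Rightarrow> 'o \<Rightarrow> 'o \<Rightarrow> 'm \<Rightarrow> bool" where
  "is_mono C X Y f \<longleftrightarrow> f \<in> Hom C X Y \<and>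
    (\<forall>W\<in>Ob C. \<forall>g\<in>Hom C W X. \<forall>h\<in>Hom C W X. f \<cdot>\<^bsub>C\<^esub> g = f \<cdot>\<^bsub>C\<^esub> h \<longrightarrow> g = h)"

definition is_epi :: "('o, 'm, 'x) precat_scheme \<Rightarrow> 'o \<Rightarrow> 'o \<Rightarrow> 'm \<Rightarrow> bool" where
  "is_epi C X Y f \<longleftrightarrow> f \<in> Hom C X Y \<and>
    (\<forall>Z\<in>Ob C. \<forall>g\<in>Hom C Y Z. \<forall>h\<in>Hom C Y Z. g \<cdot>\<^bsub>C\<^esub> f = h \<cdot>\<^bsub>C\<^esub> f \<longrightarrow> g = h)"

definition has_section :: "('o, 'm, 'x) precat_scheme \<Rightarrow> 'o \<Rightarrow> 'o \<Rightarrow> 'm \<Rightarrow> bool" where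
  "has_section C X Y f \<longleftrightarrow> f \<in> Hom C X Y \<and> (\<exists>s\<in>Hom C Y X. f \<cdot>\<^bsub>C\<^esub> s = Id C Y)"

definition is_inverse :: "('o, 'm, 'x) precat_scheme \<Rightarrow> 'o \<Rightarrow> 'o \<Rightarrow> 'm \<Rightarrow> 'm \<Rightarrow> bool" where
  "is_inverse C X Y f g \<longleftrightarrow> f \<in> Hom C X Y \<and> g \<in> Hom C Y X \<and>
    g \<cdot>\<^bsub>C\<^esub> f = Id C X \<and> f \<cdot>\<^bsub>C\<^esub> g = Id C Y"

definition is_iso :: "('o, 'm, 'x) precat_scheme \<Rightarrow> 'o \<Rightarrow> 'o \<Rightarrow> 'm \<Rightarrow> bool" where
  "is_iso C X Y f \<longleftrightarrow> (\<exists>g. is_inverse C X Y f g)"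

definition inverse_of :: "('o, 'm, 'x) precat_scheme \<Rightarrow> 'o \<Rightarrow> 'o \<Rightarrow> 'm \<Rightarrow> 'm" where
  "inverse_of C X Y f = (THE g. is_inverse C X Y f g)"

definition is_zero_object :: "('o, 'm, 'x) precat_scheme \<Rightarrow> 'o \<Rightarrow> bool" where
  "is_zero_object C Z \<longleftrightarrow> Z \<in> Ob C \<and>
    (\<forall>X\<in>Ob C. (\<exists>!f. f \<in> Hom C X Z) \<and> (\<exists>!f. f \<in> Hom C Z X))"

definition is_biproduct ::
  "('o, 'm, 'x) precat_scheme \<Rightarrow> 'o \<Rightarrow> 'o \<Rightarrow> 'o \<Rightarrow> 'm \<Rightarrow> 'm \<Rightarrow> 'm \<Rightarrow> 'm \<Rightarrow> bool" where
  "is_biproduct C X Y S i j p q \<longleftrightarrow> S \<in> Ob C \<and>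
    i \<in> Hom C X S \<and> j \<in> Hom C Y S \<and> p \<in> Hom C S X \<and> q \<in> Hom C S Y \<and>
    p \<cdot>\<^bsub>C\<^esub> i = Id C X \<and> q \<cdot>\<^bsub>C\<^esub> j = Id C Y \<and>
    q \<cdot>\<^bsub>C\<^esub> i = mzero C X Y \<and> p \<cdot>\<^bsub>C\<^esub> j = mzero C Y X \<and>
    madd C (i \<cdot>\<^bsub>C\<^esub> p) (j \<cdot>\<^bsub>C\<^esub> q) = Id C S"

definition is_kernel :: "('o, 'm, 'x) precat_scheme \<Rightarrow> 'o \<Rightarrow> 'o \<Rightarrow> 'm \<Rightarrow> 'o \<Rightarrow> 'm \<Rightarrow> bool" where
  "is_kernel C X Y f K k \<longleftrightarrow> K \<in> Ob C \<and> k \<in> Hom C K X \<and> f \<cdot>\<^bsub>C\<^esub> k = mzero C K Y \<and>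
    (\<forall>W\<in>Ob C. \<forall>g\<in>Hom C W X. f \<cdot>\<^bsub>C\<^esub> g = mzero C W Y \<longrightarrow>
      (\<exists>!h. h \<in> Hom C W K \<and> k \<cdot>\<^bsub>C\<^esub> h = g))"

definition is_cokernel :: "('o, 'm, 'x) precat_scheme \<Rightarrow> 'o \<Rightarrow> 'o \<Rightarrow> 'm \<Rightarrow> 'o \<Rightarrow> 'm \<Rightarrow> bool" where
  "is_cokernel C X Y f Q q \<longleftrightarrow> Q \<in> Ob C \<and> q \<in> Hom C Y Q \<and> q \<cdot>\<^bsub>C\<^esub> f = mzero C X Q \<and>
    (\<forall>Z\<in>Ob C. \<forall>g\<in>Hom C Y Z. g \<cdot>\<^bsub>C\<^esub> f = mzero C X Z \<longrightarrow>
      (\<exists>!h. h \<in> Hom C Q Z \<and> h \<cdot>\<^bsub>C\<^esub> q = g))"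

locale abelian_cat = preadditive_cat +
  assumes ex_zero_object: "\<exists>Z. is_zero_object C Z"
    and ex_biproduct: "\<lbrakk>X \<in> Ob C; Y \<in> Ob C\<rbrakk> \<Longrightarrow> \<exists>S i j p q. is_biproduct C X Y S i j p q"
    and ex_kernel: "\<lbrakk>X \<in> Ob C; Y \<in> Ob C; f \<in> Hom C X Y\<rbrakk> \<Longrightarrow> \<exists>K k. is_kernel C X Y f K k"
    and ex_cokernel: "\<lbrakk>X \<in> Ob C; Y \<in> Ob C; f \<in> Hom C X Y\<rbrakk> \<Longrightarrow> \<exists>Q q. is_cokernel C X Y f Q q"
    and mono_is_kernel: "\<lbrakk>X \<in> Ob C; Y \<in> Ob C; is_mono C X Y f\<rbrakk>
      \<Longrightarrow> \<exists>Z\<in>Ob C. \<exists>g\<in>Hom C Y Z. is_kernel C Y Z g X f"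
    and epi_is_cokernel: "\<lbrakk>X \<in> Ob C; Y \<in> Ob C; is_epi C X Y f\<rbrakk>
      \<Longrightarrow> \<exists>W\<in>Ob C. \<exists>g\<in>Hom C W X. is_cokernel C W X g Y f"


section \<open>Abelian monoidal categories\<close>

record ('o, 'm) moncat = "('o, 'm) precat" +
  tob :: "'o \<Rightarrow> 'o \<Rightarrow> 'o"  (infixr \<open>\<otimes>\<^sub>o\<index>\<close> 75)
  tmor :: "'m \<Rightarrow> 'm \<Rightarrow> 'm"  (infixr \<open>\<otimes>\<^sub>m\<index>\<close> 75)
  unitob :: 'o
  asc :: "'o \<Rightarrow> 'o \<Rightarrow> 'o \<Rightarrow> 'm"
  lun :: "'o \<Rightarrow> 'm"
  run :: "'o \<Rightarrow> 'm"

locale monoidal_cat = cat M for M :: "('o, 'm, 'x) moncat_scheme" (structure) +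
  assumes unitob_in: "unitob M \<in> Ob M"
    and tob_in: "\<lbrakk>X \<in> Ob M; Y \<in> Ob M\<rbrakk> \<Longrightarrow> X \<otimes>\<^sub>o Y \<in> Ob M"
    and tmor_in: "\<lbrakk>X \<in> Ob M; X' \<in> Ob M; Y \<in> Ob M; Y' \<in> Ob M; f \<in> Hom M X X'; g \<in> Hom M Y Y'\<rbrakk>
      \<Longrightarrow> f \<otimes>\<^sub>m g \<in> Hom M (X \<otimes>\<^sub>o Y) (X' \<otimes>\<^sub>o Y')"
    and tmor_Id: "\<lbrakk>X \<in> Ob M; Y \<in> Ob M\<rbrakk> \<Longrightarrow> Id M X \<otimes>\<^sub>m Id M Y = Id M (X \<otimes>\<^sub>o Y)"
    and tmor_comp: "\<lbrakk>X \<in> Ob M; X' \<in> Ob M; X'' \<in> Ob M; Y \<in> Ob M; Y' \<in> Ob M; Y'' \<in> Ob M;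
        f \<in> Hom M X X'; f' \<in> Hom M X' X''; g \<in> Hom M Y Y'; g' \<in> Hom M Y' Y''\<rbrakk>
      \<Longrightarrow> (f' \<cdot> f) \<otimes>\<^sub>m (g' \<cdot> g) = (f' \<otimes>\<^sub>m g') \<cdot> (f \<otimes>\<^sub>m g)"
    and asc_iso: "\<lbrakk>X \<in> Ob M; Y \<in> Ob M; Z \<in> Ob M\<rbrakk>
      \<Longrightarrow> is_iso M ((X \<otimes>\<^sub>o Y) \<otimes>\<^sub>o Z) (X \<otimes>\<^sub>o (Y \<otimes>\<^sub>o Z)) (asc M X Y Z)"
    and asc_natural: "\<lbrakk>X \<in> Ob M; X' \<in> Ob M; Y \<in> Ob M; Y' \<in> Ob M; Z \<in> Ob M; Z' \<in> Ob M;
        f \<in> Hom M X X'; g \<in> Hom M Y Y'; h \<in> Hom M Z Z'\<rbrakk>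
      \<Longrightarrow> asc M X' Y' Z' \<cdot> ((f \<otimes>\<^sub>m g) \<otimes>\<^sub>m h) = (f \<otimes>\<^sub>m (g \<otimes>\<^sub>m h)) \<cdot> asc M X Y Z"
    and lun_iso: "X \<in> Ob M \<Longrightarrow> is_iso M (unitob M \<otimes>\<^sub>o X) X (lun M X)"
    and lun_natural: "\<lbrakk>X \<in> Ob M; Y \<in> Ob M; f \<in> Hom M X Y\<rbrakk>
      \<Longrightarrow> lun M Y \<cdot> (Id M (unitob M) \<otimes>\<^sub>m f) = f \<cdot> lun M X"
    and run_iso: "X \<in> Ob M \<Longrightarrow> is_iso M (X \<otimes>\<^sub>o unitob M) X (run M X)"
    and run_natural: "\<lbrakk>X \<in> Ob M; Y \<in> Ob M; f \<in> Hom M X Y\<rbrakk>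
      \<Longrightarrow> run M Y \<cdot> (f \<otimes>\<^sub>m Id M (unitob M)) = f \<cdot> run M X"
    and pentagon: "\<lbrakk>W \<in> Ob M; X \<in> Ob M; Y \<in> Ob M; Z \<in> Ob M\<rbrakk>
      \<Longrightarrow> asc M W X (Y \<otimes>\<^sub>o Z) \<cdot> asc M (W \<otimes>\<^sub>o X) Y Z =
        (Id M W \<otimes>\<^sub>m asc M X Y Z) \<cdot> asc M W (X \<otimes>\<^sub>o Y) Z \<cdot> (asc M W X Y \<otimes>\<^sub>m Id M Z)"
    and triangle: "\<lbrakk>X \<in> Ob M; Y \<in> Ob M\<rbrakk>
      \<Longrightarrow> (Id M X \<otimes>\<^sub>m lun M Y) \<cdot> asc M X (unitob M) Y = run M X \<otimes>\<^sub>m Id M Y"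

text \<open>
  Bimodule categories over an abelian category are preadditive only if the functors
  \<open>X \<otimes> -\<close> and \<open>- \<otimes> X\<close> are additive.  For instance, \<open>\<oplus>\<close> is a monoidal structure on any
  abelian category, but its categories of bimodules have no zero morphisms in general.
\<close>

locale abelian_monoidal_cat = abelian_cat M + monoidal_cat M
  for M :: "('o, 'm, 'x) moncat_scheme" (structure) +
  assumes tmor_madd_right: "\<lbrakk>X \<in> Ob M; Y \<in> Ob M; Z \<in> Ob M; f \<in> Hom M Y Z; g \<in> Hom M Y Z\<rbrakk>
      \<Longrightarrow> Id M X \<otimes>\<^sub>m madd M f g = madd M (Id M X \<otimes>\<^sub>m f) (Id M X \<otimes>\<^sub>m g)"
    and tmor_madd_left: "\<lbrakk>X \<in> Ob M; Y \<in> Ob M; Z \<in> Ob M; f \<in> Hom M Y Z; g \<in> Hom M Y Z\<rbrakk>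
      \<Longrightarrow> madd M f g \<otimes>\<^sub>m Id M X = madd M (f \<otimes>\<^sub>m Id M X) (g \<otimes>\<^sub>m Id M X)"


section \<open>Algebras and bimodules\<close>

locale algebra_in = monoidal_cat M for M :: "('o, 'm, 'x) moncat_scheme" (structure) +
  fixes A :: 'o and m :: 'm and u :: 'm
  assumes A_in: "A \<in> Ob M"
    and m_in: "m \<in> Hom M (A \<otimes>\<^sub>o A) A"
    and u_in: "u \<in> Hom M (unitob M) A"
    and m_assoc: "m \<cdot> (m \<otimes>\<^sub>m Id M A) = m \<cdot> (Id M A \<otimes>\<^sub>m m) \<cdot> asc M A A A"
    and unit_left: "m \<cdot> (u \<otimes>\<^sub>m Id M A) = lun M A"
    and unit_right: "m \<cdot> (Id M A \<otimes>\<^sub>m u) = run M A"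

definition is_left_module ::
  "('o, 'm, 'x) moncat_scheme \<Rightarrow> 'o \<Rightarrow> 'm \<Rightarrow> 'm \<Rightarrow> 'o \<Rightarrow> 'm \<Rightarrow> bool" where
  "is_left_module M A m u X l \<longleftrightarrow> X \<in> Ob M \<and> l \<in> Hom M (A \<otimes>\<^sub>o\<^bsub>M\<^esub> X) X \<and>
    l \<cdot>\<^bsub>M\<^esub> (m \<otimes>\<^sub>m\<^bsub>M\<^esub> Id M X) = l \<cdot>\<^bsub>M\<^esub> (Id M A \<otimes>\<^sub>m\<^bsub>M\<^esub> l) \<cdot>\<^bsub>M\<^esub> asc M A A X \<and>
    l \<cdot>\<^bsub>M\<^esub> (u \<otimes>\<^sub>m\<^bsub>M\<^esub> Id M X) = lun M X"

definition is_right_module ::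
  "('o, 'm, 'x) moncat_scheme \<Rightarrow> 'o \<Rightarrow> 'm \<Rightarrow> 'm \<Rightarrow> 'o \<Rightarrow> 'm \<Rightarrow> bool" where
  "is_right_module M A m u X r \<longleftrightarrow> X \<in> Ob M \<and> r \<in> Hom M (X \<otimes>\<^sub>o\<^bsub>M\<^esub> A) X \<and>
    r \<cdot>\<^bsub>M\<^esub> (r \<otimes>\<^sub>m\<^bsub>M\<^esub> Id M A) = r \<cdot>\<^bsub>M\<^esub> (Id M X \<otimes>\<^sub>m\<^bsub>M\<^esub> m) \<cdot>\<^bsub>M\<^esub> asc M X A A \<and>
    r \<cdot>\<^bsub>M\<^esub> (Id M X \<otimes>\<^sub>m\<^bsub>M\<^esub> u) = run M X"

definition is_bimodule ::
  "('o, 'm, 'x) moncat_scheme \<Rightarrow> 'o \<Rightarrow> 'm \<Rightarrow> 'm \<Rightarrow> 'o \<times> 'm \<times> 'm \<Rightarrow> bool" where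
  "is_bimodule M A m u = (\<lambda>(X, l, r).
    is_left_module M A m u X l \<and> is_right_module M A m u X r \<and>
    r \<cdot>\<^bsub>M\<^esub> (l \<otimes>\<^sub>m\<^bsub>M\<^esub> Id M A) = l \<cdot>\<^bsub>M\<^esub> (Id M A \<otimes>\<^sub>m\<^bsub>M\<^esub> r) \<cdot>\<^bsub>M\<^esub> asc M A X A)"

definition bimod_hom ::
  "('o, 'm, 'x) moncat_scheme \<Rightarrow> 'o \<Rightarrow> 'o \<times> 'm \<times> 'm \<Rightarrow> 'o \<times> 'm \<times> 'm \<Rightarrow> 'm set" where
  "bimod_hom M A = (\<lambda>(X, l, r) (X', l', r').
    {f \<in> Hom M X X'. f \<cdot>\<^bsub>M\<^esub> l = l' \<cdot>\<^bsub>M\<^esub> (Id M A \<otimes>\<^sub>m\<^bsub>M\<^esub> f) \<and>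
      f \<cdot>\<^bsub>M\<^esub> r = r' \<cdot>\<^bsub>M\<^esub> (f \<otimes>\<^sub>m\<^bsub>M\<^esub> Id M A)})"

definition Bimod ::
  "('o, 'm, 'x) moncat_scheme \<Rightarrow> 'o \<Rightarrow> 'm \<Rightarrow> 'm \<Rightarrow> ('o \<times> 'm \<times> 'm, 'm) precat" where
  "Bimod M A m u = \<lparr>Ob = {B. is_bimodule M A m u B}, Hom = bimod_hom M A,
    Id = (\<lambda>B. Id M (fst B)), comp = comp M, madd = madd M,
    mzero = (\<lambda>B B'. mzero M (fst B) (fst B'))\<rparr>"

definition regular_bimod :: "'o \<Rightarrow> 'm \<Rightarrow> 'o \<times> 'm \<times> 'm" where
  "regular_bimod A m = (A, m, m)"

definition tensor_square_bimod ::
  "('o, 'm, 'x) moncat_scheme \<Rightarrow> 'o \<Rightarrow> 'm \<Rightarrow> 'o \<times> 'm \<times> 'm" where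
  "tensor_square_bimod M A m =
    (A \<otimes>\<^sub>o\<^bsub>M\<^esub> A,
     (m \<otimes>\<^sub>m\<^bsub>M\<^esub> Id M A) \<cdot>\<^bsub>M\<^esub>
       inverse_of M ((A \<otimes>\<^sub>o\<^bsub>M\<^esub> A) \<otimes>\<^sub>o\<^bsub>M\<^esub> A) (A \<otimes>\<^sub>o\<^bsub>M\<^esub> (A \<otimes>\<^sub>o\<^bsub>M\<^esub> A)) (asc M A A A),
     (Id M A \<otimes>\<^sub>m\<^bsub>M\<^esub> m) \<cdot>\<^bsub>M\<^esub> asc M A A A)"

definition separable :: "('o, 'm, 'x) moncat_scheme \<Rightarrow> 'o \<Rightarrow> 'm \<Rightarrow> 'm \<Rightarrow> bool" where
  "separable M A m u \<longleftrightarrow>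
    has_section (Bimod M A m u) (tensor_square_bimod M A m) (regular_bimod A m) m"


section \<open>Relative homological algebra\<close>

text \<open>
  A class of morphisms is a predicate \<open>E X Y e\<close> on a source, a target and a morphism.
\<close>

definition E_projective ::
  "('o, 'm, 'x) precat_scheme \<Rightarrow> ('o \<Rightarrow> 'o \<Rightarrow> 'm \<Rightarrow> bool) \<Rightarrow> 'o \<Rightarrow> bool" where
  "E_projective C E P \<longleftrightarrow> P \<in> Ob C \<and>
    (\<forall>X\<in>Ob C. \<forall>Y\<in>Ob C. \<forall>e. E X Y e \<longrightarrow> (\<lambda>g. e \<cdot>\<^bsub>C\<^esub> g) ` Hom C P X = Hom C P Y)"

text \<open>
  The last conjunct says that \<open>i\<close> is the least subobject through which \<open>f\<close> factors.  In an
  abelian category it follows from the other ones; it makes the factorization unique up to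
  isomorphism in any category.
\<close>

definition canonical_factorization ::
  "('o, 'm, 'x) precat_scheme \<Rightarrow> 'o \<Rightarrow> 'o \<Rightarrow> 'm \<Rightarrow> 'o \<Rightarrow> 'm \<Rightarrow> 'm \<Rightarrow> bool" where
  "canonical_factorization C X Y f I i e \<longleftrightarrow> I \<in> Ob C \<and>
    is_epi C X I e \<and> is_mono C I Y i \<and> f = i \<cdot>\<^bsub>C\<^esub> e \<and>
    (\<forall>J\<in>Ob C. \<forall>j. \<forall>g\<in>Hom C X J. is_mono C J Y j \<and> f = j \<cdot>\<^bsub>C\<^esub> g \<longrightarrow>
      (\<exists>t\<in>Hom C I J. i = j \<cdot>\<^bsub>C\<^esub> t))"

definition E_admissible ::
  "('o, 'm, 'x) precat_scheme \<Rightarrow> ('o \<Rightarrow> 'o \<Rightarrow> 'm \<Rightarrow> bool) \<Rightarrow> 'o \<Rightarrow> 'o \<Rightarrow> 'm \<Rightarrow> bool" where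
  "E_admissible C E X Y f \<longleftrightarrow> (\<exists>I i e. canonical_factorization C X Y f I i e \<and> E X I e)"

definition exact_at ::
  "('o, 'm, 'x) precat_scheme \<Rightarrow> 'o \<Rightarrow> 'o \<Rightarrow> 'o \<Rightarrow> 'm \<Rightarrow> 'm \<Rightarrow> bool" where
  "exact_at C X Y Z f g \<longleftrightarrow> f \<in> Hom C X Y \<and> g \<in> Hom C Y Z \<and>
    (\<exists>I i e. canonical_factorization C X Y f I i e \<and> is_kernel C Y Z g I i)"

definition E_projective_resolution ::
  "('o, 'm, 'x) precat_scheme \<Rightarrow> ('o \<Rightarrow> 'o \<Rightarrow> 'm \<Rightarrow> bool) \<Rightarrow> 'o \<Rightarrow>
    (nat \<Rightarrow> 'o) \<Rightarrow> (nat \<Rightarrow> 'm) \<Rightarrow> 'm \<Rightarrow> bool" where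
  "E_projective_resolution C E N P d a \<longleftrightarrow>
    (\<forall>n. E_projective C E (P n)) \<and>
    (\<forall>n. E_admissible C E (P (Suc n)) (P n) (d n)) \<and>
    E_admissible C E (P 0) N a \<and>
    (\<forall>n. exact_at C (P (Suc (Suc n))) (P (Suc n)) (P n) (d (Suc n)) (d n)) \<and>
    exact_at C (P (Suc 0)) (P 0) N (d 0) a \<and>
    (\<exists>Z. is_zero_object C Z \<and> exact_at C (P 0) N Z a (mzero C N Z))"

definition cocycles ::
  "('o, 'm, 'x) precat_scheme \<Rightarrow> (nat \<Rightarrow> 'o) \<Rightarrow> (nat \<Rightarrow> 'm) \<Rightarrow> 'o \<Rightarrow> nat \<Rightarrow> 'm set" where
  "cocycles C P d Y n =
    kernel (hom_group C (P n) Y) (hom_group C (P (Suc n)) Y) (\<lambda>f. f \<cdot>\<^bsub>C\<^esub> d n)"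

fun coboundaries ::
  "('o, 'm, 'x) precat_scheme \<Rightarrow> (nat \<Rightarrow> 'o) \<Rightarrow> (nat \<Rightarrow> 'm) \<Rightarrow> 'o \<Rightarrow> nat \<Rightarrow> 'm set" where
  "coboundaries C P d Y 0 = {mzero C (P 0) Y}"
| "coboundaries C P d Y (Suc n) = (\<lambda>f. f \<cdot>\<^bsub>C\<^esub> d n) ` Hom C (P n) Y"

definition hom_cohomology ::
  "('o, 'm, 'x) precat_scheme \<Rightarrow> (nat \<Rightarrow> 'o) \<Rightarrow> (nat \<Rightarrow> 'm) \<Rightarrow> 'o \<Rightarrow> nat \<Rightarrow> 'm set monoid" where
  "hom_cohomology C P d Y n =
    hom_group C (P n) Y\<lparr>carrier := cocycles C P d Y n\<rparr> Mod coboundaries C P d Y n"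

definition Ext ::
  "('o, 'm, 'x) precat_scheme \<Rightarrow> ('o \<Rightarrow> 'o \<Rightarrow> 'm \<Rightarrow> bool) \<Rightarrow> nat \<Rightarrow> 'o \<Rightarrow> 'o \<Rightarrow> 'm set monoid" where
  "Ext C E n N Y =
    (let (P, d, a) = (SOME (P, d, a). E_projective_resolution C E N P d a)
     in hom_cohomology C P d Y n)"


section \<open>Hochschild cohomology\<close>

definition split_epi_class ::
  "('o, 'm, 'x) moncat_scheme \<Rightarrow> 'o \<Rightarrow> 'm \<Rightarrow> 'm \<Rightarrow>
    'o \<times> 'm \<times> 'm \<Rightarrow> 'o \<times> 'm \<times> 'm \<Rightarrow> 'm \<Rightarrow> bool" where
  "split_epi_class M A m u B B' e \<longleftrightarrow>
    is_epi (Bimod M A m u) B B' e \<and> has_section M (fst B) (fst B') e"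

definition Hochschild ::
  "('o, 'm, 'x) moncat_scheme \<Rightarrow> 'o \<Rightarrow> 'm \<Rightarrow> 'm \<Rightarrow> nat \<Rightarrow> 'o \<times> 'm \<times> 'm \<Rightarrow> 'm set monoid" where
  "Hochschild M A m u n B =
    Ext (Bimod M A m u) (split_epi_class M A m u) n (regular_bimod A m) B"

end

theory Submission
  imports Defs
begin

text \<open>
  All three conditions are equivalent to \<open>\<E>\<close>-projectivity of the regular bimodule.

  The multiplication \<open>m\<close> lies in \<open>\<E>\<close>, so projectivity of \<open>A\<close> splits it.  Conversely, given a bimodule
  section \<open>\<sigma>\<close> of \<open>m\<close>, a bimodule map \<open>f: A \<rightarrow> Y\<close> and \<open>e: X \<rightarrow> Y\<close> in \<open>\<E>\<close> with section \<open>s\<close> in \<open>\<M>\<close>, the map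
  \<open>g\<^sub>1 = l (A \<otimes> s f) \<sigma>\<close> is a left linear lift of \<open>f\<close>, and \<open>g = r (g\<^sub>1 \<otimes> A) \<sigma>\<close> is a bilinear one.

  For an \<open>\<E>\<close>-projective resolution \<open>P\<close> of a projective object, exactness and admissibility yield maps
  \<open>h\<close> with \<open>d\<^sub>n h d\<^sub>n = d\<^sub>n\<close> one degree after the other, whence a contracting homotopy.  If
  \<open>Ext\<^sup>1(N, I) = 0\<close> for the image \<open>I\<close> of \<open>d\<^sub>0\<close>, then the epimorphism \<open>P\<^sub>1 \<rightarrow> I\<close>, being a cocycle, factors
  through \<open>d\<^sub>0\<close>, so that \<open>I\<close> splits off \<open>P\<^sub>0\<close> and \<open>N\<close> is a retract of \<open>P\<^sub>0\<close>.

  Resolutions exist since the free bimodules \<open>(A \<otimes> X) \<otimes> A\<close> are \<open>\<E>\<close>-projective and since kernels of bimodule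
  maps, formed in \<open>\<M>\<close>, carry a bimodule structure.
\<close>


section \<open>Coherence in monoidal categories\<close>

text \<open>Tensor products are assumed additive, not exact. Additivity lets actions restrict to
  kernels formed in \<open>M\<close>, but a cokernel formed in \<open>M\<close> need not inherit
  actions, so quotients have to come from the class \<open>E\<close> itself. If \<open>e\<close> in
  \<open>E\<close> has the section \<open>s\<close> in \<open>M\<close>, then
  \<open>A \<otimes> -\<close> and \<open>- \<otimes> A\<close> keep \<open>e\<close> split; a
  bimodule map \<open>g\<close> vanishing on the kernel of \<open>e\<close> therefore factors
  through \<open>e\<close> as \<open>g s\<close>, which is bilinear although \<open>s\<close> need
  not be.

  Lifting over a separable algebra is an averaging as in Maschke's theorem: if
  \<open>\<sigma>(1) = \<Sum> x \<otimes> y\<close>, then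
  \<open>g\<^sub>1(a) = \<Sum> a x s(f(y))\<close>, and linearity of \<open>e\<close> and
  \<open>f\<close> gives \<open>e g\<^sub>1 = f m \<sigma> = f\<close>. The second averaging repairs
  right linearity by the same computation.

  The relation \<open>d h d = d\<close> says that \<open>Id - h d\<close> is killed by
  \<open>d\<close>; exactness then lifts it through the next differential, which supplies the next
  \<open>h\<close>.

  \<open>Ext\<close> refers to a chosen resolution. Both implications are shown for an arbitrary
  one, and the existence proof makes the choice a genuine resolution.\<close>

text \<open>
  The hom-sets of a category may overlap.  Bundling a morphism with its source and target turns
  well-typedness into equations that the simplifier can discharge.
\<close>

datatype ('o, 'm) arrow = Arrow (src: 'o) (tgt: 'o) (mor: 'm)

section \<open>Composition of typed arrows\<close>

context cat
begin

definition arr :: "('o, 'm) arrow \<Rightarrow> bool" where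
  "arr f \<longleftrightarrow> src f \<in> Ob C \<and> tgt f \<in> Ob C \<and> mor f \<in> Hom C (src f) (tgt f)"

definition cmp :: "('o, 'm) arrow \<Rightarrow> ('o, 'm) arrow \<Rightarrow> ('o, 'm) arrow" (infixr \<open>\<star>\<close> 70) where
  "g \<star> f = Arrow (src f) (tgt g) (mor g \<cdot> mor f)"

definition idt :: "'o \<Rightarrow> ('o, 'm) arrow" where
  "idt X = Arrow X X (Id C X)"

lemma src_cmp [simp]: "src (g \<star> f) = src f"
  and tgt_cmp [simp]: "tgt (g \<star> f) = tgt g"
  and mor_cmp [simp]: "mor (g \<star> f) = mor g \<cdot> mor f"
  by (simp_all add: cmp_def)

lemma src_idt [simp]: "src (idt X) = X"
  and tgt_idt [simp]: "tgt (idt X) = X"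
  and mor_idt [simp]: "mor (idt X) = Id C X"
  by (simp_all add: idt_def)

lemma arr_src [simp]: "arr f \<Longrightarrow> src f \<in> Ob C"
  and arr_tgt [simp]: "arr f \<Longrightarrow> tgt f \<in> Ob C"
  by (simp_all add: arr_def)

lemma arr_mor: "arr f \<Longrightarrow> mor f \<in> Hom C (src f) (tgt f)"
  unfolding arr_def by simp

lemma arr_Arrow: "arr (Arrow X Y f) \<longleftrightarrow> X \<in> Ob C \<and> Y \<in> Ob C \<and> f \<in> Hom C X Y"
  unfolding arr_def by simp

lemma arr_cmp [simp]: "\<lbrakk>arr f; arr g; tgt f = src g\<rbrakk> \<Longrightarrow> arr (g \<star> f)"
  using comp_in[of "src f" "tgt f" "tgt g" "mor f" "mor g"] unfolding arr_def by simp

lemma arr_idt [simp]: "X \<in> Ob C \<Longrightarrow> arr (idt X)"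
  unfolding arr_def by (simp add: Id_in)

lemma cmp_idt [simp]: "\<lbrakk>arr f; src f = X\<rbrakk> \<Longrightarrow> f \<star> idt X = f"
  unfolding arr_def by (cases f) (auto simp: cmp_def idt_def comp_Id)

lemma idt_cmp [simp]: "\<lbrakk>arr f; tgt f = X\<rbrakk> \<Longrightarrow> idt X \<star> f = f"
  unfolding arr_def by (cases f) (auto simp: cmp_def idt_def Id_comp)

lemma cmp_assoc [simp]:
  "\<lbrakk>arr f; arr g; arr h; tgt f = src g; tgt g = src h\<rbrakk> \<Longrightarrow> (h \<star> g) \<star> f = h \<star> g \<star> f"
  using comp_assoc[of "src f" "src g" "src h" "tgt h" "mor f" "mor g" "mor h"]
  unfolding arr_def by (simp add: cmp_def)

text \<open>The simplifier nests composites to the right, where \<open>f \<star> g\<close> is no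
  longer a subterm of \<open>f \<star> g \<star> k\<close>. This turns an equation for
  \<open>f \<star> g\<close> into a rule that still applies there.\<close>

lemma cmp_pre:
  "\<lbrakk>f \<star> g = h; arr f; arr g; arr k; tgt g = src f; tgt k = src g\<rbrakk> \<Longrightarrow> f \<star> g \<star> k = h \<star> k"
  by (metis cmp_assoc)

text \<open>The definite description needs uniqueness: two inverses \<open>g\<close> and
  \<open>h\<close> agree because both equal \<open>h \<cdot> f \<cdot> g\<close>.\<close>

lemma inverse_of_is_inverse:
  assumes "is_iso C X Y f" "X \<in> Ob C" "Y \<in> Ob C"
  shows "is_inverse C X Y f (inverse_of C X Y f)"
proof -
  obtain g where g: "is_inverse C X Y f g" using assms by (auto simp: is_iso_def)
  have "h = g" if h: "is_inverse C X Y f h" for h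
  proof -
    have "h = h \<cdot> (f \<cdot> g)"
      using g h assms(2,3) by (simp add: is_inverse_def comp_Id[of Y X])
    also have "\<dots> = h \<cdot> f \<cdot> g"
      using g h assms(2,3) comp_assoc[of Y X Y X g f h] by (simp add: is_inverse_def)
    also have "\<dots> = g"
      using g h assms(2,3) Id_comp[of Y X g] by (simp add: is_inverse_def)
    finally show ?thesis .
  qed
  then show ?thesis unfolding inverse_of_def using g by (metis theI)
qed

end

section \<open>Tensor products of arrows and the coherence constraints\<close>

context monoidal_cat
begin

notation cmp (infixr \<open>\<star>\<close> 70)

definition tens :: "('o, 'm) arrow \<Rightarrow> ('o, 'm) arrow \<Rightarrow> ('o, 'm) arrow" (infixr \<open>\<boxtimes>\<close> 75) where
  "f \<boxtimes> g = Arrow (src f \<otimes>\<^sub>o src g) (tgt f \<otimes>\<^sub>o tgt g) (mor f \<otimes>\<^sub>m mor g)"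

definition assoc :: "'o \<Rightarrow> 'o \<Rightarrow> 'o \<Rightarrow> ('o, 'm) arrow" where
  "assoc X Y Z = Arrow ((X \<otimes>\<^sub>o Y) \<otimes>\<^sub>o Z) (X \<otimes>\<^sub>o Y \<otimes>\<^sub>o Z) (asc M X Y Z)"

definition assoc' :: "'o \<Rightarrow> 'o \<Rightarrow> 'o \<Rightarrow> ('o, 'm) arrow" where
  "assoc' X Y Z = Arrow (X \<otimes>\<^sub>o Y \<otimes>\<^sub>o Z) ((X \<otimes>\<^sub>o Y) \<otimes>\<^sub>o Z)
    (inverse_of M ((X \<otimes>\<^sub>o Y) \<otimes>\<^sub>o Z) (X \<otimes>\<^sub>o Y \<otimes>\<^sub>o Z) (asc M X Y Z))"

definition lunit :: "'o \<Rightarrow> ('o, 'm) arrow" where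
  "lunit X = Arrow (unitob M \<otimes>\<^sub>o X) X (lun M X)"

definition lunit' :: "'o \<Rightarrow> ('o, 'm) arrow" where
  "lunit' X = Arrow X (unitob M \<otimes>\<^sub>o X) (inverse_of M (unitob M \<otimes>\<^sub>o X) X (lun M X))"

definition runit :: "'o \<Rightarrow> ('o, 'm) arrow" where
  "runit X = Arrow (X \<otimes>\<^sub>o unitob M) X (run M X)"

definition runit' :: "'o \<Rightarrow> ('o, 'm) arrow" where
  "runit' X = Arrow X (X \<otimes>\<^sub>o unitob M) (inverse_of M (X \<otimes>\<^sub>o unitob M) X (run M X))"

lemma tens_sel [simp]:
  "src (f \<boxtimes> g) = src f \<otimes>\<^sub>o src g" "tgt (f \<boxtimes> g) = tgt f \<otimes>\<^sub>o tgt g" "mor (f \<boxtimes> g) = mor f \<otimes>\<^sub>m mor g"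
  by (simp_all add: tens_def)

lemma assoc_sel [simp]:
  "src (assoc X Y Z) = (X \<otimes>\<^sub>o Y) \<otimes>\<^sub>o Z" "tgt (assoc X Y Z) = X \<otimes>\<^sub>o Y \<otimes>\<^sub>o Z"
  "mor (assoc X Y Z) = asc M X Y Z"
  by (simp_all add: assoc_def)

lemma assoc'_sel [simp]:
  "src (assoc' X Y Z) = X \<otimes>\<^sub>o Y \<otimes>\<^sub>o Z" "tgt (assoc' X Y Z) = (X \<otimes>\<^sub>o Y) \<otimes>\<^sub>o Z"
  "mor (assoc' X Y Z) = inverse_of M ((X \<otimes>\<^sub>o Y) \<otimes>\<^sub>o Z) (X \<otimes>\<^sub>o Y \<otimes>\<^sub>o Z) (asc M X Y Z)"
  by (simp_all add: assoc'_def)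

lemma unit_sel [simp]:
  "src (lunit X) = unitob M \<otimes>\<^sub>o X" "tgt (lunit X) = X" "mor (lunit X) = lun M X"
  "src (lunit' X) = X" "tgt (lunit' X) = unitob M \<otimes>\<^sub>o X"
  "src (runit X) = X \<otimes>\<^sub>o unitob M" "tgt (runit X) = X" "mor (runit X) = run M X"
  "src (runit' X) = X" "tgt (runit' X) = X \<otimes>\<^sub>o unitob M"
  by (simp_all add: lunit_def lunit'_def runit_def runit'_def)

lemma tob_unitob_in [simp]:
  "unitob M \<in> Ob M" "\<lbrakk>X \<in> Ob M; Y \<in> Ob M\<rbrakk> \<Longrightarrow> X \<otimes>\<^sub>o Y \<in> Ob M"
  by (auto intro: unitob_in tob_in)

lemma arr_tens [simp]: "\<lbrakk>arr f; arr g\<rbrakk> \<Longrightarrow> arr (f \<boxtimes> g)"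
  using tmor_in[of "src f" "tgt f" "src g" "tgt g" "mor f" "mor g"] unfolding arr_def by simp

lemma tens_idt [simp]: "\<lbrakk>X \<in> Ob M; Y \<in> Ob M\<rbrakk> \<Longrightarrow> idt X \<boxtimes> idt Y = idt (X \<otimes>\<^sub>o Y)"
  by (simp add: tens_def idt_def tmor_Id)

lemma tens_cmp:
  "\<lbrakk>arr f; arr f'; arr g; arr g'; tgt f = src f'; tgt g = src g'\<rbrakk>
    \<Longrightarrow> (f' \<star> f) \<boxtimes> (g' \<star> g) = (f' \<boxtimes> g') \<star> (f \<boxtimes> g)"
  using tmor_comp[of "src f" "src f'" "tgt f'" "src g" "src g'" "tgt g'" "mor f" "mor f'" "mor g" "mor g'"]
  unfolding arr_def by (simp add: tens_def cmp_def)

lemma tens_cmp_right: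
  "\<lbrakk>arr g; arr g'; X \<in> Ob M; tgt g = src g'\<rbrakk> \<Longrightarrow> idt X \<boxtimes> (g' \<star> g) = (idt X \<boxtimes> g') \<star> (idt X \<boxtimes> g)"
  using tens_cmp[of "idt X" "idt X" g g'] by simp

lemma tens_cmp_left:
  "\<lbrakk>arr f; arr f'; X \<in> Ob M; tgt f = src f'\<rbrakk> \<Longrightarrow> (f' \<star> f) \<boxtimes> idt X = (f' \<boxtimes> idt X) \<star> (f \<boxtimes> idt X)"
  using tens_cmp[of f f' "idt X" "idt X"] by simp

lemma tens_exchange:
  assumes "arr f" "arr g" "src f = X" "tgt f = X'" "src g = Y" "tgt g = Y'"
  shows "(f \<boxtimes> idt Y') \<star> (idt X \<boxtimes> g) = (idt X' \<boxtimes> g) \<star> (f \<boxtimes> idt Y)"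
  using assms tens_cmp[of "idt X" f g "idt Y'"] tens_cmp[of f "idt X'" "idt Y" g] by auto

lemma assoc_inverse:
  assumes "X \<in> Ob M" "Y \<in> Ob M" "Z \<in> Ob M"
  shows arr_assoc [simp]: "arr (assoc X Y Z)" and arr_assoc' [simp]: "arr (assoc' X Y Z)"
    and assoc_assoc' [simp]: "assoc X Y Z \<star> assoc' X Y Z = idt (X \<otimes>\<^sub>o Y \<otimes>\<^sub>o Z)"
    and assoc'_assoc [simp]: "assoc' X Y Z \<star> assoc X Y Z = idt ((X \<otimes>\<^sub>o Y) \<otimes>\<^sub>o Z)"
  using inverse_of_is_inverse[OF asc_iso[OF assms]] assms
  unfolding arr_def by (auto simp: is_inverse_def assoc_def assoc'_def cmp_def idt_def)

lemma lunit_inverse: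
  assumes "X \<in> Ob M"
  shows arr_lunit [simp]: "arr (lunit X)" and arr_lunit' [simp]: "arr (lunit' X)"
    and lunit_lunit' [simp]: "lunit X \<star> lunit' X = idt X"
    and lunit'_lunit [simp]: "lunit' X \<star> lunit X = idt (unitob M \<otimes>\<^sub>o X)"
  using inverse_of_is_inverse[OF lun_iso[OF assms]] assms
  unfolding arr_def by (auto simp: is_inverse_def lunit_def lunit'_def cmp_def idt_def)

lemma runit_inverse:
  assumes "X \<in> Ob M"
  shows arr_runit [simp]: "arr (runit X)" and arr_runit' [simp]: "arr (runit' X)"
    and runit_runit' [simp]: "runit X \<star> runit' X = idt X"
    and runit'_runit [simp]: "runit' X \<star> runit X = idt (X \<otimes>\<^sub>o unitob M)"
  using inverse_of_is_inverse[OF run_iso[OF assms]] assms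
  unfolding arr_def by (auto simp: is_inverse_def runit_def runit'_def cmp_def idt_def)

lemma assoc_cancel [simp]:
  assumes "X \<in> Ob M" "Y \<in> Ob M" "Z \<in> Ob M" "arr f"
  shows "tgt f = X \<otimes>\<^sub>o Y \<otimes>\<^sub>o Z \<Longrightarrow> assoc X Y Z \<star> assoc' X Y Z \<star> f = f"
    and "tgt f = (X \<otimes>\<^sub>o Y) \<otimes>\<^sub>o Z \<Longrightarrow> assoc' X Y Z \<star> assoc X Y Z \<star> f = f"
  using assms by (simp_all add: cmp_pre[OF assoc_assoc'] cmp_pre[OF assoc'_assoc])

lemma assoc_nat:
  assumes "arr f" "arr g" "arr h" "src f = X" "src g = Y" "src h = Z"
    "tgt f = X'" "tgt g = Y'" "tgt h = Z'"
  shows "assoc X' Y' Z' \<star> ((f \<boxtimes> g) \<boxtimes> h) = (f \<boxtimes> g \<boxtimes> h) \<star> assoc X Y Z"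
  using assms asc_natural[of "src f" "tgt f" "src g" "tgt g" "src h" "tgt h" "mor f" "mor g" "mor h"]
  unfolding arr_def by (simp add: arrow.expand)

lemma assoc'_nat:
  assumes "arr f" "arr g" "arr h" "src f = X" "src g = Y" "src h = Z"
    "tgt f = X'" "tgt g = Y'" "tgt h = Z'"
  shows "assoc' X' Y' Z' \<star> (f \<boxtimes> g \<boxtimes> h) = ((f \<boxtimes> g) \<boxtimes> h) \<star> assoc' X Y Z"
proof -
  have obs: "X \<in> Ob M" "Y \<in> Ob M" "Z \<in> Ob M" "X' \<in> Ob M" "Y' \<in> Ob M" "Z' \<in> Ob M"
    using assms by auto
  have "assoc' X' Y' Z' \<star> (f \<boxtimes> g \<boxtimes> h) =
      assoc' X' Y' Z' \<star> ((f \<boxtimes> g \<boxtimes> h) \<star> assoc X Y Z) \<star> assoc' X Y Z"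
    using obs assms by simp
  also have "\<dots> = assoc' X' Y' Z' \<star> (assoc X' Y' Z' \<star> ((f \<boxtimes> g) \<boxtimes> h)) \<star> assoc' X Y Z"
    by (simp only: assoc_nat[OF assms])
  also have "\<dots> = ((f \<boxtimes> g) \<boxtimes> h) \<star> assoc' X Y Z"
    using obs assms by simp
  finally show ?thesis .
qed

text \<open>
  The simplifier collapses \<open>idt X \<boxtimes> idt Y\<close>, so naturality with two identities needs its own rewrite rules.
\<close>

lemma assoc_push:
  "\<lbrakk>arr f; arr g; arr h; tgt f = X; tgt g = Y; tgt h = Z\<rbrakk>
    \<Longrightarrow> assoc X Y Z \<star> ((f \<boxtimes> g) \<boxtimes> h) = (f \<boxtimes> g \<boxtimes> h) \<star> assoc (src f) (src g) (src h)"
  "\<lbrakk>arr h; tgt h = Z; X \<in> Ob M; Y \<in> Ob M\<rbrakk>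
    \<Longrightarrow> assoc X Y Z \<star> (idt (X \<otimes>\<^sub>o Y) \<boxtimes> h) = (idt X \<boxtimes> idt Y \<boxtimes> h) \<star> assoc X Y (src h)"
  "\<lbrakk>arr f; arr g; arr h; tgt f = X; tgt g = Y; tgt h = Z\<rbrakk>
    \<Longrightarrow> assoc' X Y Z \<star> (f \<boxtimes> g \<boxtimes> h) = ((f \<boxtimes> g) \<boxtimes> h) \<star> assoc' (src f) (src g) (src h)"
  "\<lbrakk>arr f; tgt f = X; Y \<in> Ob M; Z \<in> Ob M\<rbrakk>
    \<Longrightarrow> assoc' X Y Z \<star> (f \<boxtimes> idt (Y \<otimes>\<^sub>o Z)) = ((f \<boxtimes> idt Y) \<boxtimes> idt Z) \<star> assoc' (src f) Y Z"
  using assoc_nat[of "idt X" "idt Y" h, OF _ _ _ refl refl refl refl refl refl]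
    assoc'_nat[of f "idt Y" "idt Z", OF _ _ _ refl refl refl refl refl refl]
  by (auto intro: assoc_nat assoc'_nat)

text \<open>The same rules with a tail \<open>k\<close>, as right-nested composites demand. All of
  them move associators towards the source.\<close>

lemma assoc_push_cmp:
  "\<lbrakk>arr f; arr g; arr h; arr k; tgt f = X; tgt g = Y; tgt h = Z; tgt k = (src f \<otimes>\<^sub>o src g) \<otimes>\<^sub>o src h\<rbrakk>
    \<Longrightarrow> assoc X Y Z \<star> ((f \<boxtimes> g) \<boxtimes> h) \<star> k = (f \<boxtimes> g \<boxtimes> h) \<star> assoc (src f) (src g) (src h) \<star> k"
  "\<lbrakk>arr h; arr k; tgt h = Z; X \<in> Ob M; Y \<in> Ob M; tgt k = (X \<otimes>\<^sub>o Y) \<otimes>\<^sub>o src h\<rbrakk>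
    \<Longrightarrow> assoc X Y Z \<star> (idt (X \<otimes>\<^sub>o Y) \<boxtimes> h) \<star> k = (idt X \<boxtimes> idt Y \<boxtimes> h) \<star> assoc X Y (src h) \<star> k"
  "\<lbrakk>arr f; arr g; arr h; arr k; tgt f = X; tgt g = Y; tgt h = Z; tgt k = src f \<otimes>\<^sub>o src g \<otimes>\<^sub>o src h\<rbrakk>
    \<Longrightarrow> assoc' X Y Z \<star> (f \<boxtimes> g \<boxtimes> h) \<star> k = ((f \<boxtimes> g) \<boxtimes> h) \<star> assoc' (src f) (src g) (src h) \<star> k"
  "\<lbrakk>arr f; arr k; tgt f = X; Y \<in> Ob M; Z \<in> Ob M; tgt k = src f \<otimes>\<^sub>o Y \<otimes>\<^sub>o Z\<rbrakk>
    \<Longrightarrow> assoc' X Y Z \<star> (f \<boxtimes> idt (Y \<otimes>\<^sub>o Z)) \<star> k = ((f \<boxtimes> idt Y) \<boxtimes> idt Z) \<star> assoc' (src f) Y Z \<star> k"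
  by (auto simp: cmp_pre[OF assoc_push(1)] cmp_pre[OF assoc_push(2)] cmp_pre[OF assoc_push(3)]
      cmp_pre[OF assoc_push(4)])

lemmas assoc_pushes = assoc_push assoc_push_cmp

lemma lunit_nat:
  "\<lbrakk>arr f; src f = X; tgt f = Y\<rbrakk> \<Longrightarrow> lunit Y \<star> (idt (unitob M) \<boxtimes> f) = f \<star> lunit X"
  using lun_natural[of "src f" "tgt f" "mor f"] unfolding arr_def by (simp add: arrow.expand)

lemma runit_nat:
  "\<lbrakk>arr f; src f = X; tgt f = Y\<rbrakk> \<Longrightarrow> runit Y \<star> (f \<boxtimes> idt (unitob M)) = f \<star> runit X"
  using run_natural[of "src f" "tgt f" "mor f"] unfolding arr_def by (simp add: arrow.expand)

lemma pentagon_arr: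
  assumes "W \<in> Ob M" "X \<in> Ob M" "Y \<in> Ob M" "Z \<in> Ob M"
  shows "assoc W X (Y \<otimes>\<^sub>o Z) \<star> assoc (W \<otimes>\<^sub>o X) Y Z =
    (idt W \<boxtimes> assoc X Y Z) \<star> assoc W (X \<otimes>\<^sub>o Y) Z \<star> (assoc W X Y \<boxtimes> idt Z)"
proof -
  have "assoc W X (Y \<otimes>\<^sub>o Z) \<star> assoc (W \<otimes>\<^sub>o X) Y Z =
    ((idt W \<boxtimes> assoc X Y Z) \<star> assoc W (X \<otimes>\<^sub>o Y) Z) \<star> (assoc W X Y \<boxtimes> idt Z)"
    using pentagon[OF assms] by (simp add: arrow.expand)
  then show ?thesis using assms by simp
qed

lemma triangle_arr:
  assumes "X \<in> Ob M" "Y \<in> Ob M"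
  shows "(idt X \<boxtimes> lunit Y) \<star> assoc X (unitob M) Y = runit X \<boxtimes> idt Y"
  using triangle[OF assms] by (simp add: arrow.expand)

text \<open>Naturality of the right unitor expresses \<open>f \<star> runit (src f)\<close> through
  \<open>f \<boxtimes> idt (unitob M)\<close>, and the unitor is invertible.\<close>

lemma cancel_tens_unit_right:
  assumes "arr f" "arr g" "src f = src g" "tgt f = tgt g"
    and eq: "f \<boxtimes> idt (unitob M) = g \<boxtimes> idt (unitob M)"
  shows "f = g"
proof -
  have "f \<star> runit (src f) = g \<star> runit (src g)"
    using runit_nat[of f] runit_nat[of g] assms by metis
  then have "(f \<star> runit (src f)) \<star> runit' (src f) = (g \<star> runit (src g)) \<star> runit' (src f)"
    by simp
  then show ?thesis using assms by simp
qed

lemma cancel_tens_unit_left: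
  assumes "arr f" "arr g" "src f = src g" "tgt f = tgt g"
    and eq: "idt (unitob M) \<boxtimes> f = idt (unitob M) \<boxtimes> g"
  shows "f = g"
proof -
  have "f \<star> lunit (src f) = g \<star> lunit (src g)"
    using lunit_nat[of f] lunit_nat[of g] assms by metis
  then have "(f \<star> lunit (src f)) \<star> lunit' (src f) = (g \<star> lunit (src g)) \<star> lunit' (src f)"
    by simp
  then show ?thesis using assms by simp
qed

text \<open>
  Kelly's argument: \<open>- \<otimes> \<one>\<close> and \<open>\<one> \<otimes> -\<close> are faithful, and after applying them the claims follow from the
  pentagon and the triangle.
\<close>

lemma runit_tob:
  assumes X: "X \<in> Ob M" and Y: "Y \<in> Ob M"
  shows "runit (X \<otimes>\<^sub>o Y) = (idt X \<boxtimes> runit Y) \<star> assoc X Y (unitob M)"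
proof -
  let ?I = "unitob M"
  \<comment> \<open>The invertible associator in front makes naturality and the pentagon applicable;
    it is cancelled at the end.\<close>
  have "assoc X Y ?I \<star> (runit (X \<otimes>\<^sub>o Y) \<boxtimes> idt ?I) =
      assoc X Y ?I \<star> (idt (X \<otimes>\<^sub>o Y) \<boxtimes> lunit ?I) \<star> assoc (X \<otimes>\<^sub>o Y) ?I ?I"
    using X Y by (simp add: triangle_arr)
  also have "\<dots> = (idt X \<boxtimes> idt Y \<boxtimes> lunit ?I) \<star> assoc X Y (?I \<otimes>\<^sub>o ?I) \<star> assoc (X \<otimes>\<^sub>o Y) ?I ?I"
    using X Y by (simp add: assoc_pushes)
  also have "\<dots> = (idt X \<boxtimes> ((idt Y \<boxtimes> lunit ?I) \<star> assoc Y ?I ?I)) \<star> assoc X (Y \<otimes>\<^sub>o ?I) ?I \<star> (assoc X Y ?I \<boxtimes> idt ?I)"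
    using X Y by (simp add: pentagon_arr tens_cmp_right)
  also have "\<dots> = (idt X \<boxtimes> runit Y \<boxtimes> idt ?I) \<star> assoc X (Y \<otimes>\<^sub>o ?I) ?I \<star> (assoc X Y ?I \<boxtimes> idt ?I)"
    using X Y by (simp add: triangle_arr)
  also have "\<dots> = assoc X Y ?I \<star> ((idt X \<boxtimes> runit Y) \<boxtimes> idt ?I) \<star> (assoc X Y ?I \<boxtimes> idt ?I)"
    using X Y by (simp add: assoc_pushes)
  finally have "assoc' X Y ?I \<star> assoc X Y ?I \<star> (runit (X \<otimes>\<^sub>o Y) \<boxtimes> idt ?I) =
      assoc' X Y ?I \<star> assoc X Y ?I \<star> ((idt X \<boxtimes> runit Y) \<boxtimes> idt ?I) \<star> (assoc X Y ?I \<boxtimes> idt ?I)"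
    by simp
  then have "runit (X \<otimes>\<^sub>o Y) \<boxtimes> idt ?I = ((idt X \<boxtimes> runit Y) \<star> assoc X Y ?I) \<boxtimes> idt ?I"
    using X Y by (simp add: tens_cmp_left)
  then show ?thesis
    using X Y by (intro cancel_tens_unit_right[of "runit (X \<otimes>\<^sub>o Y)"]) simp_all
qed

lemma lunit_tob:
  assumes X: "X \<in> Ob M" and Y: "Y \<in> Ob M"
  shows "lunit X \<boxtimes> idt Y = lunit (X \<otimes>\<^sub>o Y) \<star> assoc (unitob M) X Y"
proof -
  let ?I = "unitob M"
  \<comment> \<open>\<open>?c\<close> is the part of the pentagon for \<open>?I\<close>,
    \<open>?I\<close>, \<open>X\<close>, \<open>Y\<close> that is carried along on the right, and
    \<open>?c'\<close> is its inverse.\<close>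
  let ?c = "assoc ?I (?I \<otimes>\<^sub>o X) Y \<star> (assoc ?I ?I X \<boxtimes> idt Y)"
  let ?c' = "(assoc' ?I ?I X \<boxtimes> idt Y) \<star> assoc' ?I (?I \<otimes>\<^sub>o X) Y"
  have "(idt ?I \<boxtimes> (lunit (X \<otimes>\<^sub>o Y) \<star> assoc ?I X Y)) \<star> ?c =
      (idt ?I \<boxtimes> lunit (X \<otimes>\<^sub>o Y)) \<star> assoc ?I ?I (X \<otimes>\<^sub>o Y) \<star> assoc (?I \<otimes>\<^sub>o ?I) X Y"
    using X Y by (simp add: pentagon_arr tens_cmp_right)
  also have "\<dots> = (runit ?I \<boxtimes> idt (X \<otimes>\<^sub>o Y)) \<star> assoc (?I \<otimes>\<^sub>o ?I) X Y"
    using X Y by (simp add: cmp_pre[OF triangle_arr])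
  also have "\<dots> = assoc ?I X Y \<star> ((runit ?I \<boxtimes> idt X) \<boxtimes> idt Y)"
    using X Y by (simp add: assoc_pushes)
  also have "\<dots> = assoc ?I X Y \<star> ((idt ?I \<boxtimes> lunit X) \<boxtimes> idt Y) \<star> (assoc ?I ?I X \<boxtimes> idt Y)"
    using X Y by (simp add: triangle_arr[symmetric] tens_cmp_left)
  also have "\<dots> = (idt ?I \<boxtimes> lunit X \<boxtimes> idt Y) \<star> ?c"
    using X Y by (simp add: assoc_pushes)
  finally have "((idt ?I \<boxtimes> (lunit (X \<otimes>\<^sub>o Y) \<star> assoc ?I X Y)) \<star> ?c) \<star> ?c' =
     ((idt ?I \<boxtimes> lunit X \<boxtimes> idt Y) \<star> ?c) \<star> ?c'" by simp
  moreover have "?c \<star> ?c' = idt (?I \<otimes>\<^sub>o (?I \<otimes>\<^sub>o X) \<otimes>\<^sub>o Y)"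
  proof -
    have "(assoc ?I ?I X \<boxtimes> idt Y) \<star> (assoc' ?I ?I X \<boxtimes> idt Y) = idt ((?I \<otimes>\<^sub>o ?I \<otimes>\<^sub>o X) \<otimes>\<^sub>o Y)"
      using X Y by (simp add: tens_cmp_left[symmetric])
    note cmp_pre[OF this, simp]
    show ?thesis using X Y by simp
  qed
  ultimately have "idt ?I \<boxtimes> lunit X \<boxtimes> idt Y = idt ?I \<boxtimes> (lunit (X \<otimes>\<^sub>o Y) \<star> assoc ?I X Y)"
    using X Y by (simp add: tens_cmp_right)
  then show ?thesis
    using X Y by (intro cancel_tens_unit_left[of "lunit X \<boxtimes> idt Y"]) simp_all
qed

lemma tens_inverse_right:
  assumes "arr f" "arr g" "tgt g = src f" "f \<star> g = idt Y" "X \<in> Ob M" "arr k"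
    "tgt k = X \<otimes>\<^sub>o src g"
  shows "(idt X \<boxtimes> f) \<star> (idt X \<boxtimes> g) \<star> k = k"
proof -
  have Y: "tgt f = Y" "src g = Y"
    using assms(4) by (metis tgt_cmp tgt_idt, metis src_cmp src_idt)
  then have "Y \<in> Ob M" using assms(1) by auto
  moreover have "(idt X \<boxtimes> f) \<star> (idt X \<boxtimes> g) = idt X \<boxtimes> idt Y"
    using assms tens_cmp_right[of g f X] by simp
  ultimately show ?thesis using assms Y by (simp add: cmp_pre[of "idt X \<boxtimes> f" "idt X \<boxtimes> g"])
qed

text \<open>The pentagon solved for composites that mix \<open>assoc\<close> and
  \<open>assoc'\<close>. Left actions on tensor products contain \<open>assoc'\<close>: the first
  form serves their associativity, the second their compatibility with right actions.\<close>

lemma pentagon_assoc':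
  assumes [simp]: "W \<in> Ob M" "X \<in> Ob M" "Y \<in> Ob M" "Z \<in> Ob M"
  shows "(assoc W X Y \<boxtimes> idt Z) \<star> assoc' (W \<otimes>\<^sub>o X) Y Z =
      assoc' W (X \<otimes>\<^sub>o Y) Z \<star> (idt W \<boxtimes> assoc' X Y Z) \<star> assoc W X (Y \<otimes>\<^sub>o Z)" (is ?A)
    and "assoc (W \<otimes>\<^sub>o X) Y Z \<star> (assoc' W X Y \<boxtimes> idt Z) =
      assoc' W X (Y \<otimes>\<^sub>o Z) \<star> (idt W \<boxtimes> assoc X Y Z) \<star> assoc W (X \<otimes>\<^sub>o Y) Z" (is ?B)
proof -
  note inv = tens_inverse_right[of "assoc' X Y Z" "assoc X Y Z" "(X \<otimes>\<^sub>o Y) \<otimes>\<^sub>o Z" W]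
  have "(assoc W X Y \<boxtimes> idt Z) \<star> assoc' (W \<otimes>\<^sub>o X) Y Z =
      assoc' W (X \<otimes>\<^sub>o Y) Z \<star> (idt W \<boxtimes> assoc' X Y Z) \<star>
        ((idt W \<boxtimes> assoc X Y Z) \<star> assoc W (X \<otimes>\<^sub>o Y) Z \<star> (assoc W X Y \<boxtimes> idt Z)) \<star> assoc' (W \<otimes>\<^sub>o X) Y Z"
    by (simp add: inv)
  also have "\<dots> = assoc' W (X \<otimes>\<^sub>o Y) Z \<star> (idt W \<boxtimes> assoc' X Y Z) \<star> assoc W X (Y \<otimes>\<^sub>o Z)"
    by (simp add: pentagon_arr[symmetric])
  finally show ?A .
  have "assoc (W \<otimes>\<^sub>o X) Y Z \<star> (assoc' W X Y \<boxtimes> idt Z) =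
      assoc' W X (Y \<otimes>\<^sub>o Z) \<star> (assoc W X (Y \<otimes>\<^sub>o Z) \<star> assoc (W \<otimes>\<^sub>o X) Y Z) \<star> (assoc' W X Y \<boxtimes> idt Z)"
    by simp
  also have "\<dots> = assoc' W X (Y \<otimes>\<^sub>o Z) \<star> (idt W \<boxtimes> assoc X Y Z) \<star> assoc W (X \<otimes>\<^sub>o Y) Z \<star>
      ((assoc W X Y \<boxtimes> idt Z) \<star> (assoc' W X Y \<boxtimes> idt Z))"
    by (simp only: pentagon_arr[OF assms]) simp
  also have "\<dots> = assoc' W X (Y \<otimes>\<^sub>o Z) \<star> (idt W \<boxtimes> assoc X Y Z) \<star> assoc W (X \<otimes>\<^sub>o Y) Z"
    by (simp add: tens_cmp_left[symmetric])
  finally show ?B .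
qed

end

section \<open>Bimodules\<close>

context algebra_in
begin

notation cmp (infixr \<open>\<star>\<close> 70)
notation tens (infixr \<open>\<boxtimes>\<close> 75)

section \<open>Modules and linear maps as arrows\<close>

definition mm :: "('o, 'm) arrow" where "mm = Arrow (A \<otimes>\<^sub>o A) A m"

definition uu :: "('o, 'm) arrow" where "uu = Arrow (unitob M) A u"

definition lmod :: "'o \<Rightarrow> ('o, 'm) arrow \<Rightarrow> bool" where
  "lmod X l \<longleftrightarrow> X \<in> Ob M \<and> arr l \<and> src l = A \<otimes>\<^sub>o X \<and> tgt l = X \<and>
    l \<star> (mm \<boxtimes> idt X) = l \<star> (idt A \<boxtimes> l) \<star> assoc A A X \<and> l \<star> (uu \<boxtimes> idt X) = lunit X"

definition rmod :: "'o \<Rightarrow> ('o, 'm) arrow \<Rightarrow> bool" where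
  "rmod X r \<longleftrightarrow> X \<in> Ob M \<and> arr r \<and> src r = X \<otimes>\<^sub>o A \<and> tgt r = X \<and>
    r \<star> (r \<boxtimes> idt A) = r \<star> (idt X \<boxtimes> mm) \<star> assoc X A A \<and> r \<star> (idt X \<boxtimes> uu) = runit X"

definition bimod :: "'o \<Rightarrow> ('o, 'm) arrow \<Rightarrow> ('o, 'm) arrow \<Rightarrow> bool" where
  "bimod X l r \<longleftrightarrow> lmod X l \<and> rmod X r \<and> r \<star> (l \<boxtimes> idt A) = l \<star> (idt A \<boxtimes> r) \<star> assoc A X A"

text \<open>A module is passed as its action alone, since its carrier is the target of the
  action.\<close>

definition llin :: "('o, 'm) arrow \<Rightarrow> ('o, 'm) arrow \<Rightarrow> ('o, 'm) arrow \<Rightarrow> bool" where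
  "llin l l' f \<longleftrightarrow> arr f \<and> src f = tgt l \<and> tgt f = tgt l' \<and> f \<star> l = l' \<star> (idt A \<boxtimes> f)"

definition rlin :: "('o, 'm) arrow \<Rightarrow> ('o, 'm) arrow \<Rightarrow> ('o, 'm) arrow \<Rightarrow> bool" where
  "rlin r r' f \<longleftrightarrow> arr f \<and> src f = tgt r \<and> tgt f = tgt r' \<and> f \<star> r = r' \<star> (f \<boxtimes> idt A)"

lemma mm_uu [simp]:
  "A \<in> Ob M" "arr mm" "src mm = A \<otimes>\<^sub>o A" "tgt mm = A" "mor mm = m"
  "arr uu" "src uu = unitob M" "tgt uu = A" "mor uu = u"
  using A_in m_in u_in by (simp_all add: mm_def uu_def arr_Arrow)

lemma lmodD:
  assumes "lmod X l"
  shows "X \<in> Ob M" "arr l" "src l = A \<otimes>\<^sub>o X" "tgt l = X"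
    "l \<star> (mm \<boxtimes> idt X) = l \<star> (idt A \<boxtimes> l) \<star> assoc A A X" "l \<star> (uu \<boxtimes> idt X) = lunit X"
  using assms by (simp_all add: lmod_def)

lemma rmodD:
  assumes "rmod X r"
  shows "X \<in> Ob M" "arr r" "src r = X \<otimes>\<^sub>o A" "tgt r = X"
    "r \<star> (r \<boxtimes> idt A) = r \<star> (idt X \<boxtimes> mm) \<star> assoc X A A" "r \<star> (idt X \<boxtimes> uu) = runit X"
  using assms by (simp_all add: rmod_def)

lemma bimodD:
  assumes "bimod X l r"
  shows "lmod X l" "rmod X r" "r \<star> (l \<boxtimes> idt A) = l \<star> (idt A \<boxtimes> r) \<star> assoc A X A"
  using assms by (simp_all add: bimod_def)

lemma llinD:
  assumes "llin l l' f"
  shows "arr f" "src f = tgt l" "tgt f = tgt l'" "f \<star> l = l' \<star> (idt A \<boxtimes> f)"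
  using assms by (simp_all add: llin_def)

lemma rlinD:
  assumes "rlin r r' f"
  shows "arr f" "src f = tgt r" "tgt f = tgt r'" "f \<star> r = r' \<star> (f \<boxtimes> idt A)"
  using assms by (simp_all add: rlin_def)

lemma is_left_module_iff: "is_left_module M A m u X l \<longleftrightarrow> lmod X (Arrow (A \<otimes>\<^sub>o X) X l)"
proof -
  let ?l = "Arrow (A \<otimes>\<^sub>o X) X l"
  \<comment> \<open>This left-nested form is the one that unfolds literally to
    \<open>is_left_module\<close>; passing to it uses associativity and hence the typing
    conditions.\<close>
  have "lmod X ?l \<longleftrightarrow> X \<in> Ob M \<and> arr ?l \<and>
    ?l \<star> (mm \<boxtimes> idt X) = (?l \<star> (idt A \<boxtimes> ?l)) \<star> assoc A A X \<and> ?l \<star> (uu \<boxtimes> idt X) = lunit X"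
    unfolding lmod_def by auto
  also have "\<dots> \<longleftrightarrow> is_left_module M A m u X l"
    unfolding is_left_module_def by (auto simp: arr_Arrow cmp_def tens_def assoc_def lunit_def)
  finally show ?thesis by simp
qed

lemma is_right_module_iff: "is_right_module M A m u X r \<longleftrightarrow> rmod X (Arrow (X \<otimes>\<^sub>o A) X r)"
proof -
  let ?r = "Arrow (X \<otimes>\<^sub>o A) X r"
  have "rmod X ?r \<longleftrightarrow> X \<in> Ob M \<and> arr ?r \<and>
    ?r \<star> (?r \<boxtimes> idt A) = (?r \<star> (idt X \<boxtimes> mm)) \<star> assoc X A A \<and> ?r \<star> (idt X \<boxtimes> uu) = runit X"
    unfolding rmod_def by auto
  also have "\<dots> \<longleftrightarrow> is_right_module M A m u X r"
    unfolding is_right_module_def by (auto simp: arr_Arrow cmp_def tens_def assoc_def runit_def)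
  finally show ?thesis by simp
qed

lemma is_bimodule_iff:
  "is_bimodule M A m u (X, l, r) \<longleftrightarrow> bimod X (Arrow (A \<otimes>\<^sub>o X) X l) (Arrow (X \<otimes>\<^sub>o A) X r)"
proof -
  let ?l = "Arrow (A \<otimes>\<^sub>o X) X l" and ?r = "Arrow (X \<otimes>\<^sub>o A) X r"
  have "bimod X ?l ?r \<longleftrightarrow> lmod X ?l \<and> rmod X ?r \<and>
      ?r \<star> (?l \<boxtimes> idt A) = (?l \<star> (idt A \<boxtimes> ?r)) \<star> assoc A X A"
    unfolding bimod_def using lmodD(1,2)[of X ?l] rmodD(2)[of X ?r] by auto
  then show ?thesis
    by (auto simp: is_bimodule_def is_left_module_iff is_right_module_iff cmp_def tens_def assoc_def)
qed

lemma bimod_hom_iff: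
  assumes "X \<in> Ob M" "X' \<in> Ob M"
  shows "f \<in> bimod_hom M A (X, l, r) (X', l', r') \<longleftrightarrow>
    llin (Arrow (A \<otimes>\<^sub>o X) X l) (Arrow (A \<otimes>\<^sub>o X') X' l') (Arrow X X' f) \<and>
    rlin (Arrow (X \<otimes>\<^sub>o A) X r) (Arrow (X' \<otimes>\<^sub>o A) X' r') (Arrow X X' f)"
  using assms by (auto simp: bimod_hom_def llin_def rlin_def arr_Arrow cmp_def tens_def)

lemma lmod_regular: "lmod A mm"
proof -
  have "mm \<star> (mm \<boxtimes> idt A) = (mm \<star> (idt A \<boxtimes> mm)) \<star> assoc A A A"
    "mm \<star> (uu \<boxtimes> idt A) = lunit A"
    using m_assoc unit_left by (simp_all add: arrow.expand del: cmp_assoc)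
  then show ?thesis by (simp add: lmod_def)
qed

lemma rmod_regular: "rmod A mm"
proof -
  have "mm \<star> (mm \<boxtimes> idt A) = (mm \<star> (idt A \<boxtimes> mm)) \<star> assoc A A A"
    "mm \<star> (idt A \<boxtimes> uu) = runit A"
    using m_assoc unit_right by (simp_all add: arrow.expand del: cmp_assoc)
  then show ?thesis by (simp add: rmod_def)
qed

lemma bimod_regular: "bimod A mm mm"
  using lmod_regular rmod_regular rmodD(5)[OF rmod_regular] by (simp add: bimod_def)

section \<open>Actions on tensor products and induced linear maps\<close>

lemma lmod_tens:
  assumes V: "lmod V l" and X [simp]: "X \<in> Ob M"
  shows "lmod (V \<otimes>\<^sub>o X) ((l \<boxtimes> idt X) \<star> assoc' A V X)"
proof -
  note [simp] = lmodD(1-4)[OF V]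
  have "((l \<boxtimes> idt X) \<star> assoc' A V X) \<star> (mm \<boxtimes> idt (V \<otimes>\<^sub>o X)) =
      ((l \<star> (mm \<boxtimes> idt V)) \<boxtimes> idt X) \<star> assoc' (A \<otimes>\<^sub>o A) V X"
    by (simp add: assoc_pushes tens_cmp_left)
  also have "\<dots> = (l \<boxtimes> idt X) \<star> ((idt A \<boxtimes> l) \<boxtimes> idt X) \<star> (assoc A A V \<boxtimes> idt X) \<star> assoc' (A \<otimes>\<^sub>o A) V X"
    by (simp add: lmodD(5)[OF V] tens_cmp_left)
  also have "\<dots> = ((l \<boxtimes> idt X) \<star> assoc' A V X) \<star> (idt A \<boxtimes> ((l \<boxtimes> idt X) \<star> assoc' A V X)) \<star> assoc A A (V \<otimes>\<^sub>o X)"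
    by (simp add: pentagon_assoc' tens_cmp_right assoc_pushes)
  finally have 1: "((l \<boxtimes> idt X) \<star> assoc' A V X) \<star> (mm \<boxtimes> idt (V \<otimes>\<^sub>o X)) = \<dots>" .
  have "((l \<boxtimes> idt X) \<star> assoc' A V X) \<star> (uu \<boxtimes> idt (V \<otimes>\<^sub>o X)) =
      ((l \<star> (uu \<boxtimes> idt V)) \<boxtimes> idt X) \<star> assoc' (unitob M) V X"
    by (simp add: assoc_pushes tens_cmp_left)
  also have "\<dots> = lunit (V \<otimes>\<^sub>o X)"
    by (simp add: lmodD(6)[OF V] lunit_tob)
  finally show ?thesis using 1 by (simp add: lmod_def)
qed

text \<open>Associativity is that of \<open>W\<close>, carried over by the pentagon; the unit law is
  that of \<open>W\<close> combined with \<open>runit_tob\<close>.\<close>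

lemma rmod_tens:
  assumes W: "rmod W r" and X [simp]: "X \<in> Ob M"
  shows "rmod (X \<otimes>\<^sub>o W) ((idt X \<boxtimes> r) \<star> assoc X W A)"
proof -
  note [simp] = rmodD(1-4)[OF W]
  have "((idt X \<boxtimes> r) \<star> assoc X W A) \<star> (((idt X \<boxtimes> r) \<star> assoc X W A) \<boxtimes> idt A) =
      (idt X \<boxtimes> (r \<star> (r \<boxtimes> idt A))) \<star> assoc X (W \<otimes>\<^sub>o A) A \<star> (assoc X W A \<boxtimes> idt A)"
    by (simp add: assoc_pushes tens_cmp_left tens_cmp_right)
  also have "\<dots> = (idt X \<boxtimes> r) \<star> (idt X \<boxtimes> idt W \<boxtimes> mm) \<star>
      (idt X \<boxtimes> assoc W A A) \<star> assoc X (W \<otimes>\<^sub>o A) A \<star> (assoc X W A \<boxtimes> idt A)"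
    by (simp add: rmodD(5)[OF W] tens_cmp_right)
  also have "\<dots> = ((idt X \<boxtimes> r) \<star> assoc X W A) \<star> (idt (X \<otimes>\<^sub>o W) \<boxtimes> mm) \<star> assoc (X \<otimes>\<^sub>o W) A A"
    by (simp add: pentagon_arr[symmetric] assoc_pushes)
  finally have 1: "((idt X \<boxtimes> r) \<star> assoc X W A) \<star> (((idt X \<boxtimes> r) \<star> assoc X W A) \<boxtimes> idt A) = \<dots>" .
  have "((idt X \<boxtimes> r) \<star> assoc X W A) \<star> (idt (X \<otimes>\<^sub>o W) \<boxtimes> uu) =
      (idt X \<boxtimes> (r \<star> (idt W \<boxtimes> uu))) \<star> assoc X W (unitob M)"
    by (simp add: assoc_pushes tens_cmp_right)
  also have "\<dots> = runit (X \<otimes>\<^sub>o W)"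
    by (simp add: rmodD(6)[OF W] runit_tob)
  finally show ?thesis using 1 by (simp add: rmod_def)
qed

text \<open>The left action touches only \<open>V\<close> and the right action only
  \<open>W\<close>, so they commute by the interchange law \<open>ex\<close>, up to the pentagon.
  The instances of interest are \<open>A \<otimes> A\<close> and the free bimodules.\<close>

lemma bimod_tens:
  assumes V: "lmod V l" and W: "rmod W r"
  shows "bimod (V \<otimes>\<^sub>o W) ((l \<boxtimes> idt W) \<star> assoc' A V W) ((idt V \<boxtimes> r) \<star> assoc V W A)"
proof -
  note [simp] = lmodD(1-4)[OF V] rmodD(1-4)[OF W]
  have ex: "(idt V \<boxtimes> r) \<star> (l \<boxtimes> idt (W \<otimes>\<^sub>o A)) = (l \<boxtimes> idt W) \<star> (idt (A \<otimes>\<^sub>o V) \<boxtimes> r)"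
    by (rule tens_exchange[symmetric]) simp_all
  have "((idt V \<boxtimes> r) \<star> assoc V W A) \<star> (((l \<boxtimes> idt W) \<star> assoc' A V W) \<boxtimes> idt A) =
      ((idt V \<boxtimes> r) \<star> (l \<boxtimes> idt (W \<otimes>\<^sub>o A))) \<star> assoc (A \<otimes>\<^sub>o V) W A \<star> (assoc' A V W \<boxtimes> idt A)"
    by (simp add: tens_cmp_left assoc_pushes)
  also have "\<dots> = ((l \<boxtimes> idt W) \<star> assoc' A V W) \<star> (idt A \<boxtimes> ((idt V \<boxtimes> r) \<star> assoc V W A)) \<star> assoc A (V \<otimes>\<^sub>o W) A"
    unfolding ex pentagon_assoc'[OF mm_uu(1) lmodD(1)[OF V] rmodD(1)[OF W] mm_uu(1)]
    by (simp add: tens_cmp_right assoc_pushes)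
  finally show ?thesis
    using lmod_tens[OF V, of W] rmod_tens[OF W, of V] by (simp add: bimod_def)
qed

text \<open>In elements, \<open>a \<otimes> x \<mapsto> a t(x)\<close>: the extension of
  \<open>t\<close> to the free left module on \<open>X\<close>. Its linearity is associativity of
  the action on \<open>Y\<close>.\<close>

lemma llin_free:
  assumes Y: "lmod Y l" and t: "arr t" "tgt t = Y" "src t = X"
  shows "llin ((mm \<boxtimes> idt X) \<star> assoc' A A X) l (l \<star> (idt A \<boxtimes> t))"
proof -
  note [simp] = lmodD(1-4)[OF Y] t
  have [simp]: "X \<in> Ob M" using arr_src[OF t(1)] by simp
  have "(l \<star> (idt A \<boxtimes> t)) \<star> (mm \<boxtimes> idt X) \<star> assoc' A A X =
      l \<star> ((idt A \<boxtimes> t) \<star> (mm \<boxtimes> idt X)) \<star> assoc' A A X"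
    by simp
  also have "\<dots> = (l \<star> (mm \<boxtimes> idt Y)) \<star> (idt (A \<otimes>\<^sub>o A) \<boxtimes> t) \<star> assoc' A A X"
    using tens_exchange[of mm t "A \<otimes>\<^sub>o A" A X Y, symmetric] by simp
  also have "\<dots> = l \<star> (idt A \<boxtimes> (l \<star> (idt A \<boxtimes> t)))"
    by (simp add: lmodD(5)[OF Y] assoc_pushes tens_cmp_right)
  finally show ?thesis by (simp add: llin_def)
qed

text \<open>In elements, the map is \<open>v \<otimes> a \<mapsto> g(v) a\<close>. It is left linear
  because \<open>g\<close> is and the two actions on \<open>Y\<close> commute; it is right linear by
  associativity of the right action, whatever \<open>g\<close> does on the right.\<close>

lemma induced_lin:
  assumes V: "lmod V v" and Y: "bimod Y l r" and g: "llin v l g"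
  shows "llin ((v \<boxtimes> idt A) \<star> assoc' A V A) l (r \<star> (g \<boxtimes> idt A))"
    and "rlin ((idt V \<boxtimes> mm) \<star> assoc V A A) r (r \<star> (g \<boxtimes> idt A))"
proof -
  note [simp] = lmodD(1-4)[OF V] lmodD(1-4)[OF bimodD(1)[OF Y]] rmodD(2-4)[OF bimodD(2)[OF Y]]
    llinD(1-3)[OF g]
  have "(r \<star> (g \<boxtimes> idt A)) \<star> (v \<boxtimes> idt A) \<star> assoc' A V A = r \<star> ((g \<star> v) \<boxtimes> idt A) \<star> assoc' A V A"
    by (simp add: tens_cmp_left)
  also have "\<dots> = (r \<star> (l \<boxtimes> idt A)) \<star> ((idt A \<boxtimes> g) \<boxtimes> idt A) \<star> assoc' A V A"
    by (simp add: llinD(4)[OF g] tens_cmp_left)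
  also have "\<dots> = l \<star> (idt A \<boxtimes> (r \<star> (g \<boxtimes> idt A)))"
    by (simp add: bimodD(3)[OF Y] assoc_pushes tens_cmp_right)
  finally show "llin ((v \<boxtimes> idt A) \<star> assoc' A V A) l (r \<star> (g \<boxtimes> idt A))"
    by (simp add: llin_def)
  have "(r \<star> (g \<boxtimes> idt A)) \<star> (idt V \<boxtimes> mm) \<star> assoc V A A =
      r \<star> ((g \<boxtimes> idt A) \<star> (idt V \<boxtimes> mm)) \<star> assoc V A A"
    by simp
  also have "\<dots> = (r \<star> (idt Y \<boxtimes> mm)) \<star> (g \<boxtimes> idt (A \<otimes>\<^sub>o A)) \<star> assoc V A A"
    using tens_exchange[of g mm V Y "A \<otimes>\<^sub>o A" A] by simp
  also have "\<dots> = (r \<star> (idt Y \<boxtimes> mm) \<star> assoc Y A A) \<star> ((g \<boxtimes> idt A) \<boxtimes> idt A)"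
    by (simp add: assoc_pushes)
  also have "\<dots> = r \<star> ((r \<star> (g \<boxtimes> idt A)) \<boxtimes> idt A)"
    by (simp add: rmodD(5)[OF bimodD(2)[OF Y], symmetric] tens_cmp_left)
  finally show "rlin ((idt V \<boxtimes> mm) \<star> assoc V A A) r (r \<star> (g \<boxtimes> idt A))"
    by (simp add: rlin_def)
qed

definition blin :: "('o, 'm) arrow \<Rightarrow> ('o, 'm) arrow \<Rightarrow> ('o, 'm) arrow \<Rightarrow> ('o, 'm) arrow \<Rightarrow>
    ('o, 'm) arrow \<Rightarrow> bool" where
  "blin l r l' r' f \<longleftrightarrow> llin l l' f \<and> rlin r r' f"

lemma llin_cmp:
  assumes "lmod X l" "lmod X' l'" "lmod X'' l''" and f: "llin l l' f" and g: "llin l' l'' g"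
  shows "llin l l'' (g \<star> f)"
proof -
  note [simp] = lmodD(1-4)[OF assms(1)] lmodD(1-4)[OF assms(2)] lmodD(1-4)[OF assms(3)]
    llinD(1-3)[OF f] llinD(1-3)[OF g]
  have "(g \<star> f) \<star> l = (g \<star> l') \<star> (idt A \<boxtimes> f)"
    by (simp add: llinD(4)[OF f])
  also have "\<dots> = l'' \<star> (idt A \<boxtimes> (g \<star> f))"
    by (simp add: llinD(4)[OF g] tens_cmp_right)
  finally show ?thesis by (simp add: llin_def)
qed

lemma rlin_cmp:
  assumes "rmod X r" "rmod X' r'" "rmod X'' r''" and f: "rlin r r' f" and g: "rlin r' r'' g"
  shows "rlin r r'' (g \<star> f)"
proof -
  note [simp] = rmodD(1-4)[OF assms(1)] rmodD(1-4)[OF assms(2)] rmodD(1-4)[OF assms(3)]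
    rlinD(1-3)[OF f] rlinD(1-3)[OF g]
  have "(g \<star> f) \<star> r = (g \<star> r') \<star> (f \<boxtimes> idt A)"
    by (simp add: rlinD(4)[OF f])
  also have "\<dots> = r'' \<star> ((g \<star> f) \<boxtimes> idt A)"
    by (simp add: rlinD(4)[OF g] tens_cmp_left)
  finally show ?thesis by (simp add: rlin_def)
qed

lemma blin_cmp:
  assumes "bimod X l r" "bimod X' l' r'" "bimod X'' l'' r''" "blin l r l' r' f" "blin l' r' l'' r'' g"
  shows "blin l r l'' r'' (g \<star> f)"
  using assms llin_cmp[of X l X' l' X'' l'' f g] rlin_cmp[of X r X' r' X'' r'' f g]
  by (simp add: blin_def bimod_def)

lemma blin_idt: "bimod X l r \<Longrightarrow> blin l r l r (idt X)"
  by (simp add: blin_def bimod_def llin_def rlin_def lmod_def rmod_def)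

text \<open>\<open>A \<otimes> s\<close> and \<open>s \<otimes> A\<close> are sections of
  \<open>A \<otimes> e\<close> and \<open>e \<otimes> A\<close>, so the linearity of
  \<open>h\<close> may be tested after composition with these, where it becomes the linearity of
  \<open>h \<star> e\<close> and \<open>e\<close>. The section itself need not be linear.\<close>

lemma blin_descend:
  assumes X: "bimod X l r" and Y: "bimod Y l' r'" and Z: "bimod Z l'' r''"
    and e: "blin l r l' r' e" and s: "arr s" "src s = Y" "tgt s = X" "e \<star> s = idt Y"
    and h: "arr h" "src h = Y" "tgt h = Z" and he: "blin l r l'' r'' (h \<star> e)"
  shows "blin l' r' l'' r'' h"
proof -
  note [simp] = lmodD(1-4)[OF bimodD(1)[OF X]] lmodD(1-4)[OF bimodD(1)[OF Y]]
    lmodD(1-4)[OF bimodD(1)[OF Z]] rmodD(2-4)[OF bimodD(2)[OF X]] rmodD(2-4)[OF bimodD(2)[OF Y]]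
    rmodD(2-4)[OF bimodD(2)[OF Z]] s h
  have el: "llin l l' e" and er: "rlin r r' e" and hel: "llin l l'' (h \<star> e)"
    and her: "rlin r r'' (h \<star> e)"
    using e he by (simp_all add: blin_def)
  note [simp] = llinD(1-3)[OF el]
  have "h \<star> l' = h \<star> l' \<star> (idt A \<boxtimes> (e \<star> s))" by simp
  also have "\<dots> = h \<star> (l' \<star> (idt A \<boxtimes> e)) \<star> (idt A \<boxtimes> s)"
    by (simp add: tens_cmp_right del: s(4))
  also have "\<dots> = ((h \<star> e) \<star> l) \<star> (idt A \<boxtimes> s)"
    by (simp add: llinD(4)[OF el, symmetric])
  also have "\<dots> = l'' \<star> (idt A \<boxtimes> (h \<star> e \<star> s))"
    unfolding llinD(4)[OF hel] by (simp add: tens_cmp_right del: s(4))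
  also have "\<dots> = l'' \<star> (idt A \<boxtimes> h)" by simp
  finally have 1: "llin l' l'' h" by (simp add: llin_def)
  have "h \<star> r' = h \<star> r' \<star> ((e \<star> s) \<boxtimes> idt A)" by simp
  also have "\<dots> = h \<star> (r' \<star> (e \<boxtimes> idt A)) \<star> (s \<boxtimes> idt A)"
    by (simp add: tens_cmp_left del: s(4))
  also have "\<dots> = ((h \<star> e) \<star> r) \<star> (s \<boxtimes> idt A)"
    by (simp add: rlinD(4)[OF er, symmetric])
  also have "\<dots> = r'' \<star> ((h \<star> e \<star> s) \<boxtimes> idt A)"
    unfolding rlinD(4)[OF her] by (simp add: tens_cmp_left del: s(4))
  also have "\<dots> = r'' \<star> (h \<boxtimes> idt A)" by simp
  finally have "rlin r' r'' h" by (simp add: rlin_def)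
  with 1 show ?thesis by (simp add: blin_def)
qed

text \<open>Each module axiom for \<open>K\<close> is an equation between arrows ending in
  \<open>K\<close>. Composed with \<open>k\<close> it becomes the axiom for \<open>X\<close>, and
  \<open>k\<close> can be cancelled.\<close>

lemma bimod_sub:
  assumes X: "bimod X l r" and k: "arr k" "src k = K" "tgt k = X"
    and mono: "\<And>f g. \<lbrakk>arr f; arr g; tgt f = K; tgt g = K; src f = src g; k \<star> f = k \<star> g\<rbrakk> \<Longrightarrow> f = g"
    and l': "arr l'" "src l' = A \<otimes>\<^sub>o K" "tgt l' = K" and kl: "k \<star> l' = l \<star> (idt A \<boxtimes> k)"
    and r': "arr r'" "src r' = K \<otimes>\<^sub>o A" "tgt r' = K" and kr: "k \<star> r' = r \<star> (k \<boxtimes> idt A)"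
  shows "bimod K l' r'"
proof -
  note L = bimodD(1)[OF X] and R = bimodD(2)[OF X]
  note [simp] = lmodD(1-4)[OF L] rmodD(2-4)[OF R] k l' r'
  have K [simp]: "K \<in> Ob M" using arr_src[OF k(1)] by simp
  have "k \<star> l' \<star> (mm \<boxtimes> idt K) = l \<star> (idt A \<boxtimes> k) \<star> (mm \<boxtimes> idt K)"
    by (simp add: cmp_pre[OF kl])
  also have "\<dots> = (l \<star> (mm \<boxtimes> idt X)) \<star> (idt (A \<otimes>\<^sub>o A) \<boxtimes> k)"
    using tens_exchange[of mm k "A \<otimes>\<^sub>o A" A K X] by simp
  also have "\<dots> = l \<star> (idt A \<boxtimes> (l \<star> (idt A \<boxtimes> k))) \<star> assoc A A K"
    by (simp add: lmodD(5)[OF L] tens_cmp_right assoc_pushes)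
  also have "\<dots> = l \<star> (idt A \<boxtimes> (k \<star> l')) \<star> assoc A A K"
    by (simp only: kl)
  also have "\<dots> = k \<star> l' \<star> (idt A \<boxtimes> l') \<star> assoc A A K"
    by (simp add: tens_cmp_right cmp_pre[OF kl])
  finally have 1: "l' \<star> (mm \<boxtimes> idt K) = l' \<star> (idt A \<boxtimes> l') \<star> assoc A A K"
    by - (rule mono, simp_all)
  have "k \<star> l' \<star> (uu \<boxtimes> idt K) = l \<star> (idt A \<boxtimes> k) \<star> (uu \<boxtimes> idt K)"
    by (simp add: cmp_pre[OF kl])
  also have "\<dots> = (l \<star> (uu \<boxtimes> idt X)) \<star> (idt (unitob M) \<boxtimes> k)"
    using tens_exchange[of uu k "unitob M" A K X] by simp
  also have "\<dots> = k \<star> lunit K"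
    by (simp add: lmodD(6)[OF L] lunit_nat[of k K X])
  finally have 2: "l' \<star> (uu \<boxtimes> idt K) = lunit K"
    by - (rule mono, simp_all)
  have "k \<star> r' \<star> (r' \<boxtimes> idt A) = r \<star> ((k \<star> r') \<boxtimes> idt A)"
    by (simp add: cmp_pre[OF kr] tens_cmp_left)
  also have "\<dots> = (r \<star> (r \<boxtimes> idt A)) \<star> ((k \<boxtimes> idt A) \<boxtimes> idt A)"
    by (simp add: kr tens_cmp_left)
  also have "\<dots> = r \<star> ((idt X \<boxtimes> mm) \<star> (k \<boxtimes> idt (A \<otimes>\<^sub>o A))) \<star> assoc K A A"
    by (simp add: rmodD(5)[OF R] assoc_pushes)
  also have "\<dots> = (r \<star> (k \<boxtimes> idt A)) \<star> (idt K \<boxtimes> mm) \<star> assoc K A A"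
    using tens_exchange[of k mm K X "A \<otimes>\<^sub>o A" A, symmetric] by simp
  also have "\<dots> = k \<star> r' \<star> (idt K \<boxtimes> mm) \<star> assoc K A A"
    by (simp add: cmp_pre[OF kr])
  finally have 3: "r' \<star> (r' \<boxtimes> idt A) = r' \<star> (idt K \<boxtimes> mm) \<star> assoc K A A"
    by - (rule mono, simp_all)
  have "k \<star> r' \<star> (idt K \<boxtimes> uu) = r \<star> (k \<boxtimes> idt A) \<star> (idt K \<boxtimes> uu)"
    by (simp add: cmp_pre[OF kr])
  also have "\<dots> = (r \<star> (idt X \<boxtimes> uu)) \<star> (k \<boxtimes> idt (unitob M))"
    using tens_exchange[of k uu K X "unitob M" A] by simp
  also have "\<dots> = k \<star> runit K"
    by (simp add: rmodD(6)[OF R] runit_nat[of k K X])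
  finally have 4: "r' \<star> (idt K \<boxtimes> uu) = runit K"
    by - (rule mono, simp_all)
  have "k \<star> r' \<star> (l' \<boxtimes> idt A) = r \<star> ((k \<star> l') \<boxtimes> idt A)"
    by (simp add: cmp_pre[OF kr] tens_cmp_left)
  also have "\<dots> = (r \<star> (l \<boxtimes> idt A)) \<star> ((idt A \<boxtimes> k) \<boxtimes> idt A)"
    by (simp add: kl tens_cmp_left)
  also have "\<dots> = l \<star> (idt A \<boxtimes> (r \<star> (k \<boxtimes> idt A))) \<star> assoc A K A"
    by (simp add: bimodD(3)[OF X] tens_cmp_right assoc_pushes)
  also have "\<dots> = l \<star> (idt A \<boxtimes> (k \<star> r')) \<star> assoc A K A"
    by (simp only: kr)
  also have "\<dots> = k \<star> l' \<star> (idt A \<boxtimes> r') \<star> assoc A K A"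
    by (simp add: tens_cmp_right cmp_pre[OF kl])
  finally have 5: "r' \<star> (l' \<boxtimes> idt A) = l' \<star> (idt A \<boxtimes> r') \<star> assoc A K A"
    by - (rule mono, simp_all)
  show ?thesis using 1 2 3 4 5 by (simp add: bimod_def lmod_def rmod_def)
qed

text \<open>In elements, \<open>e(a t(x)) = a e(t(x))\<close>. This computation checks that the
  lifts built below, from \<open>A\<close> and from free bimodules, really are lifts.\<close>

lemma llin_ext:
  assumes "lmod X l" "lmod Y l'" "llin l l' e" "arr t" "tgt t = X"
  shows "e \<star> l \<star> (idt A \<boxtimes> t) = l' \<star> (idt A \<boxtimes> (e \<star> t))"
  using assms(4,5) lmodD(1-4)[OF assms(1)] lmodD(1-4)[OF assms(2)] llinD(1-3)[OF assms(3)]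
  by (simp add: cmp_pre[OF llinD(4)[OF assms(3)]] tens_cmp_right)

lemma rlin_ext:
  assumes "rmod X r" "rmod Y r'" "rlin r r' e" "arr t" "tgt t = X"
  shows "e \<star> r \<star> (t \<boxtimes> idt A) = r' \<star> ((e \<star> t) \<boxtimes> idt A)"
  using assms(4,5) rmodD(1-4)[OF assms(1)] rmodD(1-4)[OF assms(2)] rlinD(1-3)[OF assms(3)]
  by (simp add: cmp_pre[OF rlinD(4)[OF assms(3)]] tens_cmp_left)

text \<open>\<open>mm\<close> is the map that \<open>induced_lin\<close> attaches to the identity of
  \<open>A\<close>.\<close>

lemma blin_mult: "blin ((mm \<boxtimes> idt A) \<star> assoc' A A A) ((idt A \<boxtimes> mm) \<star> assoc A A A) mm mm mm"
proof -
  have "llin mm mm (idt A)" by (simp add: llin_def)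
  from induced_lin[OF lmod_regular bimod_regular this] show ?thesis
    by (simp add: blin_def)
qed

lemma section_lift:
  assumes \<sigma>: "blin mm mm ((mm \<boxtimes> idt A) \<star> assoc' A A A) ((idt A \<boxtimes> mm) \<star> assoc A A A) \<sigma>"
    and m\<sigma>: "mm \<star> \<sigma> = idt A"
    and X: "bimod X l r" and Y: "bimod Y l' r'" and e: "blin l r l' r' e"
    and s: "arr s" "src s = Y" "tgt s = X" "e \<star> s = idt Y" and f: "blin mm mm l' r' f"
  shows "\<exists>g. blin mm mm l r g \<and> e \<star> g = f"
proof -
  let ?S = "(mm \<boxtimes> idt A) \<star> assoc' A A A"
  note XL = bimodD(1)[OF X] and XR = bimodD(2)[OF X] and YL = bimodD(1)[OF Y] and YR = bimodD(2)[OF Y]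
  have e': "llin l l' e" "rlin r r' e" and f': "llin mm l' f" "rlin mm r' f"
    and \<sigma>': "llin mm ?S \<sigma>"
    using e f \<sigma> by (simp_all add: blin_def)
  note [simp] = lmodD(1-4)[OF XL] lmodD(1-4)[OF YL] rmodD(2-4)[OF XR] rmodD(2-4)[OF YR]
    llinD(1-3)[OF e'(1)] llinD(1-3)[OF f'(1)] llinD(1-3)[OF \<sigma>'] s
  \<comment> \<open>A lift of \<open>f\<close> in \<open>M\<close> only; the two averagings that
    follow make it linear on the left and then on the right.\<close>
  define t where "t = s \<star> f"
  have t [simp]: "arr t" "src t = A" "tgt t = X" and et: "e \<star> t = f"
    by (simp_all add: t_def cmp_pre[OF s(4)])
  define g1 where "g1 = l \<star> (idt A \<boxtimes> t) \<star> \<sigma>"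
  have g1: "llin mm l g1"
    using llin_cmp[OF lmod_regular lmod_tens[OF lmod_regular mm_uu(1)] XL \<sigma>'
        llin_free[OF XL t(1,3,2)]]
    by (simp add: g1_def)
  note [simp] = llinD(1-3)[OF g1]
  \<comment> \<open>Linearity of \<open>e\<close> turns the extension of \<open>t\<close> into that
    of \<open>e \<star> t = f\<close>, which is \<open>f \<star> mm\<close> since \<open>f\<close>
    is linear; \<open>\<sigma>\<close> then cancels \<open>mm\<close>.\<close>
  have eg1: "e \<star> g1 = f"
  proof -
    have "e \<star> g1 = (e \<star> l \<star> (idt A \<boxtimes> t)) \<star> \<sigma>" by (simp add: g1_def)
    also have "\<dots> = (f \<star> mm) \<star> \<sigma>"
      by (simp add: llin_ext[OF XL YL e'(1)] et llinD(4)[OF f'(1)])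
    also have "\<dots> = f" by (simp add: m\<sigma>)
    finally show ?thesis .
  qed
  \<comment> \<open>Left linearity survives the second averaging because \<open>\<sigma>\<close> is
    bilinear and \<open>induced_lin\<close> accepts the left linear \<open>g1\<close>.\<close>
  define g where "g = (r \<star> (g1 \<boxtimes> idt A)) \<star> \<sigma>"
  have "blin mm mm l r g"
    unfolding g_def
    using induced_lin[OF lmod_regular X g1]
    by (intro blin_cmp[OF bimod_regular bimod_tens[OF lmod_regular rmod_regular] X \<sigma>])
      (simp add: blin_def)
  moreover have "e \<star> g = f"
  proof -
    have "e \<star> g = (e \<star> r \<star> (g1 \<boxtimes> idt A)) \<star> \<sigma>" by (simp add: g_def)
    also have "\<dots> = (f \<star> mm) \<star> \<sigma>"
      by (simp add: rlin_ext[OF XR YR e'(2)] eg1 rlinD(4)[OF f'(2)])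
    also have "\<dots> = f" by (simp add: m\<sigma>)
    finally show ?thesis .
  qed
  ultimately show ?thesis by blast
qed

section \<open>Free bimodules\<close>

definition free_left :: "'o \<Rightarrow> ('o, 'm) arrow" where
  "free_left X = (mm \<boxtimes> idt X) \<star> assoc' A A X"

definition free_l :: "'o \<Rightarrow> ('o, 'm) arrow" where
  "free_l X = (free_left X \<boxtimes> idt A) \<star> assoc' A (A \<otimes>\<^sub>o X) A"

definition free_r :: "'o \<Rightarrow> ('o, 'm) arrow" where
  "free_r X = (idt (A \<otimes>\<^sub>o X) \<boxtimes> mm) \<star> assoc (A \<otimes>\<^sub>o X) A A"

lemma lmod_free: "X \<in> Ob M \<Longrightarrow> lmod (A \<otimes>\<^sub>o X) (free_left X)"
  unfolding free_left_def by (rule lmod_tens[OF lmod_regular])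

lemma bimod_free: "X \<in> Ob M \<Longrightarrow> bimod ((A \<otimes>\<^sub>o X) \<otimes>\<^sub>o A) (free_l X) (free_r X)"
  unfolding free_l_def free_r_def by (rule bimod_tens[OF lmod_free rmod_regular])

lemma blin_free:
  assumes Y: "bimod Y l r" and t: "arr t" "tgt t = Y" "src t = X"
  shows "blin (free_l X) (free_r X) l r (r \<star> ((l \<star> (idt A \<boxtimes> t)) \<boxtimes> idt A))"
proof -
  have X: "X \<in> Ob M" using arr_src[OF t(1)] t by simp
  from induced_lin[OF lmod_free[OF X] Y, unfolded free_left_def, OF llin_free[OF bimodD(1)[OF Y] t]]
  show ?thesis by (simp add: blin_def free_l_def free_r_def free_left_def)
qed

text \<open>The inclusion of generators, in elements
  \<open>x \<mapsto> (1 \<otimes> x) \<otimes> 1\<close>.\<close>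

definition free_unit :: "'o \<Rightarrow> ('o, 'm) arrow" where
  "free_unit X = (idt (A \<otimes>\<^sub>o X) \<boxtimes> uu) \<star> runit' (A \<otimes>\<^sub>o X) \<star> (uu \<boxtimes> idt X) \<star> lunit' X"

lemma free_unit_sel [simp]:
  assumes "X \<in> Ob M"
  shows "arr (free_unit X)" "src (free_unit X) = X" "tgt (free_unit X) = (A \<otimes>\<^sub>o X) \<otimes>\<^sub>o A"
  using assms by (simp_all add: free_unit_def)

text \<open>In elements, \<open>a ((1 \<otimes> x) \<otimes> 1) b = (a \<otimes> x) \<otimes>
  b\<close>: the generators generate. Hence a bilinear map out of a free bimodule can be recovered
  from its composite with \<open>free_unit\<close>.\<close>

lemma free_unit_ext:
  assumes X [simp]: "X \<in> Ob M"
  shows "free_r X \<star> ((free_l X \<star> (idt A \<boxtimes> free_unit X)) \<boxtimes> idt A) = idt ((A \<otimes>\<^sub>o X) \<otimes>\<^sub>o A)"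
proof -
  let ?I = "unitob M" and ?V = "A \<otimes>\<^sub>o X"
  \<comment> \<open>The inclusion splits as \<open>?\<iota> \<star> ?j\<close> with
    \<open>?j\<close> inserting the left unit and \<open>?\<iota>\<close> the right one. Fact 1 says
    that \<open>?j\<close> generates \<open>?V\<close> from the left, fact 2 that
    \<open>?\<iota>\<close> is left linear, fact 3 that \<open>?\<iota>\<close> generates from the
    right.\<close>
  let ?v = "free_left X" and ?\<iota> = "(idt ?V \<boxtimes> uu) \<star> runit' ?V" and ?j = "(uu \<boxtimes> idt X) \<star> lunit' X"
  note v [simp] = lmodD(2-4)[OF lmod_free[OF X]]
  have "?v \<star> (idt A \<boxtimes> ?j) = ((mm \<star> (idt A \<boxtimes> uu)) \<boxtimes> idt X) \<star> assoc' A ?I X \<star> (idt A \<boxtimes> lunit' X)"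
    by (simp add: free_left_def tens_cmp_right tens_cmp_left assoc_pushes)
  also have "\<dots> = (runit A \<boxtimes> idt X) \<star> assoc' A ?I X \<star> (idt A \<boxtimes> lunit' X)"
    by (simp add: rmodD(6)[OF rmod_regular])
  also have "\<dots> = (idt A \<boxtimes> lunit X) \<star> (idt A \<boxtimes> lunit' X)"
    by (simp add: triangle_arr[symmetric])
  also have "\<dots> = idt ?V"
    by (simp add: tens_cmp_right[symmetric])
  finally have 1: "?v \<star> (idt A \<boxtimes> ?j) = idt ?V" .
  \<comment> \<open>This and \<open>r'_nat\<close> move the inverse unitor hidden in
    \<open>?\<iota>\<close> past the left action.\<close>
  have r': "assoc' A ?V ?I \<star> (idt A \<boxtimes> runit' ?V) = runit' (A \<otimes>\<^sub>o ?V)"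
  proof -
    have "assoc' A ?V ?I \<star> (idt A \<boxtimes> runit' ?V) =
        (runit' (A \<otimes>\<^sub>o ?V) \<star> runit (A \<otimes>\<^sub>o ?V)) \<star> assoc' A ?V ?I \<star> (idt A \<boxtimes> runit' ?V)"
      by simp
    also have "\<dots> = runit' (A \<otimes>\<^sub>o ?V) \<star> (idt A \<boxtimes> runit ?V) \<star> (idt A \<boxtimes> runit' ?V)"
      by (simp add: runit_tob[of A ?V])
    also have "\<dots> = runit' (A \<otimes>\<^sub>o ?V)"
      by (simp add: tens_cmp_right[symmetric])
    finally show ?thesis .
  qed
  have r'_nat: "(?v \<boxtimes> idt ?I) \<star> runit' (A \<otimes>\<^sub>o ?V) = runit' ?V \<star> ?v"
  proof -
    have "(?v \<boxtimes> idt ?I) \<star> runit' (A \<otimes>\<^sub>o ?V) =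
        runit' ?V \<star> (runit ?V \<star> (?v \<boxtimes> idt ?I)) \<star> runit' (A \<otimes>\<^sub>o ?V)"
      by (simp add: cmp_pre[OF runit'_runit])
    also have "\<dots> = runit' ?V \<star> ?v"
      by (simp add: runit_nat[of ?v "A \<otimes>\<^sub>o ?V" ?V])
    finally show ?thesis .
  qed
  have "free_l X \<star> (idt A \<boxtimes> ?\<iota>) = ((?v \<boxtimes> idt A) \<star> (idt (A \<otimes>\<^sub>o ?V) \<boxtimes> uu)) \<star>
      assoc' A ?V ?I \<star> (idt A \<boxtimes> runit' ?V)"
    using assoc_push_cmp(3)[of "idt A" "idt ?V" uu]
    by (simp add: free_l_def tens_cmp_right assoc_pushes)
  also have "\<dots> = (idt ?V \<boxtimes> uu) \<star> (?v \<boxtimes> idt ?I) \<star> runit' (A \<otimes>\<^sub>o ?V)"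
    unfolding r' using tens_exchange[of ?v uu "A \<otimes>\<^sub>o ?V" ?V ?I A] by simp
  also have "\<dots> = ?\<iota> \<star> ?v"
    by (simp add: r'_nat)
  finally have 2: "free_l X \<star> (idt A \<boxtimes> ?\<iota>) = ?\<iota> \<star> ?v" .
  have "free_r X \<star> (?\<iota> \<boxtimes> idt A) =
      (idt ?V \<boxtimes> (mm \<star> (uu \<boxtimes> idt A))) \<star> assoc ?V ?I A \<star> (runit' ?V \<boxtimes> idt A)"
    by (simp add: free_r_def tens_cmp_left tens_cmp_right assoc_pushes)
  also have "\<dots> = (runit ?V \<boxtimes> idt A) \<star> (runit' ?V \<boxtimes> idt A)"
    by (simp add: lmodD(6)[OF lmod_regular] triangle_arr[symmetric])
  also have "\<dots> = idt (?V \<otimes>\<^sub>o A)"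
    by (simp add: tens_cmp_left[symmetric])
  finally have 3: "free_r X \<star> (?\<iota> \<boxtimes> idt A) = idt (?V \<otimes>\<^sub>o A)" .
  note F = lmodD(2-4)[OF bimodD(1)[OF bimod_free[OF X]]]
  have "free_l X \<star> (idt A \<boxtimes> free_unit X) = (free_l X \<star> (idt A \<boxtimes> ?\<iota>)) \<star> (idt A \<boxtimes> ?j)"
    using F by (simp add: free_unit_def tens_cmp_right)
  also have "\<dots> = ?\<iota> \<star> (?v \<star> (idt A \<boxtimes> ?j))"
    unfolding 2 by simp
  also have "\<dots> = ?\<iota>"
    unfolding 1 by simp
  finally show ?thesis using 3 by simp
qed

text \<open>Only the generators need lifting, and they lift along \<open>s\<close> in
  \<open>M\<close>. The extension \<open>g\<close> of that lift satisfies
  \<open>e \<star> g = f\<close> because both sides extend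
  \<open>f \<star> free_unit Z\<close>.\<close>

lemma free_lift:
  assumes Z [simp]: "Z \<in> Ob M" and X: "bimod X l r" and Y: "bimod Y l' r'" and e: "blin l r l' r' e"
    and s: "arr s" "src s = Y" "tgt s = X" "e \<star> s = idt Y" and f: "blin (free_l Z) (free_r Z) l' r' f"
  shows "\<exists>g. blin (free_l Z) (free_r Z) l r g \<and> e \<star> g = f"
proof -
  note XL = bimodD(1)[OF X] and XR = bimodD(2)[OF X] and YL = bimodD(1)[OF Y] and YR = bimodD(2)[OF Y]
    and F = bimod_free[OF Z]
  note FL = bimodD(1)[OF F] and FR = bimodD(2)[OF F]
  have e': "llin l l' e" "rlin r r' e" and f': "llin (free_l Z) l' f" "rlin (free_r Z) r' f"
    using e f by (simp_all add: blin_def)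
  note [simp] = lmodD(1-4)[OF XL] lmodD(1-4)[OF YL] lmodD(1-4)[OF FL]
    rmodD(2-4)[OF XR] rmodD(2-4)[OF YR] rmodD(2-4)[OF FR]
    llinD(1-3)[OF e'(1)] llinD(1-3)[OF f'(1)] s
  define t where "t = s \<star> f \<star> free_unit Z"
  have t [simp]: "arr t" "src t = Z" "tgt t = X" and et: "e \<star> t = f \<star> free_unit Z"
    by (simp_all add: t_def cmp_pre[OF s(4)])
  define g where "g = r \<star> ((l \<star> (idt A \<boxtimes> t)) \<boxtimes> idt A)"
  have "blin (free_l Z) (free_r Z) l r g"
    unfolding g_def by (rule blin_free[OF X]) simp_all
  moreover have "e \<star> g = f"
  proof -
    have "e \<star> g = r' \<star> ((l' \<star> (idt A \<boxtimes> (f \<star> free_unit Z))) \<boxtimes> idt A)"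
      by (simp add: g_def rlin_ext[OF XR YR e'(2)] llin_ext[OF XL YL e'(1)] et)
    also have "\<dots> = f \<star> free_r Z \<star> ((free_l Z \<star> (idt A \<boxtimes> free_unit Z)) \<boxtimes> idt A)"
      by (simp add: rlin_ext[OF FR YR f'(2)] llin_ext[OF FL YL f'(1)])
    also have "\<dots> = f" unfolding free_unit_ext[OF Z] by simp
    finally show ?thesis .
  qed
  ultimately show ?thesis by blast
qed

text \<open>\<open>e\<close> is \<open>(a \<otimes> x) \<otimes> b \<mapsto> a x b\<close>, and the
  unit laws make \<open>x \<mapsto> (1 \<otimes> x) \<otimes> 1\<close> a section of it in
  \<open>M\<close>. This provides enough projectives.\<close>

lemma free_counit:
  assumes X: "bimod X l r"
  shows "\<exists>e s. blin (free_l X) (free_r X) l r e \<and> arr s \<and> src s = X \<and> tgt s = (A \<otimes>\<^sub>o X) \<otimes>\<^sub>o A \<and>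
    e \<star> s = idt X"
proof -
  note XL = bimodD(1)[OF X] and XR = bimodD(2)[OF X]
  note [simp] = lmodD(1-4)[OF XL] rmodD(2-4)[OF XR]
  let ?I = "unitob M"
  let ?e = "r \<star> (l \<boxtimes> idt A)" and ?j = "(uu \<boxtimes> idt X) \<star> lunit' X"
  let ?s = "(?j \<boxtimes> idt A) \<star> (idt X \<boxtimes> uu) \<star> runit' X"
  have "?e \<star> ?s = r \<star> (((l \<star> (uu \<boxtimes> idt X)) \<star> lunit' X) \<boxtimes> idt A) \<star> (idt X \<boxtimes> uu) \<star> runit' X"
    by (simp add: tens_cmp_left)
  also have "\<dots> = idt X"
    unfolding lmodD(6)[OF XL] by (simp add: cmp_pre[OF rmodD(6)[OF XR]])
  finally have "?e \<star> ?s = idt X" .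
  moreover have "blin (free_l X) (free_r X) l r ?e"
    using blin_free[OF X, of "idt X" X] by simp
  ultimately show ?thesis
    by (intro exI[of _ ?e] exI[of _ ?s]) simp
qed

end


section \<open>Relative homological algebra\<close>

lemma (in normal) trivial_factor_group_iff:
  "trivial_group (G Mod H) \<longleftrightarrow> carrier G \<subseteq> H"
proof
  assume "trivial_group (G Mod H)"
  then have "carrier (G Mod H) = {H}"
    by (simp add: trivial_group_def FactGroup_def)
  then have "H #> x = H" if "x \<in> carrier G" for x
    using that by (auto simp: FactGroup_def RCOSETS_def)
  then show "carrier G \<subseteq> H"
    using rcos_self[OF _ subgroup_axioms] by blast
next
  assume "carrier G \<subseteq> H"
  then have "H #> x = H" if "x \<in> carrier G" for x
    using coset_join2[OF that subgroup_axioms] that by blast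
  then have "carrier (G Mod H) = {H}"
    by (auto simp: FactGroup_def RCOSETS_def)
  then show "trivial_group (G Mod H)"
    using factorgroup_is_group by (simp add: trivial_group_def FactGroup_def)
qed

lemma (in comm_group) subgroup_comm_group:
  assumes "subgroup H G"
  shows "comm_group (G\<lparr>carrier := H\<rparr>)"
  using group.group_comm_groupI[OF subgroup_imp_group[OF assms]] m_comm subgroup.mem_carrier[OF assms]
  by simp

lemma subgroup_equalizer:
  assumes "group_hom G H f" "group_hom G H g"
  shows "subgroup {x \<in> carrier G. f x = g x} G"
proof -
  interpret f: group_hom G H f by fact
  interpret g: group_hom G H g by fact
  show ?thesis by (rule f.G.subgroupI) (auto intro: f.G.one_closed)
qed

section \<open>Kernels and Hom complexes in preadditive categories\<close>

context preadditive_cat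
begin

lemma hom_group_simps [simp]:
  "carrier (hom_group C X Y) = Hom C X Y" "mult (hom_group C X Y) = madd C"
  "one (hom_group C X Y) = mzero C X Y"
  by (simp_all add: hom_group_def)

lemma mzero_in: "\<lbrakk>X \<in> Ob C; Y \<in> Ob C\<rbrakk> \<Longrightarrow> mzero C X Y \<in> Hom C X Y"
  using hom_comm_group[of X Y] comm_group.axioms(2) group.is_monoid monoid.one_closed
  by fastforce

lemma madd_mzero:
  assumes "X \<in> Ob C" "Y \<in> Ob C" "f \<in> Hom C X Y"
  shows "madd C (mzero C X Y) f = f"
  using monoid.l_one[OF group.is_monoid[OF comm_group.axioms(2)[OF hom_comm_group[of X Y]]]] assms
  by simp

lemma madd_mzero_right:
  assumes "X \<in> Ob C" "Y \<in> Ob C" "f \<in> Hom C X Y"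
  shows "madd C f (mzero C X Y) = f"
  using monoid.r_one[OF group.is_monoid[OF comm_group.axioms(2)[OF hom_comm_group[of X Y]]]] assms
  by simp

lemma madd_cancel:
  assumes "X \<in> Ob C" "Y \<in> Ob C" "f \<in> Hom C X Y" "g \<in> Hom C X Y" "h \<in> Hom C X Y"
    "madd C f h = madd C g h"
  shows "f = g"
  using group.right_cancel[OF comm_group.axioms(2)[OF hom_comm_group[of X Y]], of h f g] assms
  by simp

text \<open>The device by which additive operations are shown to preserve zero: they map
  \<open>0 = 0 + 0\<close> to an element equal to its double.\<close>

lemma madd_self:
  assumes "X \<in> Ob C" "Y \<in> Ob C" "f \<in> Hom C X Y" "madd C f f = f"
  shows "f = mzero C X Y"
  using madd_cancel[OF assms(1,2,3) mzero_in[OF assms(1,2)] assms(3)] madd_mzero assms by simp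

text \<open>The record \<open>precat\<close> has no symbol for negation; \<open>w\<close> stands for
  \<open>f - g\<close>.\<close>

lemma ex_difference:
  assumes "X \<in> Ob C" "Y \<in> Ob C" "f \<in> Hom C X Y" "g \<in> Hom C X Y"
  shows "\<exists>w\<in>Hom C X Y. madd C w g = f"
proof -
  interpret G: comm_group "hom_group C X Y" using assms by (intro hom_comm_group)
  let ?w = "mult (hom_group C X Y) f (m_inv (hom_group C X Y) g)"
  have "?w \<in> carrier (hom_group C X Y)" "mult (hom_group C X Y) ?w g = f"
    using assms by (simp_all add: G.m_assoc del: hom_group_simps
        add: hom_group_simps(1)[symmetric])
  then show ?thesis by auto
qed

lemma comp_mzero:
  assumes "X \<in> Ob C" "Y \<in> Ob C" "Z \<in> Ob C" "g \<in> Hom C Y Z"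
  shows "g \<cdot> mzero C X Y = mzero C X Z"
proof (rule madd_self)
  have "madd C (mzero C X Y) (mzero C X Y) = mzero C X Y"
    using assms by (simp add: madd_mzero mzero_in)
  then show "madd C (g \<cdot> mzero C X Y) (g \<cdot> mzero C X Y) = g \<cdot> mzero C X Y"
    using comp_madd_right[of X Y Z "mzero C X Y" "mzero C X Y" g] assms by (simp add: mzero_in)
qed (use assms mzero_in comp_in in auto)

lemma mzero_comp:
  assumes "X \<in> Ob C" "Y \<in> Ob C" "Z \<in> Ob C" "f \<in> Hom C X Y"
  shows "mzero C Y Z \<cdot> f = mzero C X Z"
proof (rule madd_self)
  have "madd C (mzero C Y Z) (mzero C Y Z) = mzero C Y Z"
    using assms by (simp add: madd_mzero mzero_in)
  then show "madd C (mzero C Y Z \<cdot> f) (mzero C Y Z \<cdot> f) = mzero C Y Z \<cdot> f"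
    using comp_madd_left[of X Y Z f "mzero C Y Z" "mzero C Y Z"] assms by (simp add: mzero_in)
qed (use assms mzero_in comp_in in auto)

lemma is_kernelD:
  assumes "is_kernel C X Y f K k"
  shows "K \<in> Ob C" "k \<in> Hom C K X" "f \<cdot> k = mzero C K Y"
    and "\<lbrakk>W \<in> Ob C; g \<in> Hom C W X; f \<cdot> g = mzero C W Y\<rbrakk> \<Longrightarrow> \<exists>h\<in>Hom C W K. k \<cdot> h = g"
  using assms unfolding is_kernel_def by (blast, blast, blast, blast)

lemma kernel_is_mono:
  assumes K: "is_kernel C X Y f K k" and X: "X \<in> Ob C" and Y: "Y \<in> Ob C" and f: "f \<in> Hom C X Y"
  shows "is_mono C K X k"
proof -
  note k = is_kernelD(1-3)[OF K]
  have "g = h" if W: "W \<in> Ob C" and g: "g \<in> Hom C W K" and h: "h \<in> Hom C W K" and eq: "k \<cdot> g = k \<cdot> h"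
    for W g h
  proof -
    have "f \<cdot> (k \<cdot> g) = mzero C W Y"
      using comp_assoc[OF W k(1) X Y g k(2) f] k(3) mzero_comp[OF W k(1) Y g] by simp
    moreover have "k \<cdot> g \<in> Hom C W X" using comp_in[OF W k(1) X g k(2)] .
    ultimately have "\<exists>!x. x \<in> Hom C W K \<and> k \<cdot> x = k \<cdot> g"
      using K W unfolding is_kernel_def by blast
    then show ?thesis using g h eq by auto
  qed
  then show ?thesis using k unfolding is_mono_def by blast
qed

lemma is_kernelI_mono:
  assumes f: "f \<in> Hom C X Y" and X: "X \<in> Ob C" and Y: "Y \<in> Ob C"
    and mono: "is_mono C K X k" and K: "K \<in> Ob C" and fk: "f \<cdot> k = mzero C K Y"
    and factor: "\<And>W g. \<lbrakk>W \<in> Ob C; g \<in> Hom C W X; f \<cdot> g = mzero C W Y\<rbrakk> \<Longrightarrow> \<exists>h\<in>Hom C W K. k \<cdot> h = g"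
  shows "is_kernel C X Y f K k"
proof -
  have k: "k \<in> Hom C K X" using mono by (simp add: is_mono_def)
  have "\<exists>!h. h \<in> Hom C W K \<and> k \<cdot> h = g" if "W \<in> Ob C" "g \<in> Hom C W X" "f \<cdot> g = mzero C W Y" for W g
    using factor[OF that] mono that(1) unfolding is_mono_def by metis
  then show ?thesis using K k fk unfolding is_kernel_def by blast
qed

text \<open>A monomorphism reflects zero. This identifies the kernel of a differential with the
  kernel of its epimorphic part.\<close>

lemma kernel_mono_comp_iff:
  assumes f: "f \<in> Hom C X Y" and j: "is_mono C Y Z j" and X: "X \<in> Ob C" and Y: "Y \<in> Ob C" and Z: "Z \<in> Ob C"
  shows "is_kernel C X Z (j \<cdot> f) K k \<longleftrightarrow> is_kernel C X Y f K k"
proof -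
  have jh: "j \<in> Hom C Y Z" using j by (simp add: is_mono_def)
  have *: "j \<cdot> f \<cdot> g = mzero C W Z \<longleftrightarrow> f \<cdot> g = mzero C W Y" if W: "W \<in> Ob C" and g: "g \<in> Hom C W X" for W g
  proof -
    have "j \<cdot> f \<cdot> g = j \<cdot> (f \<cdot> g)" using comp_assoc[OF W X Y Z g f jh] .
    moreover have "j \<cdot> mzero C W Y = mzero C W Z" using comp_mzero[OF W Y Z jh] .
    ultimately show ?thesis
      using j W comp_in[OF W X Y g f] mzero_in[OF W Y] unfolding is_mono_def by metis
  qed
  show ?thesis unfolding is_kernel_def by (simp add: * cong: conj_cong ball_cong)
qed

text \<open>The last exactness condition of a resolution asks for a zero object, and kernels alone
  provide one: \<open>k\<close> is both zero and monic, so all maps into \<open>K\<close> coincide;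
  in particular its identity is zero.\<close>

lemma kernel_Id_is_zero_object:
  assumes N: "N \<in> Ob C" and K: "is_kernel C N N (Id C N) K k"
  shows "is_zero_object C K"
proof -
  note k = is_kernelD(1-3)[OF K]
  have k0: "k = mzero C K N" using k Id_comp[OF k(1) N k(2)] by simp
  have mono: "is_mono C K N k" by (rule kernel_is_mono[OF K N N Id_in[OF N]])
  have into: "f = mzero C X K" if X: "X \<in> Ob C" and f: "f \<in> Hom C X K" for X f
  proof -
    have "k \<cdot> f = k \<cdot> mzero C X K"
      using k0 mzero_comp[OF X k(1) N f] mzero_comp[OF X k(1) N mzero_in[OF X k(1)]] by simp
    then show ?thesis using mono X f mzero_in[OF X k(1)] unfolding is_mono_def by blast
  qed
  have out_of: "f = mzero C K X" if X: "X \<in> Ob C" and f: "f \<in> Hom C K X" for X f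
  proof -
    have "f = f \<cdot> Id C K" using comp_Id[OF k(1) X f] by simp
    also have "Id C K = mzero C K K" using into[OF k(1) Id_in[OF k(1)]] .
    finally show ?thesis using comp_mzero[OF k(1) k(1) X f] by simp
  qed
  show ?thesis unfolding is_zero_object_def
    using k(1) into out_of mzero_in[OF _ k(1)] mzero_in[OF k(1)] by blast
qed

lemma precompose_group_hom:
  assumes X: "X \<in> Ob C" and X': "X' \<in> Ob C" and Y: "Y \<in> Ob C" and d: "d \<in> Hom C X' X"
  shows "group_hom (hom_group C X Y) (hom_group C X' Y) (\<lambda>f. f \<cdot> d)"
  using hom_comm_group[OF X Y] hom_comm_group[OF X' Y] comp_in[OF X' X Y d] comp_madd_left[OF X' X Y d]
  by (auto simp: group_hom_def group_hom_axioms_def hom_def comm_group.axioms(2))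

text \<open>Replaces the quotient group by a factorization problem, the form in which vanishing of
  cohomology is proved and used below.\<close>

lemma trivial_hom_cohomology_iff:
  assumes P: "\<And>n. P n \<in> Ob C" and d: "\<And>n. d n \<in> Hom C (P (Suc n)) (P n)"
    and dd: "\<And>n. d n \<cdot> d (Suc n) = mzero C (P (Suc (Suc n))) (P n)" and Y: "Y \<in> Ob C"
  shows "trivial_group (hom_cohomology C P d Y (Suc n)) \<longleftrightarrow>
    (\<forall>f\<in>Hom C (P (Suc n)) Y. f \<cdot> d (Suc n) = mzero C (P (Suc (Suc n))) Y \<longrightarrow>
      (\<exists>g\<in>Hom C (P n) Y. f = g \<cdot> d n))"
proof -
  let ?G = "hom_group C (P (Suc n)) Y" and ?Z = "cocycles C P d Y (Suc n)"
    and ?B = "coboundaries C P d Y (Suc n)"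
  interpret G: comm_group ?G using P Y by (intro hom_comm_group)
  interpret out: group_hom ?G "hom_group C (P (Suc (Suc n))) Y" "\<lambda>f. f \<cdot> d (Suc n)"
    by (rule precompose_group_hom[OF P P Y d])
  interpret inn: group_hom "hom_group C (P n) Y" ?G "\<lambda>f. f \<cdot> d n"
    by (rule precompose_group_hom[OF P P Y d])
  have Z: "subgroup ?Z ?G" unfolding cocycles_def by (rule out.subgroup_kernel)
  have B: "subgroup ?B ?G" using inn.img_is_subgroup by simp
  have "g \<cdot> d n \<cdot> d (Suc n) = mzero C (P (Suc (Suc n))) Y" if g: "g \<in> Hom C (P n) Y" for g
    using comp_assoc[OF P P P Y d[of "Suc n"] d[of n] g] dd[of n] comp_mzero[OF P P Y g]
    by simp
  then have BZ: "?B \<subseteq> ?Z"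
    using comp_in[OF P P Y d] by (auto simp: cocycles_def kernel_def)
  have ZG: "comm_group (?G\<lparr>carrier := ?Z\<rparr>)" 
    by (rule G.subgroup_comm_group[OF Z])
  have "normal ?B (?G\<lparr>carrier := ?Z\<rparr>)"
    using comm_group.subgroup_imp_normal[OF ZG] G.subgroup_incl[OF B Z BZ] by blast
  then have "trivial_group (hom_cohomology C P d Y (Suc n)) \<longleftrightarrow> ?Z \<subseteq> ?B"
    unfolding hom_cohomology_def by (simp add: normal.trivial_factor_group_iff)
  also have "\<dots> \<longleftrightarrow> (\<forall>f\<in>Hom C (P (Suc n)) Y. f \<cdot> d (Suc n) = mzero C (P (Suc (Suc n))) Y \<longrightarrow>
      (\<exists>g\<in>Hom C (P n) Y. f = g \<cdot> d n))"
    by (auto simp: cocycles_def kernel_def)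
  finally show ?thesis .
qed

end

text \<open>
  The epimorphisms in \<open>E\<close> are only asked to be cokernels of their kernels: categories of bimodules
  need not have cokernels unless the functors \<open>A \<otimes> -\<close> and \<open>- \<otimes> A\<close> are right exact.
\<close>

locale relative_cat = preadditive_cat C for C :: "('o, 'm, 'x) precat_scheme" (structure) +
  fixes E :: "'o \<Rightarrow> 'o \<Rightarrow> 'm \<Rightarrow> bool"
  assumes kernel_exists: "\<lbrakk>X \<in> Ob C; Y \<in> Ob C; f \<in> Hom C X Y\<rbrakk> \<Longrightarrow> \<exists>K k. is_kernel C X Y f K k"
    and E_epi: "\<lbrakk>X \<in> Ob C; Y \<in> Ob C; E X Y e\<rbrakk> \<Longrightarrow> is_epi C X Y e"
    and E_normal: "\<lbrakk>X \<in> Ob C; Y \<in> Ob C; E X Y e; is_kernel C X Y e K k\<rbrakk> \<Longrightarrow> is_cokernel C K X k Y e"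
    and enough_projectives: "X \<in> Ob C \<Longrightarrow> \<exists>P e. E_projective C E P \<and> E P X e"
begin

lemma E_in: "\<lbrakk>X \<in> Ob C; Y \<in> Ob C; E X Y e\<rbrakk> \<Longrightarrow> e \<in> Hom C X Y"
  using E_epi by (simp add: is_epi_def)

lemma E_projective_Ob: "E_projective C E P \<Longrightarrow> P \<in> Ob C"
  by (simp add: E_projective_def)

lemma E_projective_lift:
  assumes "E_projective C E P" "X \<in> Ob C" "Y \<in> Ob C" "E X Y e" "f \<in> Hom C P Y"
  shows "\<exists>g\<in>Hom C P X. e \<cdot> g = f"
proof -
  have "f \<in> (\<lambda>g. e \<cdot> g) ` Hom C P X" using assms by (simp add: E_projective_def)
  then show ?thesis by auto
qed

text \<open>Minimality of the image is where normality of \<open>e\<close> enters: in a competing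
  factorization \<open>j \<cdot> g\<close> the map \<open>g\<close> vanishes on the kernel of
  \<open>e\<close>, because \<open>j\<close> is monic, and so descends along
  \<open>e\<close>.\<close>

lemma canonical_factorization_E:
  assumes X: "X \<in> Ob C" and I: "I \<in> Ob C" and Y: "Y \<in> Ob C" and e: "E X I e" and i: "is_mono C I Y i"
  shows "canonical_factorization C X Y (i \<cdot> e) I i e"
proof -
  have eh: "e \<in> Hom C X I" by (rule E_in[OF X I e])
  have ih: "i \<in> Hom C I Y" using i by (simp add: is_mono_def)
  obtain K k where K: "is_kernel C X I e K k" using kernel_exists[OF X I eh] by blast
  note k = is_kernelD(1-3)[OF K]
  have "\<exists>t\<in>Hom C I J. i = j \<cdot> t"
    if J: "J \<in> Ob C" and g: "g \<in> Hom C X J" and j: "is_mono C J Y j" and eq: "i \<cdot> e = j \<cdot> g" for J j g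
  proof -
    have jh: "j \<in> Hom C J Y" using j by (simp add: is_mono_def)
    have "j \<cdot> (g \<cdot> k) = i \<cdot> e \<cdot> k"
      using comp_assoc[OF k(1) X J Y k(2) g jh] eq by simp
    also have "\<dots> = mzero C K Y"
      using comp_assoc[OF k(1) X I Y k(2) eh ih] k(3) comp_mzero[OF k(1) I Y ih] by simp
    also have "\<dots> = j \<cdot> mzero C K J" using comp_mzero[OF k(1) J Y jh] by simp
    finally have "g \<cdot> k = mzero C K J"
      using j k(1) comp_in[OF k(1) X J k(2) g] mzero_in[OF k(1) J] unfolding is_mono_def by blast
    then obtain t where t: "t \<in> Hom C I J" "t \<cdot> e = g"
      using E_normal[OF X I e K] J g unfolding is_cokernel_def by blast
    have "j \<cdot> t \<cdot> e = i \<cdot> e" using comp_assoc[OF X I J Y eh t(1) jh] t(2) eq by simp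
    then have "i = j \<cdot> t"
      using E_epi[OF X I e] Y ih comp_in[OF I J Y t(1) jh] unfolding is_epi_def by metis
    then show ?thesis using t(1) by blast
  qed
  then show ?thesis
    unfolding canonical_factorization_def using I E_epi[OF X I e] i by blast
qed

lemma Id_is_mono: "X \<in> Ob C \<Longrightarrow> is_mono C X X (Id C X)"
  unfolding is_mono_def using Id_in Id_comp by metis

lemma E_projective_resolution_exists:
  assumes N: "N \<in> Ob C"
  shows "\<exists>P d a. E_projective_resolution C E N P d a"
proof -
  obtain cov where cov: "\<And>X. X \<in> Ob C \<Longrightarrow> E_projective C E (fst (cov X)) \<and> E (fst (cov X)) X (snd (cov X))"
  proof -
    have "\<forall>X\<in>Ob C. \<exists>c. E_projective C E (fst c) \<and> E (fst c) X (snd c)"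
      using enough_projectives by fastforce
    then show ?thesis using that by metis
  qed
  let ?P = "\<lambda>X. fst (cov X)" and ?e = "\<lambda>X. snd (cov X)"
  have PO: "?P X \<in> Ob C" if "X \<in> Ob C" for X using cov[OF that] E_projective_Ob by blast
  have eH: "?e X \<in> Hom C (?P X) X" if "X \<in> Ob C" for X
    using cov[OF that] E_in[OF PO[OF that] that] by blast
  obtain ker where ker: "\<And>X. X \<in> Ob C \<Longrightarrow> is_kernel C (?P X) X (?e X) (fst (ker X)) (snd (ker X))"
  proof -
    have "\<forall>X\<in>Ob C. \<exists>c. is_kernel C (?P X) X (?e X) (fst c) (snd c)"
      using kernel_exists[OF PO _ eH] by fastforce
    then show ?thesis using that by metis
  qed
  let ?K = "\<lambda>X. fst (ker X)" and ?k = "\<lambda>X. snd (ker X)"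
  \<comment> \<open>\<open>S n\<close> is the n-th syzygy of \<open>N\<close>. The resolution
    splices the sequences \<open>S (Suc n) \<rightarrow> P n \<rightarrow> S n\<close>, so that the
    image of \<open>d n\<close> is \<open>S (Suc n)\<close>.\<close>
  define S where "S n = (?K ^^ n) N" for n
  have S0: "S 0 = N" and SS: "S (Suc n) = ?K (S n)" for n by (simp_all add: S_def)
  have SO: "S n \<in> Ob C" for n
    by (induction n) (auto simp: S0 SS N is_kernelD(1)[OF ker])
  define P d where "P n = ?P (S n)" and "d n = ?k (S n) \<cdot> ?e (S (Suc n))" for n
  have Pp: "E_projective C E (P n)" and PO': "P n \<in> Ob C"
    and eE: "E (P n) (S n) (?e (S n))" and eH': "?e (S n) \<in> Hom C (P n) (S n)"
    and K: "is_kernel C (P n) (S n) (?e (S n)) (S (Suc n)) (?k (S n))" for n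
    using cov[OF SO] PO[OF SO] eH[OF SO] ker[OF SO] by (simp_all add: P_def SS)
  have kmono: "is_mono C (S (Suc n)) (P n) (?k (S n))" for n
    by (rule kernel_is_mono[OF K PO' SO eH'])
  have kH: "?k (S n) \<in> Hom C (S (Suc n)) (P n)" for n
    using kmono by (simp add: is_mono_def)
  have dH: "d n \<in> Hom C (P (Suc n)) (P n)" for n
    unfolding d_def by (rule comp_in[OF PO' SO PO' eH' kH])
  have fac: "canonical_factorization C (P (Suc n)) (P n) (d n) (S (Suc n)) (?k (S n)) (?e (S (Suc n)))" for n
    unfolding d_def by (rule canonical_factorization_E[OF PO' SO PO' eE kmono])
  have Kd: "is_kernel C (P (Suc n)) (P n) (d n) (S (Suc (Suc n))) (?k (S (Suc n)))" for n
    unfolding d_def using kernel_mono_comp_iff[OF eH' kmono PO' SO PO'] K by blast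
  obtain Z where Z: "is_zero_object C Z"
    using kernel_exists[OF N N Id_in[OF N]] kernel_Id_is_zero_object[OF N] by blast
  have ZO: "Z \<in> Ob C" using Z by (simp add: is_zero_object_def)
  let ?a = "?e N"
  have aH: "?a \<in> Hom C (P 0) N" using eH'[of 0] by (simp add: S0)
  \<comment> \<open>The augmentation lies in \<open>E\<close>, so it is its own epimorphic part and
    its image is all of \<open>N\<close>.\<close>
  have faca: "canonical_factorization C (P 0) N ?a N (Id C N) ?a"
    using canonical_factorization_E[OF PO' N N _ Id_is_mono[OF N], of 0 ?a] eE[of 0]
      Id_comp[OF PO' N aH] by (simp add: S0)
  \<comment> \<open>The kernel of the zero map is all of \<open>N\<close>, which matches the image
    found in \<open>faca\<close>.\<close>
  have kerN: "is_kernel C N Z (mzero C N Z) N (Id C N)"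
    by (rule is_kernelI_mono[OF mzero_in[OF N ZO] N ZO Id_is_mono[OF N] N
          comp_Id[OF N ZO mzero_in[OF N ZO]]]) (use Id_comp[OF _ N] in blast)
  have "E_projective_resolution C E N P d ?a"
    unfolding E_projective_resolution_def
  proof (intro conjI allI)
    fix n
    show "E_projective C E (P n)" by (rule Pp)
    show "E_admissible C E (P (Suc n)) (P n) (d n)"
      unfolding E_admissible_def using fac eE by blast
    show "exact_at C (P (Suc (Suc n))) (P (Suc n)) (P n) (d (Suc n)) (d n)"
      unfolding exact_at_def using dH fac[of "Suc n"] Kd[of n] by blast
  next
    show "E_admissible C E (P 0) N ?a"
      unfolding E_admissible_def using faca eE[of 0] by (auto simp: S0)
    show "exact_at C (P (Suc 0)) (P 0) N (d 0) ?a"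
      unfolding exact_at_def using dH aH fac[of 0] K[of 0] by (auto simp: S0)
    show "\<exists>Z. is_zero_object C Z \<and> exact_at C (P 0) N Z ?a (mzero C N Z)"
      unfolding exact_at_def using Z aH mzero_in[OF N ZO] faca kerN by blast
  qed
  then show ?thesis by blast
qed

text \<open>Exactness and admissibility may speak of different factorizations of \<open>f\<close>.
  Minimality of the exact one gives \<open>t\<close> from \<open>I\<close> to \<open>J\<close>;
  \<open>h\<close> factors through the kernel \<open>I\<close>, is moved to \<open>J\<close> by
  \<open>t\<close>, and lifts from there along the member \<open>e'\<close> of
  \<open>E\<close>.\<close>

lemma exact_lift:
  assumes Q: "E_projective C E Q" and X: "X \<in> Ob C" and Y: "Y \<in> Ob C"
    and ex: "exact_at C X Y Z f g" and ad: "E_admissible C E X Y f"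
    and h: "h \<in> Hom C Q Y" "g \<cdot> h = mzero C Q Z"
  shows "\<exists>w\<in>Hom C Q X. f \<cdot> w = h"
proof -
  have QO: "Q \<in> Ob C" by (rule E_projective_Ob[OF Q])
  obtain I i e where fac: "canonical_factorization C X Y f I i e" and K: "is_kernel C Y Z g I i"
    using ex unfolding exact_at_def by blast
  obtain J j e' where fac': "canonical_factorization C X Y f J j e'" and e': "E X J e'"
    using ad unfolding E_admissible_def by blast
  have J: "J \<in> Ob C" "is_mono C J Y j" "f = j \<cdot> e'" "j \<in> Hom C J Y" "e' \<in> Hom C X J"
    using fac' unfolding canonical_factorization_def is_mono_def is_epi_def by simp_all
  have I: "I \<in> Ob C" using fac by (simp add: canonical_factorization_def)
  obtain t where t: "t \<in> Hom C I J" "i = j \<cdot> t"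
    using fac J unfolding canonical_factorization_def by blast
  obtain v where v: "v \<in> Hom C Q I" "i \<cdot> v = h"
    using is_kernelD(4)[OF K QO h] by blast
  obtain w where w: "w \<in> Hom C Q X" "e' \<cdot> w = t \<cdot> v"
    using E_projective_lift[OF Q X J(1) e' comp_in[OF QO I J(1) v(1) t(1)]] by blast
  have "f \<cdot> w = j \<cdot> (t \<cdot> v)" using comp_assoc[OF QO X J(1) Y w(1) J(5,4)] J(3) w(2) by simp
  also have "\<dots> = h" using comp_assoc[OF QO I J(1) Y v(1) t(1) J(4)] t(2) v(2) by simp
  finally show ?thesis using w(1) by blast
qed

lemma exact_at_comp:
  assumes ex: "exact_at C X Y Z f g" and X: "X \<in> Ob C" and Y: "Y \<in> Ob C" and Z: "Z \<in> Ob C"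
  shows "g \<cdot> f = mzero C X Z"
proof -
  obtain I i e where fac: "canonical_factorization C X Y f I i e" and K: "is_kernel C Y Z g I i"
    and g: "g \<in> Hom C Y Z"
    using ex unfolding exact_at_def by blast
  have I: "I \<in> Ob C" "f = i \<cdot> e" "i \<in> Hom C I Y" "e \<in> Hom C X I"
    using fac unfolding canonical_factorization_def is_mono_def is_epi_def by simp_all
  show ?thesis
    using comp_assoc[OF X I(1) Y Z I(4,3) g] is_kernelD(3)[OF K] mzero_comp[OF X I(1) Z I(4)] I(2) by simp
qed

text \<open>A lift of \<open>f \<cdot> a\<close>, restricted along \<open>s\<close>, is a lift of
  \<open>f\<close>.\<close>

lemma E_projective_retract:
  assumes P: "E_projective C E P" and N: "N \<in> Ob C" and a: "a \<in> Hom C P N" and s: "s \<in> Hom C N P"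
    and as: "a \<cdot> s = Id C N"
  shows "E_projective C E N"
proof -
  have PO: "P \<in> Ob C" by (rule E_projective_Ob[OF P])
  have "(\<lambda>g. e \<cdot> g) ` Hom C N X = Hom C N Y" if X: "X \<in> Ob C" and Y: "Y \<in> Ob C" and e: "E X Y e" for X Y e
  proof
    note eh = E_in[OF X Y e]
    show "(\<lambda>g. e \<cdot> g) ` Hom C N X \<subseteq> Hom C N Y" using comp_in[OF N X Y _ eh] by blast
    show "Hom C N Y \<subseteq> (\<lambda>g. e \<cdot> g) ` Hom C N X"
    proof
      fix f assume f: "f \<in> Hom C N Y"
      obtain g where g: "g \<in> Hom C P X" "e \<cdot> g = f \<cdot> a"
        using E_projective_lift[OF P X Y e comp_in[OF PO N Y a f]] by blast
      have "e \<cdot> (g \<cdot> s) = f \<cdot> (a \<cdot> s)"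
        using comp_assoc[OF N PO X Y s g(1) eh] comp_assoc[OF N PO N Y s a f] g(2) by simp
      also have "\<dots> = f" using as comp_Id[OF N Y f] by simp
      finally show "f \<in> (\<lambda>g. e \<cdot> g) ` Hom C N X" using comp_in[OF N PO X s g(1)] by blast
    qed
  qed
  then show ?thesis using N by (simp add: E_projective_def)
qed

section \<open>Projectivity and cohomology on a fixed resolution\<close>

context
  fixes N P d a
  assumes N: "N \<in> Ob C" and res: "E_projective_resolution C E N P d a"
begin

lemma res_P: "E_projective C E (P n)"
  and res_ad: "E_admissible C E (P (Suc n)) (P n) (d n)"
  and res_ada: "E_admissible C E (P 0) N a"
  and res_ex: "exact_at C (P (Suc (Suc n))) (P (Suc n)) (P n) (d (Suc n)) (d n)"
  and res_exa: "exact_at C (P (Suc 0)) (P 0) N (d 0) a"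
  and res_exN: "\<exists>Z. is_zero_object C Z \<and> exact_at C (P 0) N Z a (mzero C N Z)"
  using res by (simp_all add: E_projective_resolution_def)

lemma res_Ob: "P n \<in> Ob C"
  by (rule E_projective_Ob[OF res_P])

lemma res_in: "d n \<in> Hom C (P (Suc n)) (P n)" and res_ina: "a \<in> Hom C (P 0) N"
  using res_ex[of n] res_exa by (simp_all add: exact_at_def)

lemma res_comp: "d n \<cdot> d (Suc n) = mzero C (P (Suc (Suc n))) (P n)"
  by (rule exact_at_comp[OF res_ex res_Ob res_Ob res_Ob])

text \<open>Surjectivity of \<open>a\<close> in usable form. The locale does not make
  \<open>E\<close> closed under isomorphism, so \<open>a\<close> is presented as a member
  \<open>e\<close> of \<open>E\<close> followed by an isomorphism \<open>j\<close> with inverse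
  \<open>j'\<close>.\<close>

lemma augmentation:
  obtains J j j' e where "J \<in> Ob C" "E (P 0) J e" "e \<in> Hom C (P 0) J" "is_mono C J N j"
    "j \<in> Hom C J N" "j' \<in> Hom C N J" "a = j \<cdot> e" "j \<cdot> j' = Id C N" "j' \<cdot> j = Id C J"
proof -
  obtain Z where Z: "is_zero_object C Z" and ex: "exact_at C (P 0) N Z a (mzero C N Z)"
    using res_exN by blast
  have ZO: "Z \<in> Ob C" using Z by (simp add: is_zero_object_def)
  obtain I i f where fac: "canonical_factorization C (P 0) N a I i f" and K: "is_kernel C N Z (mzero C N Z) I i"
    using ex unfolding exact_at_def by blast
  obtain J j e where fac': "canonical_factorization C (P 0) N a J j e" and e: "E (P 0) J e"
    using res_ada unfolding E_admissible_def by blast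
  have J: "J \<in> Ob C" "is_mono C J N j" "a = j \<cdot> e" "j \<in> Hom C J N" "e \<in> Hom C (P 0) J"
    using fac' unfolding canonical_factorization_def is_mono_def is_epi_def by simp_all
  have I: "I \<in> Ob C" using fac by (simp add: canonical_factorization_def)
  obtain t where t: "t \<in> Hom C I J" "i = j \<cdot> t"
    using fac J unfolding canonical_factorization_def by blast
  \<comment> \<open>The zero map kills the identity of \<open>N\<close>, which therefore factors
    through the image \<open>i = j \<cdot> t\<close>; so \<open>j\<close> has a right inverse, and a
    monomorphism with a right inverse is invertible.\<close>
  obtain v where v: "v \<in> Hom C N I" "i \<cdot> v = Id C N"
    using is_kernelD(4)[OF K N Id_in[OF N] mzero_comp[OF N N ZO Id_in[OF N]]] by blast
  let ?j' = "t \<cdot> v"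
  have j': "?j' \<in> Hom C N J" by (rule comp_in[OF N I J(1) v(1) t(1)])
  have jj': "j \<cdot> ?j' = Id C N"
    using comp_assoc[OF N I J(1) N v(1) t(1) J(4)] t(2) v(2) by simp
  have "j \<cdot> (?j' \<cdot> j) = j \<cdot> Id C J"
    using comp_assoc[OF J(1) N J(1) N J(4) j' J(4)] jj' Id_comp[OF J(1) N J(4)] comp_Id[OF J(1) N J(4)]
    by simp
  then have "?j' \<cdot> j = Id C J"
    using J(1,2) comp_in[OF J(1) N J(1) J(4) j'] Id_in[OF J(1)] unfolding is_mono_def by blast
  then show thesis using that J e j' jj' by blast
qed

text \<open>\<open>w\<close> is \<open>Id - h \<cdot> \<delta>\<close>, the projection onto the
  kernel of \<open>\<delta>\<close>.\<close>

lemma ex_complement: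
  assumes Z: "Z \<in> Ob C" and \<delta>: "\<delta> \<in> Hom C (P n) Z" and h: "h \<in> Hom C Z (P n)"
    and eq: "\<delta> \<cdot> (h \<cdot> \<delta>) = \<delta>"
  obtains w where "w \<in> Hom C (P n) (P n)" "madd C w (h \<cdot> \<delta>) = Id C (P n)" "\<delta> \<cdot> w = mzero C (P n) Z"
proof -
  have hd: "h \<cdot> \<delta> \<in> Hom C (P n) (P n)" by (rule comp_in[OF res_Ob Z res_Ob \<delta> h])
  obtain w where w: "w \<in> Hom C (P n) (P n)" "madd C w (h \<cdot> \<delta>) = Id C (P n)"
    using ex_difference[OF res_Ob res_Ob Id_in[OF res_Ob] hd] by blast
  have "madd C (\<delta> \<cdot> w) \<delta> = \<delta> \<cdot> madd C w (h \<cdot> \<delta>)"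
    using comp_madd_right[OF res_Ob res_Ob Z w(1) hd \<delta>] eq by simp
  also have "\<dots> = madd C (mzero C (P n) Z) \<delta>"
    using w(2) comp_Id[OF res_Ob Z \<delta>] madd_mzero[OF res_Ob Z \<delta>] by simp
  finally have "\<delta> \<cdot> w = mzero C (P n) Z"
    using madd_cancel[OF res_Ob Z comp_in[OF res_Ob res_Ob Z w(1) \<delta>] mzero_in[OF res_Ob Z] \<delta>] by blast
  then show thesis using that w by blast
qed

text \<open>\<open>h'\<close> lifts \<open>Id - h \<cdot> \<delta>\<close> through
  \<open>d n\<close>. Composing with \<open>d n\<close> on the right kills the term with
  \<open>\<delta>\<close> and leaves the relation for \<open>d n\<close> that the next degree needs.
  \<open>\<delta>\<close> is the augmentation at the start and the previous differential
  afterwards.\<close>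

lemma contraction_step:
  assumes Z: "Z \<in> Ob C" and \<delta>: "\<delta> \<in> Hom C (P n) Z" and ex: "exact_at C (P (Suc n)) (P n) Z (d n) \<delta>"
    and h: "h \<in> Hom C Z (P n)" and eq: "\<delta> \<cdot> (h \<cdot> \<delta>) = \<delta>"
  obtains h' where "h' \<in> Hom C (P n) (P (Suc n))" "madd C (d n \<cdot> h') (h \<cdot> \<delta>) = Id C (P n)"
    "d n \<cdot> (h' \<cdot> d n) = d n"
proof -
  obtain w where w: "w \<in> Hom C (P n) (P n)" "madd C w (h \<cdot> \<delta>) = Id C (P n)" "\<delta> \<cdot> w = mzero C (P n) Z"
    using ex_complement[OF Z \<delta> h eq] .
  obtain h' where h': "h' \<in> Hom C (P n) (P (Suc n))" "d n \<cdot> h' = w"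
    using exact_lift[OF res_P res_Ob res_Ob ex res_ad w(1,3)] by blast
  have hd: "h \<cdot> \<delta> \<in> Hom C (P n) (P n)" by (rule comp_in[OF res_Ob Z res_Ob \<delta> h])
  have "h \<cdot> \<delta> \<cdot> d n = h \<cdot> (\<delta> \<cdot> d n)"
    by (rule comp_assoc[OF res_Ob res_Ob Z res_Ob res_in \<delta> h])
  also have "\<dots> = mzero C (P (Suc n)) (P n)"
    using exact_at_comp[OF ex res_Ob res_Ob Z] comp_mzero[OF res_Ob Z res_Ob h] by simp
  finally have hdd: "h \<cdot> \<delta> \<cdot> d n = mzero C (P (Suc n)) (P n)" .
  have wd: "w \<cdot> d n \<in> Hom C (P (Suc n)) (P n)" by (rule comp_in[OF res_Ob res_Ob res_Ob res_in w(1)])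
  have "d n = madd C w (h \<cdot> \<delta>) \<cdot> d n" using w(2) Id_comp[OF res_Ob res_Ob res_in] by simp
  also have "\<dots> = madd C (w \<cdot> d n) (mzero C (P (Suc n)) (P n))"
    using comp_madd_left[OF res_Ob res_Ob res_Ob res_in w(1) hd] hdd by simp
  also have "\<dots> = w \<cdot> d n" by (rule madd_mzero_right[OF res_Ob res_Ob wd])
  also have "\<dots> = d n \<cdot> (h' \<cdot> d n)"
    using comp_assoc[OF res_Ob res_Ob res_Ob res_Ob res_in h'(1) res_in] h'(2) by simp
  finally have "d n \<cdot> (h' \<cdot> d n) = d n" by simp
  then show thesis using that h' w(2) by blast
qed

lemma contraction:
  assumes "E_projective C E N"
  shows "\<exists>h\<in>Hom C (P n) (P (Suc n)). d n \<cdot> (h \<cdot> d n) = d n"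
proof (induction n)
  case 0
  obtain J j j' e where J: "J \<in> Ob C" "E (P 0) J e" "e \<in> Hom C (P 0) J" "is_mono C J N j"
    "j \<in> Hom C J N" "j' \<in> Hom C N J" "a = j \<cdot> e" "j \<cdot> j' = Id C N" "j' \<cdot> j = Id C J"
    by (rule augmentation)
  \<comment> \<open>It is \<open>e\<close>, not \<open>a\<close>, that lies in \<open>E\<close>;
    lifting \<open>j'\<close> along \<open>e\<close> makes \<open>s\<close> a section of
    \<open>a = j \<cdot> e\<close>.\<close>
  obtain s where s: "s \<in> Hom C N (P 0)" "e \<cdot> s = j'"
    using E_projective_lift[OF assms res_Ob J(1,2,6)] by blast
  have "a \<cdot> s = Id C N"
    using comp_assoc[OF N res_Ob J(1) N s(1) J(3,5)] s(2) J(7,8) by simp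
  then have "a \<cdot> (s \<cdot> a) = a"
    using comp_assoc[OF res_Ob N res_Ob N res_ina s(1) res_ina] Id_comp[OF res_Ob N res_ina] by simp
  from contraction_step[OF N res_ina res_exa s(1) this] show ?case by blast
next
  case (Suc n)
  then obtain h where h: "h \<in> Hom C (P n) (P (Suc n))" "d n \<cdot> (h \<cdot> d n) = d n" by blast
  from contraction_step[OF res_Ob res_in res_ex h] show ?case by blast
qed

text \<open>Apply a cocycle \<open>f\<close> to the homotopy identity
  \<open>d h' + h d = Id\<close>: the first term vanishes, and \<open>f = f h d\<close> is a
  coboundary.\<close>

lemma cohomology_trivial_if_projective:
  assumes "E_projective C E N" and Y: "Y \<in> Ob C"
  shows "trivial_group (hom_cohomology C P d Y (Suc n))"
  unfolding trivial_hom_cohomology_iff[of P d, OF res_Ob res_in res_comp Y]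
proof (intro ballI impI)
  fix f assume f: "f \<in> Hom C (P (Suc n)) Y" and fd: "f \<cdot> d (Suc n) = mzero C (P (Suc (Suc n))) Y"
  obtain h where h: "h \<in> Hom C (P n) (P (Suc n))" "d n \<cdot> (h \<cdot> d n) = d n"
    using contraction[OF assms(1)] by blast
  obtain h' where h': "h' \<in> Hom C (P (Suc n)) (P (Suc (Suc n)))"
    "madd C (d (Suc n) \<cdot> h') (h \<cdot> d n) = Id C (P (Suc n))"
    using contraction_step[OF res_Ob res_in res_ex h] by blast
  have in1: "d (Suc n) \<cdot> h' \<in> Hom C (P (Suc n)) (P (Suc n))"
    by (rule comp_in[OF res_Ob res_Ob res_Ob h'(1) res_in])
  have in2: "h \<cdot> d n \<in> Hom C (P (Suc n)) (P (Suc n))"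
    by (rule comp_in[OF res_Ob res_Ob res_Ob res_in h(1)])
  have in3: "f \<cdot> h \<in> Hom C (P n) Y" by (rule comp_in[OF res_Ob res_Ob Y h(1) f])
  have z: "f \<cdot> (d (Suc n) \<cdot> h') = mzero C (P (Suc n)) Y"
    using comp_assoc[OF res_Ob res_Ob res_Ob Y h'(1) res_in f] fd mzero_comp[OF res_Ob res_Ob Y h'(1)] by simp
  have "f = f \<cdot> madd C (d (Suc n) \<cdot> h') (h \<cdot> d n)" using h'(2) comp_Id[OF res_Ob Y f] by simp
  also have "\<dots> = f \<cdot> (h \<cdot> d n)"
    using comp_madd_right[OF res_Ob res_Ob Y in1 in2 f] z
      madd_mzero[OF res_Ob Y comp_in[OF res_Ob res_Ob Y in2 f]] by simp
  also have "\<dots> = f \<cdot> h \<cdot> d n" using comp_assoc[OF res_Ob res_Ob res_Ob Y res_in h(1) f] by simp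
  finally show "\<exists>g\<in>Hom C (P n) Y. f = g \<cdot> d n" using in3 by blast
qed

lemma projective_if_cohomology_trivial:
  assumes triv: "\<And>Y. Y \<in> Ob C \<Longrightarrow> trivial_group (hom_cohomology C P d Y (Suc 0))"
  shows "E_projective C E N"
proof -
  obtain J j j' e where J: "J \<in> Ob C" "E (P 0) J e" "e \<in> Hom C (P 0) J" "is_mono C J N j"
    "j \<in> Hom C J N" "j' \<in> Hom C N J" "a = j \<cdot> e" "j \<cdot> j' = Id C N" "j' \<cdot> j = Id C J"
    by (rule augmentation)
  obtain I i q where fac: "canonical_factorization C (P (Suc 0)) (P 0) (d 0) I i q"
    and K: "is_kernel C (P 0) N a I i"
    using res_exa unfolding exact_at_def by blast
  have I: "I \<in> Ob C" "is_mono C I (P 0) i" "is_epi C (P (Suc 0)) I q" "d 0 = i \<cdot> q"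
    "i \<in> Hom C I (P 0)" "q \<in> Hom C (P (Suc 0)) I"
    using fac unfolding canonical_factorization_def is_mono_def is_epi_def by simp_all
  \<comment> \<open>\<open>q\<close> is a 1-cocycle with coefficients in \<open>I\<close>: its
    composite with the next differential is killed by the monomorphism \<open>i\<close>, since
    \<open>d d = 0\<close>.\<close>
  have "i \<cdot> (q \<cdot> d (Suc 0)) = i \<cdot> mzero C (P (Suc (Suc 0))) I"
    using comp_assoc[OF res_Ob res_Ob I(1) res_Ob res_in I(6,5)] I(4) res_comp[of 0]
      comp_mzero[OF res_Ob I(1) res_Ob I(5)] by simp
  then have "q \<cdot> d (Suc 0) = mzero C (P (Suc (Suc 0))) I"
    using I(2) res_Ob comp_in[OF res_Ob res_Ob I(1) res_in I(6)] mzero_in[OF res_Ob I(1)]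
    unfolding is_mono_def by blast
  then obtain g where g: "g \<in> Hom C (P 0) I" "q = g \<cdot> d 0"
    using triv[OF I(1)] I(6) unfolding trivial_hom_cohomology_iff[of P d, OF res_Ob res_in res_comp I(1)] by blast
  have gi: "g \<cdot> i \<in> Hom C I I" by (rule comp_in[OF I(1) res_Ob I(1) I(5) g(1)])
  \<comment> \<open>The left side is \<open>g \<cdot> d 0 = q\<close>. Cancelling the epimorphism
    \<open>q\<close> exhibits \<open>I\<close> as a retract of \<open>P 0\<close>.\<close>
  have "g \<cdot> i \<cdot> q = Id C I \<cdot> q"
    using comp_assoc[OF res_Ob I(1) res_Ob I(1) I(6,5) g(1)] I(4)[symmetric] g(2)[symmetric]
      Id_comp[OF res_Ob I(1,6)] by simp
  then have gi1: "g \<cdot> i = Id C I"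
    using I(3) I(1) gi Id_in[OF I(1)] unfolding is_epi_def by blast
  have ig: "i \<cdot> g \<in> Hom C (P 0) (P 0)" by (rule comp_in[OF res_Ob I(1) res_Ob g(1) I(5)])
  \<comment> \<open>\<open>w = Id - i \<cdot> g\<close> vanishes on the kernel \<open>I\<close> of
    the augmentation, hence descends to a map \<open>h\<close> out of the quotient
    \<open>J\<close>.\<close>
  obtain w where w: "w \<in> Hom C (P 0) (P 0)" "madd C w (i \<cdot> g) = Id C (P 0)"
    using ex_difference[OF res_Ob res_Ob Id_in[OF res_Ob] ig] by blast
  have "madd C (w \<cdot> i) i = madd C w (i \<cdot> g) \<cdot> i"
    using comp_madd_left[OF I(1) res_Ob res_Ob I(5) w(1) ig] comp_assoc[OF I(1) res_Ob I(1) res_Ob I(5) g(1) I(5)]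
      gi1 comp_Id[OF I(1) res_Ob I(5)] by simp
  also have "\<dots> = madd C (mzero C I (P 0)) i"
    using w(2) Id_comp[OF I(1) res_Ob I(5)] madd_mzero[OF I(1) res_Ob I(5)] by simp
  finally have wi: "w \<cdot> i = mzero C I (P 0)"
    using madd_cancel[OF I(1) res_Ob comp_in[OF I(1) res_Ob res_Ob I(5) w(1)] mzero_in[OF I(1) res_Ob] I(5)]
    by blast
  \<comment> \<open>Normality is available for \<open>e\<close> only, so the kernel of
    \<open>a\<close> is first recognized as that of \<open>e\<close>.\<close>
  have "is_kernel C (P 0) J e I i"
    using K J(7) kernel_mono_comp_iff[OF J(3,4) res_Ob J(1) N] by simp
  then have "is_cokernel C I (P 0) i J e" by (rule E_normal[OF res_Ob J(1,2)])
  then obtain h where h: "h \<in> Hom C J (P 0)" "h \<cdot> e = w"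
    using wi w(1) res_Ob unfolding is_cokernel_def by blast
  have ai: "a \<cdot> i = mzero C I N" by (rule is_kernelD(3)[OF K])
  \<comment> \<open>Since \<open>w\<close> differs from the identity by a map through the kernel of
    \<open>a\<close>, the descended map is a section up to \<open>j\<close>.\<close>
  have aw: "a \<cdot> w = a"
  proof -
    have aw_in: "a \<cdot> w \<in> Hom C (P 0) N" by (rule comp_in[OF res_Ob res_Ob N w(1) res_ina])
    have "a \<cdot> (i \<cdot> g) = mzero C (P 0) N"
      using comp_assoc[OF res_Ob I(1) res_Ob N g(1) I(5) res_ina] ai mzero_comp[OF res_Ob I(1) N g(1)] by simp
    then have "a \<cdot> madd C w (i \<cdot> g) = a \<cdot> w"
      using comp_madd_right[OF res_Ob res_Ob N w(1) ig res_ina] madd_mzero_right[OF res_Ob N aw_in] by simp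
    then show ?thesis using w(2) comp_Id[OF res_Ob N res_ina] by simp
  qed
  let ?s = "h \<cdot> j'"
  have s: "?s \<in> Hom C N (P 0)" by (rule comp_in[OF N J(1) res_Ob J(6) h(1)])
  have ah: "a \<cdot> h \<in> Hom C J N" by (rule comp_in[OF J(1) res_Ob N h(1) res_ina])
  have "a \<cdot> h \<cdot> e = j \<cdot> e"
    using comp_assoc[OF res_Ob J(1) res_Ob N J(3) h(1) res_ina] h(2) aw J(7) by simp
  then have "a \<cdot> h = j"
    using E_epi[OF res_Ob J(1,2)] N ah J(5) unfolding is_epi_def by blast
  then have "a \<cdot> ?s = Id C N"
    using comp_assoc[OF N J(1) res_Ob N J(6) h(1) res_ina] J(8) by simp
  then show ?thesis by (rule E_projective_retract[OF res_P N res_ina s])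
qed

end

text \<open>The choice inside \<open>Ext\<close> depends on \<open>N\<close> only, so a single
  resolution serves all degrees and coefficients.\<close>

lemma Ext_resolution:
  assumes "N \<in> Ob C"
  obtains P d a where "E_projective_resolution C E N P d a"
    "\<And>n Y. Ext C E n N Y = hom_cohomology C P d Y n"
proof -
  obtain P d a where eq: "(SOME (P, d, a). E_projective_resolution C E N P d a) = (P, d, a)"
    by (metis prod_cases3)
  have "case (SOME (P, d, a). E_projective_resolution C E N P d a) of
      (P, d, a) \<Rightarrow> E_projective_resolution C E N P d a"
    by (rule someI_ex) (use E_projective_resolution_exists[OF assms] in auto)
  then show thesis using that[of P d a] eq by (simp add: Ext_def)
qed

theorem projective_iff_Ext_trivial:
  assumes N: "N \<in> Ob C"
  shows "E_projective C E N \<longleftrightarrow> (\<forall>Y\<in>Ob C. trivial_group (Ext C E 1 N Y))"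
    and "E_projective C E N \<longleftrightarrow> (\<forall>Y\<in>Ob C. \<forall>n>0. trivial_group (Ext C E n N Y))"
proof -
  obtain P d a where res: "E_projective_resolution C E N P d a"
    and Ext: "\<And>n Y. Ext C E n N Y = hom_cohomology C P d Y n"
    using Ext_resolution[OF N] by metis
  have 1: "E_projective C E N" if "\<forall>Y\<in>Ob C. trivial_group (Ext C E 1 N Y)"
    using projective_if_cohomology_trivial[OF N res] that by (simp add: Ext)
  have 2: "trivial_group (Ext C E n N Y)" if "E_projective C E N" "Y \<in> Ob C" "n > 0" for n Y
    using cohomology_trivial_if_projective[OF N res that(1,2)] that(3) by (cases n) (simp_all add: Ext)
  show "E_projective C E N \<longleftrightarrow> (\<forall>Y\<in>Ob C. trivial_group (Ext C E 1 N Y))"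
    using 1 2 by auto
  show "E_projective C E N \<longleftrightarrow> (\<forall>Y\<in>Ob C. \<forall>n>0. trivial_group (Ext C E n N Y))"
    using 1 2 by auto
qed

end


section \<open>The category of bimodules\<close>

locale abelian_algebra = abelian_monoidal_cat M + algebra_in M A m u
  for M :: "('o, 'm, 'x) moncat_scheme" (structure) and A m u
begin

notation cmp (infixr \<open>\<star>\<close> 70)
notation tens (infixr \<open>\<boxtimes>\<close> 75)

abbreviation BM :: "('o \<times> 'm \<times> 'm, 'm) precat" where
  "BM \<equiv> Bimod M A m u"

definition lact :: "'o \<times> 'm \<times> 'm \<Rightarrow> ('o, 'm) arrow" where
  "lact B = Arrow (A \<otimes>\<^sub>o fst B) (fst B) (fst (snd B))"

definition ract :: "'o \<times> 'm \<times> 'm \<Rightarrow> ('o, 'm) arrow" where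
  "ract B = Arrow (fst B \<otimes>\<^sub>o A) (fst B) (snd (snd B))"

lemma Bimod_sel [simp]:
  "Id BM B = Id M (fst B)" "comp BM = comp M" "madd BM = madd M"
  "mzero BM B B' = mzero M (fst B) (fst B')"
  by (simp_all add: Bimod_def)

lemma Bimod_Ob_iff: "B \<in> Ob BM \<longleftrightarrow> bimod (fst B) (lact B) (ract B)"
  by (cases B) (simp add: Bimod_def is_bimodule_iff lact_def ract_def)

lemma Bimod_Ob [simp]: "B \<in> Ob BM \<Longrightarrow> fst B \<in> Ob M"
  using lmodD(1)[OF bimodD(1)] Bimod_Ob_iff by blast

lemma Bimod_Hom_iff:
  assumes "B \<in> Ob BM" "B' \<in> Ob BM"
  shows "f \<in> Hom BM B B' \<longleftrightarrow> blin (lact B) (ract B) (lact B') (ract B') (Arrow (fst B) (fst B') f)"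
  using bimod_hom_iff[OF Bimod_Ob[OF assms(1)] Bimod_Ob[OF assms(2)]]
  by (cases B; cases B') (simp add: Bimod_def lact_def ract_def blin_def)

lemma Bimod_Hom_in: "\<lbrakk>B \<in> Ob BM; B' \<in> Ob BM; f \<in> Hom BM B B'\<rbrakk> \<Longrightarrow> f \<in> Hom M (fst B) (fst B')"
  by (cases B; cases B') (simp add: Bimod_def bimod_hom_def)

lemma Bimod_HomI:
  assumes "B \<in> Ob BM" "B' \<in> Ob BM" "blin (lact B) (ract B) (lact B') (ract B') f"
  shows "f = Arrow (fst B) (fst B') (mor f)" "mor f \<in> Hom BM B B'"
proof -
  have "src f = fst B" "tgt f = fst B'"
    using assms(3) by (simp_all add: blin_def llin_def lact_def)
  then show f: "f = Arrow (fst B) (fst B') (mor f)" by (metis arrow.collapse)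
  show "mor f \<in> Hom BM B B'" using Bimod_Hom_iff[OF assms(1,2)] assms(3) f by simp
qed

text \<open>With this, acting on a vanishing map gives a vanishing map, which is what lets actions
  restrict to kernels.\<close>

lemma tmor_mzero:
  assumes "X \<in> Ob M" "Y \<in> Ob M" "Z \<in> Ob M"
  shows "Id M X \<otimes>\<^sub>m mzero M Y Z = mzero M (X \<otimes>\<^sub>o Y) (X \<otimes>\<^sub>o Z)"
    and "mzero M Y Z \<otimes>\<^sub>m Id M X = mzero M (Y \<otimes>\<^sub>o X) (Z \<otimes>\<^sub>o X)"
proof -
  have z: "madd M (mzero M Y Z) (mzero M Y Z) = mzero M Y Z"
    using madd_mzero[OF assms(2,3) mzero_in[OF assms(2,3)]] .
  show "Id M X \<otimes>\<^sub>m mzero M Y Z = mzero M (X \<otimes>\<^sub>o Y) (X \<otimes>\<^sub>o Z)"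
    using tmor_madd_right[OF assms mzero_in[OF assms(2,3)] mzero_in[OF assms(2,3)]] z assms
      tmor_in[OF assms(1,1,2,3) Id_in[OF assms(1)] mzero_in[OF assms(2,3)]]
    by (intro madd_self) simp_all
  show "mzero M Y Z \<otimes>\<^sub>m Id M X = mzero M (Y \<otimes>\<^sub>o X) (Z \<otimes>\<^sub>o X)"
    using tmor_madd_left[OF assms mzero_in[OF assms(2,3)] mzero_in[OF assms(2,3)]] z assms
      tmor_in[OF assms(2,3,1,1) mzero_in[OF assms(2,3)] Id_in[OF assms(1)]]
    by (intro madd_self) simp_all
qed

lemma act_in:
  assumes "B \<in> Ob BM"
  shows "fst (snd B) \<in> Hom M (A \<otimes>\<^sub>o fst B) (fst B)" "snd (snd B) \<in> Hom M (fst B \<otimes>\<^sub>o A) (fst B)"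
  using lmodD(2)[OF bimodD(1)[OF assms[unfolded Bimod_Ob_iff]]]
    rmodD(2)[OF bimodD(2)[OF assms[unfolded Bimod_Ob_iff]]]
  by (simp_all add: lact_def ract_def arr_Arrow)

section \<open>Additive structure, kernels and split epimorphisms of bimodules\<close>

lemma subgroup_Bimod_Hom:
  assumes B: "B \<in> Ob BM" and B': "B' \<in> Ob BM"
  shows "subgroup (Hom BM B B') (hom_group M (fst B) (fst B'))"
proof -
  note [simp] = Bimod_Ob[OF B] Bimod_Ob[OF B']
  let ?X = "fst B" and ?Y = "fst B'"
  let ?l = "fst (snd B)" and ?r = "snd (snd B)" and ?l' = "fst (snd B')" and ?r' = "snd (snd B')"
  let ?G = "hom_group M ?X ?Y"
  note act = act_in[OF B] act_in[OF B']
  have tl: "Id M A \<otimes>\<^sub>m f \<in> Hom M (A \<otimes>\<^sub>o ?X) (A \<otimes>\<^sub>o ?Y)" if "f \<in> Hom M ?X ?Y" for f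
    using tmor_in[of A A ?X ?Y "Id M A" f] that Id_in[of A] by simp
  have tr: "f \<otimes>\<^sub>m Id M A \<in> Hom M (?X \<otimes>\<^sub>o A) (?Y \<otimes>\<^sub>o A)" if "f \<in> Hom M ?X ?Y" for f
    using tmor_in[of ?X ?Y A A f "Id M A"] that Id_in[of A] by simp
  have L: "group_hom ?G (hom_group M (A \<otimes>\<^sub>o ?X) ?Y) (\<lambda>f. ?l' \<cdot> (Id M A \<otimes>\<^sub>m f))"
    using hom_comm_group[of ?X ?Y] hom_comm_group[of "A \<otimes>\<^sub>o ?X" ?Y] tl act(3)
      comp_in[of "A \<otimes>\<^sub>o ?X" "A \<otimes>\<^sub>o ?Y" ?Y] comp_madd_right[of "A \<otimes>\<^sub>o ?X" "A \<otimes>\<^sub>o ?Y" ?Y]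
      tmor_madd_right[of A ?X ?Y]
    by (auto simp: group_hom_def group_hom_axioms_def hom_def comm_group.axioms(2))
  have R: "group_hom ?G (hom_group M (?X \<otimes>\<^sub>o A) ?Y) (\<lambda>f. ?r' \<cdot> (f \<otimes>\<^sub>m Id M A))"
    using hom_comm_group[of ?X ?Y] hom_comm_group[of "?X \<otimes>\<^sub>o A" ?Y] tr act(4)
      comp_in[of "?X \<otimes>\<^sub>o A" "?Y \<otimes>\<^sub>o A" ?Y] comp_madd_right[of "?X \<otimes>\<^sub>o A" "?Y \<otimes>\<^sub>o A" ?Y]
      tmor_madd_left[of A ?X ?Y]
    by (auto simp: group_hom_def group_hom_axioms_def hom_def comm_group.axioms(2))
  \<comment> \<open>Each linearity condition equates two additive functions of \<open>f\<close>;
    \<open>L\<close> and \<open>R\<close> are where additivity of the tensor product enters.\<close>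
  have "Hom BM B B' = {f \<in> carrier ?G. f \<cdot> ?l = ?l' \<cdot> (Id M A \<otimes>\<^sub>m f)} \<inter>
      {f \<in> carrier ?G. f \<cdot> ?r = ?r' \<cdot> (f \<otimes>\<^sub>m Id M A)}"
    by (cases B; cases B') (auto simp: Bimod_def bimod_hom_def)
  moreover have "group ?G" using hom_comm_group[of ?X ?Y] by (simp add: comm_group.axioms(2))
  ultimately show ?thesis
    using group.subgroups_Inter_pair[OF _ subgroup_equalizer[OF precompose_group_hom L]
        subgroup_equalizer[OF precompose_group_hom R]] act by simp
qed

lemma preadditive_Bimod: "preadditive_cat BM"
proof (intro preadditive_cat.intro cat.intro preadditive_cat_axioms.intro)
  fix B assume B: "B \<in> Ob BM"
  show "Id BM B \<in> Hom BM B B"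
    using blin_idt[of "fst B"] B by (simp add: Bimod_Hom_iff Bimod_Ob_iff idt_def)
next
  fix B B' B'' f g
  assume B: "B \<in> Ob BM" "B' \<in> Ob BM" "B'' \<in> Ob BM" and f: "f \<in> Hom BM B B'" and g: "g \<in> Hom BM B' B''"
  show "g \<cdot>\<^bsub>BM\<^esub> f \<in> Hom BM B B''"
    using blin_cmp[of "fst B" "lact B" "ract B" "fst B'" "lact B'" "ract B'" "fst B''" "lact B''" "ract B''"
        "Arrow (fst B) (fst B') f" "Arrow (fst B') (fst B'') g"] B f g
    by (simp add: Bimod_Hom_iff) (simp add: Bimod_Ob_iff cmp_def)
next
  fix B B' f assume "B \<in> Ob BM" "B' \<in> Ob BM" "f \<in> Hom BM B B'"
  then show "f \<cdot>\<^bsub>BM\<^esub> Id BM B = f" "Id BM B' \<cdot>\<^bsub>BM\<^esub> f = f"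
    using comp_Id[of "fst B" "fst B'" f] Id_comp[of "fst B" "fst B'" f] Bimod_Hom_in by simp_all
next
  fix B B' B'' B''' f g h
  assume "B \<in> Ob BM" "B' \<in> Ob BM" "B'' \<in> Ob BM" "B''' \<in> Ob BM"
    "f \<in> Hom BM B B'" "g \<in> Hom BM B' B''" "h \<in> Hom BM B'' B'''"
  then show "h \<cdot>\<^bsub>BM\<^esub> g \<cdot>\<^bsub>BM\<^esub> f = h \<cdot>\<^bsub>BM\<^esub> (g \<cdot>\<^bsub>BM\<^esub> f)"
    using comp_assoc[of "fst B" "fst B'" "fst B''" "fst B'''" f g h] Bimod_Hom_in by simp
next
  fix B B' assume B: "B \<in> Ob BM" "B' \<in> Ob BM"
  have "hom_group BM B B' = hom_group M (fst B) (fst B')\<lparr>carrier := Hom BM B B'\<rparr>"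
    by (simp add: hom_group_def)
  then show "comm_group (hom_group BM B B')"
    using comm_group.subgroup_comm_group[OF hom_comm_group subgroup_Bimod_Hom] B by simp
next
  fix B B' B'' f f' g
  assume "B \<in> Ob BM" "B' \<in> Ob BM" "B'' \<in> Ob BM" "f \<in> Hom BM B B'" "f' \<in> Hom BM B B'" "g \<in> Hom BM B' B''"
  then show "g \<cdot>\<^bsub>BM\<^esub> madd BM f f' = madd BM (g \<cdot>\<^bsub>BM\<^esub> f) (g \<cdot>\<^bsub>BM\<^esub> f')"
    using comp_madd_right[of "fst B" "fst B'" "fst B''" f f' g] Bimod_Hom_in by simp
next
  fix B B' B'' f g g'
  assume "B \<in> Ob BM" "B' \<in> Ob BM" "B'' \<in> Ob BM" "f \<in> Hom BM B B'" "g \<in> Hom BM B' B''" "g' \<in> Hom BM B' B''"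
  then show "madd BM g g' \<cdot>\<^bsub>BM\<^esub> f = madd BM (g \<cdot>\<^bsub>BM\<^esub> f) (g' \<cdot>\<^bsub>BM\<^esub> f)"
    using comp_madd_left[of "fst B" "fst B'" "fst B''" f g g'] Bimod_Hom_in by simp
qed

lemma mono_cancel:
  assumes "is_mono M K X k" "K \<in> Ob M" "X \<in> Ob M" "arr f" "arr g" "tgt f = K" "tgt g = K" "src f = src g"
    "Arrow K X k \<star> f = Arrow K X k \<star> g"
  shows "f = g"
proof -
  have "mor f = mor g"
    using assms unfolding is_mono_def arr_def by (auto simp: cmp_def)
  then show ?thesis using assms by (simp add: arrow.expand)
qed

text \<open>Linearity of \<open>h\<close> is an equation between arrows ending in \<open>K\<close>,
  so it may be tested after composition with \<open>k\<close>.\<close>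

lemma blin_through_mono:
  assumes W: "bimod W lw rw" and K: "bimod K lk rk" and X: "bimod X l r"
    and k: "blin lk rk l r k" and h: "arr h" "src h = W" "tgt h = K" and kh: "blin lw rw l r (k \<star> h)"
    and mono: "\<And>f g. \<lbrakk>arr f; arr g; tgt f = K; tgt g = K; src f = src g; k \<star> f = k \<star> g\<rbrakk> \<Longrightarrow> f = g"
  shows "blin lw rw lk rk h"
proof -
  have k': "llin lk l k" "rlin rk r k" and kh': "llin lw l (k \<star> h)" "rlin rw r (k \<star> h)"
    using k kh by (simp_all add: blin_def)
  note [simp] = lmodD(1-4)[OF bimodD(1)[OF W]] lmodD(1-4)[OF bimodD(1)[OF K]]
    lmodD(1-4)[OF bimodD(1)[OF X]] rmodD(2-4)[OF bimodD(2)[OF W]] rmodD(2-4)[OF bimodD(2)[OF K]]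
    rmodD(2-4)[OF bimodD(2)[OF X]] h llinD(1-3)[OF k'(1)]
  have "k \<star> h \<star> lw = k \<star> lk \<star> (idt A \<boxtimes> h)"
    using llinD(4)[OF kh'(1)] by (simp add: tens_cmp_right cmp_pre[OF llinD(4)[OF k'(1)]])
  then have "h \<star> lw = lk \<star> (idt A \<boxtimes> h)" by - (rule mono, simp_all)
  moreover have "k \<star> h \<star> rw = k \<star> rk \<star> (h \<boxtimes> idt A)"
    using rlinD(4)[OF kh'(2)] by (simp add: tens_cmp_left cmp_pre[OF rlinD(4)[OF k'(2)]])
  then have "h \<star> rw = rk \<star> (h \<boxtimes> idt A)" by - (rule mono, simp_all)
  ultimately show ?thesis by (simp add: blin_def llin_def rlin_def)
qed

text \<open>The second conjunct records that the forgetful functor preserves this kernel. It allows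
  maps of \<open>M\<close> that are not bilinear to be factored through it.\<close>

lemma Bimod_kernel:
  assumes B: "B \<in> Ob BM" and B': "B' \<in> Ob BM" and f: "f \<in> Hom BM B B'"
  shows "\<exists>K k. is_kernel BM B B' f K k \<and> is_kernel M (fst B) (fst B') f (fst K) k"
proof -
  interpret BM: preadditive_cat BM by (rule preadditive_Bimod)
  let ?X = "fst B" and ?Y = "fst B'"
  note X = Bimod_Ob[OF B] and Y = Bimod_Ob[OF B']
  note fM = Bimod_Hom_in[OF B B' f]
  obtain K k where K: "is_kernel M ?X ?Y f K k" using ex_kernel[OF X Y fM] by blast
  note k = is_kernelD(1-3)[OF K]
  note mono = kernel_is_mono[OF K X Y fM]
  let ?k = "Arrow K ?X k" and ?f = "Arrow ?X ?Y f"
  note bB = B[unfolded Bimod_Ob_iff] and bB' = B'[unfolded Bimod_Ob_iff]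
  have fb: "llin (lact B) (lact B') ?f" "rlin (ract B) (ract B') ?f"
    using f Bimod_Hom_iff[OF B B'] by (simp_all add: blin_def)
  have [simp]: "arr ?k" "arr ?f" using k X Y fM by (simp_all add: arr_Arrow)
  note [simp] = k(1) X Y lmodD(2-4)[OF bimodD(1)[OF bB]] lmodD(2-4)[OF bimodD(1)[OF bB']]
    rmodD(2-4)[OF bimodD(2)[OF bB]] rmodD(2-4)[OF bimodD(2)[OF bB']]
  have fk: "?f \<star> ?k = Arrow K ?Y (mzero M K ?Y)" using k(3) by (simp add: cmp_def)
  have z: "l \<star> (idt A \<boxtimes> Arrow K ?Y (mzero M K ?Y)) = Arrow (A \<otimes>\<^sub>o K) ?Y (mzero M (A \<otimes>\<^sub>o K) ?Y)"
    if "arr l" "src l = A \<otimes>\<^sub>o ?Y" "tgt l = ?Y" for l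
    using that comp_mzero[of "A \<otimes>\<^sub>o K" "A \<otimes>\<^sub>o ?Y" ?Y "mor l"] tmor_mzero(1)[of A K ?Y]
    unfolding arr_def by (simp add: cmp_def tens_def)
  have z': "l \<star> (Arrow K ?Y (mzero M K ?Y) \<boxtimes> idt A) = Arrow (K \<otimes>\<^sub>o A) ?Y (mzero M (K \<otimes>\<^sub>o A) ?Y)"
    if "arr l" "src l = ?Y \<otimes>\<^sub>o A" "tgt l = ?Y" for l
    using that comp_mzero[of "K \<otimes>\<^sub>o A" "?Y \<otimes>\<^sub>o A" ?Y "mor l"] tmor_mzero(2)[of A K ?Y]
    unfolding arr_def by (simp add: cmp_def tens_def)
  \<comment> \<open>In elements, \<open>f(a k(x)) = a f(k(x)) = 0\<close>, so acting on
    \<open>K\<close> stays in the kernel. The factorization through \<open>k\<close> is the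
    restricted action.\<close>
  have "?f \<star> (lact B \<star> (idt A \<boxtimes> ?k)) = lact B' \<star> (idt A \<boxtimes> (?f \<star> ?k))"
    by (rule llin_ext[OF bimodD(1)[OF bB] bimodD(1)[OF bB'] fb(1)]) simp_all
  then have "f \<cdot> mor (lact B \<star> (idt A \<boxtimes> ?k)) = mzero M (A \<otimes>\<^sub>o K) ?Y"
    unfolding fk by (simp add: z) (simp add: cmp_def)
  moreover have "mor (lact B \<star> (idt A \<boxtimes> ?k)) \<in> Hom M (A \<otimes>\<^sub>o K) ?X"
    using arr_mor[of "lact B \<star> (idt A \<boxtimes> ?k)"] by simp
  ultimately obtain l where l: "l \<in> Hom M (A \<otimes>\<^sub>o K) K" "k \<cdot> l = mor (lact B \<star> (idt A \<boxtimes> ?k))"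
    using is_kernelD(4)[OF K, of "A \<otimes>\<^sub>o K"] by auto
  have "?f \<star> (ract B \<star> (?k \<boxtimes> idt A)) = ract B' \<star> ((?f \<star> ?k) \<boxtimes> idt A)"
    by (rule rlin_ext[OF bimodD(2)[OF bB] bimodD(2)[OF bB'] fb(2)]) simp_all
  then have "f \<cdot> mor (ract B \<star> (?k \<boxtimes> idt A)) = mzero M (K \<otimes>\<^sub>o A) ?Y"
    unfolding fk by (simp add: z') (simp add: cmp_def)
  moreover have "mor (ract B \<star> (?k \<boxtimes> idt A)) \<in> Hom M (K \<otimes>\<^sub>o A) ?X"
    using arr_mor[of "ract B \<star> (?k \<boxtimes> idt A)"] by simp
  ultimately obtain r where r: "r \<in> Hom M (K \<otimes>\<^sub>o A) K" "k \<cdot> r = mor (ract B \<star> (?k \<boxtimes> idt A))"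
    using is_kernelD(4)[OF K, of "K \<otimes>\<^sub>o A"] by auto
  let ?K = "(K, l, r)"
  have kl: "?k \<star> lact ?K = lact B \<star> (idt A \<boxtimes> ?k)" and kr: "?k \<star> ract ?K = ract B \<star> (?k \<boxtimes> idt A)"
    using l r by (simp_all add: arrow.expand lact_def ract_def)
  have al [simp]: "arr (lact ?K)" "src (lact ?K) = A \<otimes>\<^sub>o K" "tgt (lact ?K) = K"
    and ar [simp]: "arr (ract ?K)" "src (ract ?K) = K \<otimes>\<^sub>o A" "tgt (ract ?K) = K"
    using l r by (simp_all add: lact_def ract_def arr_Arrow)
  have bK: "bimod K (lact ?K) (ract ?K)"
    by (rule bimod_sub[OF bB _ _ _ _ al kl ar kr]) (use mono_cancel[OF mono k(1) X] in simp_all)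
  then have KO: "?K \<in> Ob BM" by (simp add: Bimod_Ob_iff)
  have kb: "blin (lact ?K) (ract ?K) (lact B) (ract B) ?k"
    using kl kr by (simp add: blin_def llin_def rlin_def)
  then have kH: "k \<in> Hom BM ?K B" using Bimod_Hom_iff[OF KO B] by simp
  have monoB: "is_mono BM ?K B k"
    unfolding is_mono_def
  proof (intro conjI ballI impI)
    fix W g h assume W: "W \<in> Ob BM" and g: "g \<in> Hom BM W ?K" and h: "h \<in> Hom BM W ?K"
      and "k \<cdot>\<^bsub>BM\<^esub> g = k \<cdot>\<^bsub>BM\<^esub> h"
    then have "k \<cdot> g = k \<cdot> h" "g \<in> Hom M (fst W) K" "h \<in> Hom M (fst W) K"
      using Bimod_Hom_in[OF W KO g] Bimod_Hom_in[OF W KO h] by simp_all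
    then show "g = h" using mono Bimod_Ob[OF W] unfolding is_mono_def by blast
  qed (rule kH)
  have "is_kernel BM B B' f ?K k"
  proof (rule BM.is_kernelI_mono[OF f B B' monoB KO])
    show "f \<cdot>\<^bsub>BM\<^esub> k = mzero BM ?K B'" using k(3) by simp
  next
    fix W g assume W: "W \<in> Ob BM" and g: "g \<in> Hom BM W B" and fg: "f \<cdot>\<^bsub>BM\<^esub> g = mzero BM W B'"
    obtain h where h: "h \<in> Hom M (fst W) K" "k \<cdot> h = g"
      using is_kernelD(4)[OF K Bimod_Ob[OF W] Bimod_Hom_in[OF W B g]] fg by auto
    have "blin (lact W) (ract W) (lact ?K) (ract ?K) (Arrow (fst W) K h)"
    proof (rule blin_through_mono[OF _ bK bB kb])
      show "bimod (fst W) (lact W) (ract W)" using W by (simp add: Bimod_Ob_iff)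
      show "arr (Arrow (fst W) K h)" using h W by (simp add: arr_Arrow)
      show "blin (lact W) (ract W) (lact B) (ract B) (?k \<star> Arrow (fst W) K h)"
        using g Bimod_Hom_iff[OF W B] h by (simp add: cmp_def)
    qed (use mono_cancel[OF mono k(1) X] in simp_all)
    then have "h \<in> Hom BM W ?K" using Bimod_Hom_iff[OF W KO] by simp
    then show "\<exists>h\<in>Hom BM W ?K. k \<cdot>\<^bsub>BM\<^esub> h = g" using h by auto
  qed
  then show ?thesis using K by (intro exI[of _ ?K] exI[of _ k]) simp
qed

text \<open>Epimorphy follows from the section: \<open>g = (g e) s\<close> can be computed in
  \<open>M\<close>.\<close>

lemma split_epi_classI:
  assumes B: "B \<in> Ob BM" and B': "B' \<in> Ob BM" and e: "e \<in> Hom BM B B'"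
    and s: "s \<in> Hom M (fst B') (fst B)" "e \<cdot> s = Id M (fst B')"
  shows "split_epi_class M A m u B B' e"
proof -
  note X = Bimod_Ob[OF B] and Y = Bimod_Ob[OF B']
  note eM = Bimod_Hom_in[OF B B' e]
  have "g = h" if Z: "Z \<in> Ob BM" and g: "g \<in> Hom BM B' Z" and h: "h \<in> Hom BM B' Z"
    and eq: "g \<cdot> e = h \<cdot> e" for Z g h
  proof -
    note ZM = Bimod_Ob[OF Z] and gM = Bimod_Hom_in[OF B' Z g] and hM = Bimod_Hom_in[OF B' Z h]
    have "g = g \<cdot> e \<cdot> s"
      using comp_assoc[OF Y X Y ZM s(1) eM gM] s(2) comp_Id[OF Y ZM gM] by simp
    also have "\<dots> = h"
      using comp_assoc[OF Y X Y ZM s(1) eM hM] s(2) comp_Id[OF Y ZM hM] eq by simp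
    finally show ?thesis .
  qed
  then show ?thesis
    using e eM s unfolding split_epi_class_def is_epi_def has_section_def by auto
qed

lemma split_epi_classD:
  assumes "split_epi_class M A m u B B' e"
  shows "is_epi BM B B' e" "e \<in> Hom BM B B'" "\<exists>s\<in>Hom M (fst B') (fst B). e \<cdot> s = Id M (fst B')"
  using assms by (auto simp: split_epi_class_def is_epi_def has_section_def)

lemma split_epi_is_cokernel:
  assumes B: "B \<in> Ob BM" and B': "B' \<in> Ob BM" and E: "split_epi_class M A m u B B' e"
    and K: "is_kernel BM B B' e K k"
  shows "is_cokernel BM K B k B' e"
proof -
  interpret BM: preadditive_cat BM by (rule preadditive_Bimod)
  note X = Bimod_Ob[OF B] and Y = Bimod_Ob[OF B'] and e = split_epi_classD(2)[OF E]
  note eM = Bimod_Hom_in[OF B B' e]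
  obtain s where s: "s \<in> Hom M (fst B') (fst B)" "e \<cdot> s = Id M (fst B')"
    using split_epi_classD(3)[OF E] by blast
  note k = BM.is_kernelD(1-3)[OF K]
  note KO = Bimod_Ob[OF k(1)] and kM = Bimod_Hom_in[OF k(1) B k(2)]
  have se: "s \<cdot> e \<in> Hom M (fst B) (fst B)" by (rule comp_in[OF X Y X eM s(1)])
  \<comment> \<open>\<open>w = Id - s \<cdot> e\<close> is the projection onto the kernel in
    \<open>M\<close>; it need not be bilinear.\<close>
  obtain w where w: "w \<in> Hom M (fst B) (fst B)" "madd M w (s \<cdot> e) = Id M (fst B)"
    using ex_difference[OF X X Id_in[OF X] se] by blast
  have "madd M (e \<cdot> w) e = e \<cdot> madd M w (s \<cdot> e)"
    using comp_madd_right[OF X X Y w(1) se eM] comp_assoc[OF X Y X Y eM s(1) eM] s(2) Id_comp[OF X Y eM] by simp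
  also have "\<dots> = madd M (mzero M (fst B) (fst B')) e"
    using w(2) comp_Id[OF X Y eM] madd_mzero[OF X Y eM] by simp
  finally have ew: "e \<cdot> w = mzero M (fst B) (fst B')"
    using madd_cancel[OF X Y comp_in[OF X X Y w(1) eM] mzero_in[OF X Y] eM] by blast
  \<comment> \<open>The given \<open>K\<close> is a kernel among bimodules. \<open>K'\<close> is
    also one in \<open>M\<close>, so \<open>w\<close> factors through it, and \<open>t\<close>
    carries the factorization over to \<open>K\<close>.\<close>
  obtain K' k' where K': "is_kernel BM B B' e K' k'" and KM: "is_kernel M (fst B) (fst B') e (fst K') k'"
    using Bimod_kernel[OF B B' e] by blast
  note k' = BM.is_kernelD(1-3)[OF K']
  note KO' = Bimod_Ob[OF k'(1)]
  obtain t where t: "t \<in> Hom BM K' K" "k \<cdot> t = k'"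
    using BM.is_kernelD(4)[OF K k'] by auto
  note tM = Bimod_Hom_in[OF k'(1) k(1) t(1)]
  obtain v where v: "v \<in> Hom M (fst B) (fst K')" "k' \<cdot> v = w"
    using is_kernelD(4)[OF KM X w(1) ew] by blast
  have tv: "t \<cdot> v \<in> Hom M (fst B) (fst K)" by (rule comp_in[OF X KO' KO v(1) tM])
  have wk: "w = k \<cdot> (t \<cdot> v)"
    using comp_assoc[OF X KO' KO X v(1) tM kM] t(2) v(2) by simp
  have "\<exists>!h. h \<in> Hom BM B' Z \<and> h \<cdot> e = g"
    if Z: "Z \<in> Ob BM" and g: "g \<in> Hom BM B Z" and gk: "g \<cdot> k = mzero M (fst K) (fst Z)" for Z g
  proof -
    note ZO = Bimod_Ob[OF Z] and gM = Bimod_Hom_in[OF B Z g]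
    \<comment> \<open>Since \<open>g\<close> kills the kernel it kills \<open>w\<close>, so
      \<open>g = g s e\<close>; then \<open>blin_descend\<close> makes \<open>g s\<close>
      bilinear.\<close>
    let ?h = "g \<cdot> s"
    have hM: "?h \<in> Hom M (fst B') (fst Z)" by (rule comp_in[OF Y X ZO s(1) gM])
    have gw: "g \<cdot> w = mzero M (fst B) (fst Z)"
      using comp_assoc[OF X KO X ZO tv kM gM] wk gk mzero_comp[OF X KO ZO tv] by simp
    have he: "?h \<cdot> e = g"
    proof -
      have "g = g \<cdot> madd M w (s \<cdot> e)" using w(2) comp_Id[OF X ZO gM] by simp
      also have "\<dots> = g \<cdot> (s \<cdot> e)"
        using comp_madd_right[OF X X ZO w(1) se gM] gw madd_mzero[OF X ZO comp_in[OF X X ZO se gM]] by simp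
      finally show ?thesis using comp_assoc[OF X Y X ZO eM s(1) gM] by simp
    qed
    have "blin (lact B') (ract B') (lact Z) (ract Z) (Arrow (fst B') (fst Z) ?h)"
    proof (rule blin_descend[OF B[unfolded Bimod_Ob_iff] B'[unfolded Bimod_Ob_iff] Z[unfolded Bimod_Ob_iff]])
      show "blin (lact B) (ract B) (lact B') (ract B') (Arrow (fst B) (fst B') e)"
        using e Bimod_Hom_iff[OF B B'] by simp
      show "arr (Arrow (fst B') (fst B) s)" using s X Y by (simp add: arr_Arrow)
      show "Arrow (fst B) (fst B') e \<star> Arrow (fst B') (fst B) s = idt (fst B')"
        using s by (simp add: cmp_def idt_def)
      show "arr (Arrow (fst B') (fst Z) ?h)" using hM Y ZO by (simp add: arr_Arrow)
      show "blin (lact B) (ract B) (lact Z) (ract Z) (Arrow (fst B') (fst Z) ?h \<star> Arrow (fst B) (fst B') e)"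
        using g Bimod_Hom_iff[OF B Z] he by (simp add: cmp_def)
    qed simp_all
    then have hB: "?h \<in> Hom BM B' Z" using Bimod_Hom_iff[OF B' Z] by simp
    show ?thesis
    proof (rule ex1I[of _ ?h])
      show "?h \<in> Hom BM B' Z \<and> ?h \<cdot> e = g" using hB he by simp
      fix h assume "h \<in> Hom BM B' Z \<and> h \<cdot> e = g"
      then show "h = ?h"
        using split_epi_classD(1)[OF E] Z hB he unfolding is_epi_def by auto
    qed
  qed
  then show ?thesis
    using B' e k(3) unfolding is_cokernel_def by simp
qed

text \<open>Restates the lifting problem for arrows with the section in \<open>M\<close> given as
  data, the common shape of \<open>section_lift\<close> and \<open>free_lift\<close>.\<close>

lemma E_projectiveI:
  assumes P: "P \<in> Ob BM"
    and lift: "\<And>B B' e s f. \<lbrakk>B \<in> Ob BM; B' \<in> Ob BM; blin (lact B) (ract B) (lact B') (ract B') e;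
      arr s; src s = fst B'; tgt s = fst B; e \<star> s = idt (fst B'); blin (lact P) (ract P) (lact B') (ract B') f\<rbrakk>
      \<Longrightarrow> \<exists>g. blin (lact P) (ract P) (lact B) (ract B) g \<and> e \<star> g = f"
  shows "E_projective BM (split_epi_class M A m u) P"
proof -
  interpret BM: preadditive_cat BM by (rule preadditive_Bimod)
  have "(\<lambda>g. e \<cdot> g) ` Hom BM P B = Hom BM P B'"
    if B: "B \<in> Ob BM" and B': "B' \<in> Ob BM" and E: "split_epi_class M A m u B B' e" for B B' e
  proof
    note e = split_epi_classD(2)[OF E]
    show "(\<lambda>g. e \<cdot> g) ` Hom BM P B \<subseteq> Hom BM P B'"
      using BM.comp_in[OF P B B' _ e] by auto
    show "Hom BM P B' \<subseteq> (\<lambda>g. e \<cdot> g) ` Hom BM P B"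
    proof
      fix f assume f: "f \<in> Hom BM P B'"
      obtain s where s: "s \<in> Hom M (fst B') (fst B)" "e \<cdot> s = Id M (fst B')"
        using split_epi_classD(3)[OF E] by blast
      have "\<exists>g. blin (lact P) (ract P) (lact B) (ract B) g \<and>
          Arrow (fst B) (fst B') e \<star> g = Arrow (fst P) (fst B') f"
      proof (rule lift[OF B B', of _ "Arrow (fst B') (fst B) s"])
        show "blin (lact B) (ract B) (lact B') (ract B') (Arrow (fst B) (fst B') e)"
          using e Bimod_Hom_iff[OF B B'] by simp
        show "blin (lact P) (ract P) (lact B') (ract B') (Arrow (fst P) (fst B') f)"
          using f Bimod_Hom_iff[OF P B'] by simp
      qed (use s B B' in \<open>simp_all add: arr_Arrow cmp_def idt_def\<close>)
      then obtain g where g: "blin (lact P) (ract P) (lact B) (ract B) g"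
        "Arrow (fst B) (fst B') e \<star> g = Arrow (fst P) (fst B') f" by blast
      have "mor g \<in> Hom BM P B" using Bimod_HomI(2)[OF P B g(1)] .
      moreover have "e \<cdot> mor g = f" using g(2) by (simp add: cmp_def)
      ultimately show "f \<in> (\<lambda>g. e \<cdot> g) ` Hom BM P B" by blast
    qed
  qed
  then show ?thesis using P unfolding E_projective_def by simp
qed

section \<open>Enough projectives among bimodules\<close>

definition free_bimod :: "'o \<Rightarrow> 'o \<times> 'm \<times> 'm" where
  "free_bimod X = ((A \<otimes>\<^sub>o X) \<otimes>\<^sub>o A, mor (free_l X), mor (free_r X))"

lemma free_bimod_act:
  "fst (free_bimod X) = (A \<otimes>\<^sub>o X) \<otimes>\<^sub>o A" "lact (free_bimod X) = free_l X" "ract (free_bimod X) = free_r X"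
  by (simp_all add: free_bimod_def lact_def ract_def free_l_def free_r_def free_left_def arrow.expand)

lemma free_bimod_projective:
  assumes X: "X \<in> Ob M"
  shows "E_projective BM (split_epi_class M A m u) (free_bimod X)"
proof (rule E_projectiveI)
  show "free_bimod X \<in> Ob BM" using bimod_free[OF X] by (simp add: Bimod_Ob_iff free_bimod_act)
qed (use free_lift[OF X] in \<open>simp add: Bimod_Ob_iff free_bimod_act\<close>)

lemma relative_Bimod: "relative_cat BM (split_epi_class M A m u)"
proof -
  interpret BM: preadditive_cat BM by (rule preadditive_Bimod)
  show ?thesis
  proof unfold_locales
    fix B B' f assume "B \<in> Ob BM" "B' \<in> Ob BM" "f \<in> Hom BM B B'"
    then show "\<exists>K k. is_kernel BM B B' f K k" using Bimod_kernel by blast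
  next
    fix B B' e assume "split_epi_class M A m u B B' e"
    then show "is_epi BM B B' e" by (rule split_epi_classD(1))
  next
    fix B B' e K k
    assume "B \<in> Ob BM" "B' \<in> Ob BM" "split_epi_class M A m u B B' e" "is_kernel BM B B' e K k"
    then show "is_cokernel BM K B k B' e" by (rule split_epi_is_cokernel)
  next
    fix B assume B: "B \<in> Ob BM"
    let ?F = "free_bimod (fst B)"
    have P: "E_projective BM (split_epi_class M A m u) ?F"
      using free_bimod_projective B by simp
    then have F: "?F \<in> Ob BM" by (simp add: E_projective_def)
    obtain e s where e: "blin (lact ?F) (ract ?F) (lact B) (ract B) e"
      and s: "arr s" "src s = fst B" "tgt s = fst ?F" "e \<star> s = idt (fst B)"
      using free_counit[OF B[unfolded Bimod_Ob_iff]] by (auto simp: free_bimod_act)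
    have "mor e \<cdot> mor s = Id M (fst B)"
      using s(4) by (metis mor_cmp mor_idt)
    moreover have "mor s \<in> Hom M (fst B) (fst ?F)" using arr_mor[OF s(1)] s by simp
    ultimately have "split_epi_class M A m u ?F B (mor e)"
      using split_epi_classI[OF F B Bimod_HomI(2)[OF F B e]] by blast
    then show "\<exists>P e. E_projective BM (split_epi_class M A m u) P \<and> split_epi_class M A m u P B e"
      using P by blast
  qed
qed

section \<open>Separability and projectivity of the regular bimodule\<close>

lemma regular_bimod_act:
  "fst (regular_bimod A m) = A" "lact (regular_bimod A m) = mm" "ract (regular_bimod A m) = mm"
  by (simp_all add: regular_bimod_def lact_def ract_def mm_def)

lemma tensor_square_bimod_act:
  "fst (tensor_square_bimod M A m) = A \<otimes>\<^sub>o A"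
  "lact (tensor_square_bimod M A m) = (mm \<boxtimes> idt A) \<star> assoc' A A A"
  "ract (tensor_square_bimod M A m) = (idt A \<boxtimes> mm) \<star> assoc A A A"
  by (simp_all add: tensor_square_bimod_def lact_def ract_def arrow.expand)

lemma regular_bimod_Ob: "regular_bimod A m \<in> Ob BM"
  using bimod_regular by (simp add: Bimod_Ob_iff regular_bimod_act)

lemma tensor_square_bimod_Ob: "tensor_square_bimod M A m \<in> Ob BM"
  using bimod_tens[OF lmod_regular rmod_regular] by (simp add: Bimod_Ob_iff tensor_square_bimod_act)

theorem separable_iff_projective:
  "separable M A m u \<longleftrightarrow> E_projective BM (split_epi_class M A m u) (regular_bimod A m)"
proof
  let ?R = "regular_bimod A m" and ?T = "tensor_square_bimod M A m"
  note R = regular_bimod_Ob and T = tensor_square_bimod_Ob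
  assume "separable M A m u"
  then obtain s where s: "s \<in> Hom BM ?R ?T" "m \<cdot> s = Id M A"
    by (auto simp: separable_def has_section_def regular_bimod_act)
  let ?s = "Arrow A (A \<otimes>\<^sub>o A) s"
  have "blin mm mm ((mm \<boxtimes> idt A) \<star> assoc' A A A) ((idt A \<boxtimes> mm) \<star> assoc A A A) ?s"
    using s(1) unfolding Bimod_Hom_iff[OF R T] by (simp add: regular_bimod_act tensor_square_bimod_act)
  moreover have "mm \<star> ?s = idt A" using s(2) by (simp add: cmp_def idt_def)
  ultimately show "E_projective BM (split_epi_class M A m u) ?R"
    using section_lift[of ?s] by (intro E_projectiveI[OF R]) (simp add: Bimod_Ob_iff regular_bimod_act)
next
  let ?R = "regular_bimod A m" and ?T = "tensor_square_bimod M A m"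
  note R = regular_bimod_Ob and T = tensor_square_bimod_Ob
  interpret rel: relative_cat BM "split_epi_class M A m u" by (rule relative_Bimod)
  assume P: "E_projective BM (split_epi_class M A m u) ?R"
  have m: "m \<in> Hom BM ?T ?R"
    using blin_mult unfolding Bimod_Hom_iff[OF T R]
    by (simp add: regular_bimod_act tensor_square_bimod_act mm_def)
  \<comment> \<open>In elements \<open>a \<mapsto> a \<otimes> 1\<close>, a section of
    \<open>m\<close> in \<open>M\<close> by the right unit law, so \<open>m\<close> belongs to the
    class of split epimorphisms.\<close>
  let ?s = "(idt A \<boxtimes> uu) \<star> runit' A"
  have "mm \<star> ?s = idt A" using cmp_pre[OF rmodD(6)[OF rmod_regular], of "runit' A"] by simp
  then have "m \<cdot> mor ?s = Id M A" by (metis mm_uu(5) mor_cmp mor_idt)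
  moreover have "mor ?s \<in> Hom M A (A \<otimes>\<^sub>o A)"
    using arr_mor[of ?s] by simp
  ultimately have "split_epi_class M A m u ?T ?R m"
    using split_epi_classI[OF T R m, of "mor ?s"] by (simp add: regular_bimod_act tensor_square_bimod_act)
  \<comment> \<open>A bimodule section of \<open>m\<close> is a lift of the identity of
    \<open>A\<close> along \<open>m\<close>.\<close>
  then obtain g where "g \<in> Hom BM ?R ?T" "m \<cdot> g = Id M A"
    using rel.E_projective_lift[OF P T R _ rel.Id_in[OF R]] by (auto simp: regular_bimod_act)
  then show "separable M A m u"
    using m by (auto simp: separable_def has_section_def regular_bimod_act)
qed

end

theorem theorem2p4:
  fixes M :: "('o, 'm) moncat" and A :: 'o and m u :: 'm
  assumes "abelian_monoidal_cat M" and "algebra_in M A m u"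
  shows "(separable M A m u \<longleftrightarrow>
            (\<forall>B\<in>Ob (Bimod M A m u). trivial_group (Hochschild M A m u 1 B))) \<and>
         (separable M A m u \<longleftrightarrow>
            (\<forall>B\<in>Ob (Bimod M A m u). \<forall>n>0. trivial_group (Hochschild M A m u n B)))"
proof -
  interpret abelian_algebra M A m u
    using assms by (rule abelian_algebra.intro)
  interpret rel: relative_cat "Bimod M A m u" "split_epi_class M A m u"
    by (rule relative_Bimod)
  show ?thesis
    unfolding separable_iff_projective Hochschild_def
    using rel.projective_iff_Ext_trivial[OF regular_bimod_Ob] by blast
qed

end
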